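(* Let $\mathcal{P}: A_0,\dots,A_{n-1}$ be a closed path polyomino and let $K$ be a field. Then the polyomino ideal $I_{\mathcal{P}}\subset S=K[x_a\mid a\in V(\mathcal{P})]$ is a Knutson ideal.
   Context: $\mathbb{N}$ is the set of nonnegative integers, and $(i,j)\le (k,l)$ in $\mathbb{N}^2$ means $i\le k$ and $j\le l$. For $a=(i,j)\le b=(k,l)$ put $[a,b]=\{m\in\mathbb{N}^2: a\le m\le b\}$; it is a proper interval if $i<k$ and $j<l$. The anti-diagonal vertices of a proper interval are $(i,l)$ and $(k,j)$. A cell is $C=[a,a+(1,1)]$; $V(C)$ is the set of its four vertices and its edges are the four pairs of adjacent vertices. For a finite collection of cells $\mathcal{P}$ in $(\mathbb{N}\setminus\{0\})^2$, $V(\mathcal{P})=\bigcup_{C\in\mathcal{P}}V(C)$. Closed path polyomino: a finite non-empty collection of cells $\mathcal{P}$ is a closed path polyomino if it is a sequence of cells $A_0,\dots,A_n$ with $n\ge 6$ such that: (1) $A_0=A_n$; (2) $A_i\ne A_j$ for all $i\neq j$ with $i,j\in\{1,\dots,n\}$; (3) $A_i\cap A_{i+1}$ is a common edge for all $i\in\{0,\dots,n-1\}$; (4) $V(A_i)\cap V(A_j)=\emptyset$ for all $i\in\{0,\dots,n-1\}$ and all $j\notin\{i-2,i-1,i,i+1,i+2\}$, where the indices are reduced modulo $n$. An inner interval of $\mathcal{P}$ is a proper interval $[a,b]$ with $a,b\in V(\mathcal{P})$ all of whose cells belong to $\mathcal{P}$. $I_{\mathcal{P}}$ is the ideal of $S=K[x_a\mid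 a\in V(\mathcal{P})]$ generated by all binomials $x_ax_b-x_cx_d$, where $[a,b]$ ranges over the inner intervals of $\mathcal{P}$ and $c,d$ are the anti-diagonal vertices of $[a,b]$. Knutson ideals: let $f\in S$ be such that $\operatorname{in}_<(f)$ is a square-free monomial for some monomial order $<$ on $S$. $\mathcal{C}_f$ is the smallest set of ideals of $S$ such that: (1) $(f)\in\mathcal{C}_f$; (2) if $I\in\mathcal{C}_f$ and $J$ is any ideal of $S$, then $I:J\in\mathcal{C}_f$; (3) if $I,J\in\mathcal{C}_f$, then $I+J\in\mathcal{C}_f$ and $I\cap J\in\mathcal{C}_f$. An ideal is a Knutson ideal if it lies in $\mathcal{C}_f$ for some such $f$. *)

theory Defs
  imports
    "HOL-Algebra.Ideal"
    "HOL-Library.Poly_Mapping"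
    "HOL-Library.Product_Order"
    "HOL-Library.Product_Plus"
begin

type_synonym point = "nat \<times> nat"

text \<open>
  With the componentwise order of \<^theory>\<open>HOL-Library.Product_Order\<close>, the interval
  \<open>[a, b]\<close> is \<open>{a..b}\<close>. A cell is identified with the set of lattice points it contains,
  i.e. \<open>V(C) = C\<close> for a cell \<open>C\<close>.
\<close>

definition proper_interval :: "point \<Rightarrow> point \<Rightarrow> bool" where
  "proper_interval a b \<longleftrightarrow> fst a < fst b \<and> snd a < snd b"

definition cell :: "point \<Rightarrow> point set" where
  "cell a = {a..a + (1, 1)}"

definition adjacent :: "point \<Rightarrow> point \<Rightarrow> bool" where
  "adjacent v w \<longleftrightarrow> w = v + (1, 0) \<or> w = v + (0, 1)"

definition cell_edges :: "point set \<Rightarrow> point set set" where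
  "cell_edges C = {{v, w} | v w. v \<in> C \<and> w \<in> C \<and> adjacent v w}"

definition cell_collection :: "point set set \<Rightarrow> bool" where
  "cell_collection P \<longleftrightarrow>
     finite P \<and> (\<forall>C \<in> P. \<exists>a. C = cell a \<and> 1 \<le> fst a \<and> 1 \<le> snd a)"

definition vertices :: "point set set \<Rightarrow> point set" where
  "vertices P = \<Union> P"

definition closed_path_sequence :: "nat \<Rightarrow> (nat \<Rightarrow> point set) \<Rightarrow> bool" where
  "closed_path_sequence n A \<longleftrightarrow>
     n \<ge> 6 \<and>
     A 0 = A n \<and>
     (\<forall>i \<in> {1..n}. \<forall>j \<in> {1..n}. i \<noteq> j \<longrightarrow> A i \<noteq> A j) \<and>
     (\<forall>i < n. A i \<inter> A (i + 1) \<in> cell_edges (A i) \<inter> cell_edges (A (i + 1))) \<and>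
     (\<forall>i < n. \<forall>j < n.
        (\<forall>d \<in> {-2..2}. int j \<noteq> (int i + d) mod int n) \<longrightarrow> A i \<inter> A j = {})"

definition closed_path_polyomino :: "point set set \<Rightarrow> bool" where
  "closed_path_polyomino P \<longleftrightarrow>
     cell_collection P \<and> P \<noteq> {} \<and> (\<exists>n A. P = A ` {0..n} \<and> closed_path_sequence n A)"

text \<open>All cells of \<open>[a, b]\<close> are the cells contained in \<open>[a, b]\<close> as sets of lattice points.\<close>

definition inner_interval :: "point set set \<Rightarrow> point \<Rightarrow> point \<Rightarrow> bool" where
  "inner_interval P a b \<longleftrightarrow>
     proper_interval a b \<and> a \<in> vertices P \<and> b \<in> vertices P \<and>
     (\<forall>c. cell c \<subseteq> {a..b} \<longrightarrow> cell c \<in> P)"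

text \<open>
  A monomial is its exponent vector, of type \<^typ>\<open>'v \<Rightarrow>\<^sub>0 nat\<close>; a polynomial maps monomials to
  their coefficients, with multiplication the convolution product of
  \<^theory>\<open>HOL-Library.Poly_Mapping\<close>.
\<close>

type_synonym ('v, 'k) mpoly = "('v \<Rightarrow>\<^sub>0 nat) \<Rightarrow>\<^sub>0 'k"

definition monomials_in :: "'v set \<Rightarrow> ('v \<Rightarrow>\<^sub>0 nat) set" where
  "monomials_in V = {m. Poly_Mapping.keys m \<subseteq> V}"

definition poly_ring :: "'v set \<Rightarrow> ('v, 'k::field) mpoly ring" where
  "poly_ring V =
     \<lparr>carrier = {p. Poly_Mapping.keys p \<subseteq> monomials_in V},
      monoid.mult = (*), one = 1, zero = 0, add = (+)\<rparr>"

definition var :: "'v \<Rightarrow> ('v, 'k::field) mpoly" where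
  "var v = Poly_Mapping.single (Poly_Mapping.single v 1) 1"

lemma poly_ring_simps [simp]:
  "carrier (poly_ring V) = {p. Poly_Mapping.keys p \<subseteq> monomials_in V}"
  "monoid.mult (poly_ring V) = (*)"
  "one (poly_ring V) = 1"
  "zero (poly_ring V) = 0"
  "add (poly_ring V) = (+)"
  by (simp_all add: poly_ring_def)

lemma zero_in_monomials_in [simp]: "0 \<in> monomials_in V"
  by (simp add: monomials_in_def)

lemma add_in_monomials_in:
  "m \<in> monomials_in V \<Longrightarrow> u \<in> monomials_in V \<Longrightarrow> m + u \<in> monomials_in V"
  unfolding monomials_in_def using Poly_Mapping.keys_add[of m u] by blast

lemma poly_ring_cring: "cring (poly_ring V :: ('v, 'k::field) mpoly ring)"
proof (rule cringI)
  show "abelian_group (poly_ring V :: ('v, 'k) mpoly ring)"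
  proof (rule abelian_groupI)
    fix x y :: "('v, 'k) mpoly"
    assume "x \<in> carrier (poly_ring V)" "y \<in> carrier (poly_ring V)"
    then show "x \<oplus>\<^bsub>poly_ring V\<^esub> y \<in> carrier (poly_ring V)"
      using Poly_Mapping.keys_add[of x y] by auto
  next
    fix x :: "('v, 'k) mpoly"
    assume "x \<in> carrier (poly_ring V)"
    then show "\<exists>y \<in> carrier (poly_ring V). y \<oplus>\<^bsub>poly_ring V\<^esub> x = \<zero>\<^bsub>poly_ring V\<^esub>"
      by (intro bexI[of _ "- x"]) auto
  qed (auto simp: algebra_simps)
  show "comm_monoid (poly_ring V :: ('v, 'k) mpoly ring)"
  proof (rule comm_monoidI)
    fix x y :: "('v, 'k) mpoly"
    assume "x \<in> carrier (poly_ring V)" "y \<in> carrier (poly_ring V)"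
    then show "x \<otimes>\<^bsub>poly_ring V\<^esub> y \<in> carrier (poly_ring V)"
      using Poly_Mapping.keys_mult[of x y] add_in_monomials_in by fastforce
  qed (auto simp: algebra_simps)
qed (auto simp: algebra_simps)

lemma var_in_poly_ring: "v \<in> V \<Longrightarrow> var v \<in> carrier (poly_ring V)"
  by (simp add: var_def monomials_in_def)

definition monomial_order :: "'v set \<Rightarrow> (('v \<Rightarrow>\<^sub>0 nat) \<times> ('v \<Rightarrow>\<^sub>0 nat)) set \<Rightarrow> bool" where
  "monomial_order V r \<longleftrightarrow>
     linear_order_on (monomials_in V) r \<and>
     (\<forall>m \<in> monomials_in V. (0, m) \<in> r) \<and>
     (\<forall>(m, m') \<in> r. \<forall>u \<in> monomials_in V. (m + u, m' + u) \<in> r)"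

text \<open>
  A relation rather than a function, since the zero polynomial has no initial monomial.
\<close>

definition is_initial_monomial ::
    "(('v \<Rightarrow>\<^sub>0 nat) \<times> ('v \<Rightarrow>\<^sub>0 nat)) set \<Rightarrow> ('v, 'k::field) mpoly \<Rightarrow> ('v \<Rightarrow>\<^sub>0 nat) \<Rightarrow> bool" where
  "is_initial_monomial r f m \<longleftrightarrow>
     m \<in> Poly_Mapping.keys f \<and> (\<forall>m' \<in> Poly_Mapping.keys f. (m', m) \<in> r)"

definition squarefree_monomial :: "('v \<Rightarrow>\<^sub>0 nat) \<Rightarrow> bool" where
  "squarefree_monomial m \<longleftrightarrow> (\<forall>v. Poly_Mapping.lookup m v \<le> 1)"

definition colon_ideal :: "('a, 'b) ring_scheme \<Rightarrow> 'a set \<Rightarrow> 'a set \<Rightarrow> 'a set" where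
  "colon_ideal R I J = {x \<in> carrier R. \<forall>y \<in> J. x \<otimes>\<^bsub>R\<^esub> y \<in> I}"

inductive_set knutson_family :: "('a, 'b) ring_scheme \<Rightarrow> 'a \<Rightarrow> 'a set set"
  for R :: "('a, 'b) ring_scheme" and f :: 'a where
  principal: "genideal R {f} \<in> knutson_family R f"
| colon: "I \<in> knutson_family R f \<Longrightarrow> ideal J R \<Longrightarrow> colon_ideal R I J \<in> knutson_family R f"
| sum: "I \<in> knutson_family R f \<Longrightarrow> J \<in> knutson_family R f \<Longrightarrow> I <+>\<^bsub>R\<^esub> J \<in> knutson_family R f"
| inter: "I \<in> knutson_family R f \<Longrightarrow> J \<in> knutson_family R f \<Longrightarrow> I \<inter> J \<in> knutson_family R f"

definition knutson_ideal :: "'v set \<Rightarrow> ('v, 'k::field) mpoly set \<Rightarrow> bool" where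
  "knutson_ideal V I \<longleftrightarrow>
     (\<exists>f \<in> carrier (poly_ring V). \<exists>r m.
        monomial_order V r \<and> is_initial_monomial r f m \<and> squarefree_monomial m \<and>
        I \<in> knutson_family (poly_ring V) f)"

definition inner_binomials :: "point set set \<Rightarrow> (point, 'k::field) mpoly set" where
  "inner_binomials P =
     {var a * var b - var (fst a, snd b) * var (fst b, snd a) | a b. inner_interval P a b}"

definition polyomino_ideal :: "point set set \<Rightarrow> (point, 'k::field) mpoly set" where
  "polyomino_ideal P = genideal (poly_ring (vertices P)) (inner_binomials P)"

end

theory Submission
  imports Defs "HOL-Library.Function_Algebras"
begin

text \<open>
  The polynomial \<open>f\<close> is a product of inner \<open>2\<close>-minors, one for each cell of the path. For most
  cells it is the minor of the cell itself, so that along a straight block of cells the minors of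
  consecutive columns appear, and their leading terms \<open>x i * y (i + 1)\<close> are coprime. At a corner the leading
  terms of the two adjacent blocks may collide. This is cured by changing the order of the columns:
  if the block that follows a corner is a U-turn, i.e. turns in the same direction at both ends,
  then the cell before that corner is replaced by the domino of this cell and the corner
  cell. With this choice the leading terms partition the vertex set, and a lexicographic order
  selects them.

  Since \<open>f\<close> is a product, every factor generates a Knutson ideal. If \<open>I\<close> is the ideal of \<open>2\<close>-minors
  of some columns, \<open>u\<close> is one of these columns and \<open>w\<close> a new one, then adding the minor
  \<open>[u, w]\<close> and taking the colon ideal by the variable \<open>x\<^sub>u\<close> gives the ideal of \<open>2\<close>-minors
  of all columns, because variables are nonzerodivisors modulo the latter. Hence the ideals of all
  blocks are obtained, except for those ending in a corner whose cell has been replaced by a domino;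
  these are obtained together with the adjacent domino. The polyomino ideal is their sum.
\<close>

section \<open>Ideals of the polynomial ring\<close>

text \<open>Each block is oriented by the turn that ends it, so the choice of diagonals is local and
  raises no condition around the closed path. Consider a corner with turn \<open>t\<close> between
  straight cells. The leading term of the cell before it uses the vertex of their common edge away
  from the pivot of the turn. If the next turn is \<open>- t\<close>, the following block starts at
  the outer vertex, and the diagonal through the pivot is left for the corner cell. In a U-turn the
  following block starts at the pivot, and the two vertices left in the corner cell span an edge,
  not a diagonal. A domino in place of the previous cell skips the common edge and releases its
  vertex, so that a diagonal becomes free again.

  Variables are nonzerodivisors modulo the ideals of minors because these ideals are kernels of maps
  into the algebra of a cancellative monoid, given by row and column sums of exponents. That the
  kernel is not larger is a connectivity statement: monomials with the same sums are joined by
  exchanges along single minors.\<close>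

abbreviation idl :: "'v set \<Rightarrow> ('v, 'k::field) mpoly set \<Rightarrow> ('v, 'k) mpoly set" where
  "idl V \<equiv> genideal (poly_ring V)"

lemma poly_ring_closed:
  fixes p q :: "('v, 'k::field) mpoly"
  assumes "p \<in> carrier (poly_ring V)" "q \<in> carrier (poly_ring V)"
  shows "p + q \<in> carrier (poly_ring V)" "p * q \<in> carrier (poly_ring V)"
    "- p \<in> carrier (poly_ring V)" "p - q \<in> carrier (poly_ring V)"
proof -
  interpret cring "poly_ring V :: ('v, 'k) mpoly ring" by (rule poly_ring_cring)
  show "p + q \<in> carrier (poly_ring V)" "p * q \<in> carrier (poly_ring V)"
    using a_closed[of p q] m_closed[of p q] assms by (simp_all only: poly_ring_simps)
  show "- p \<in> carrier (poly_ring V)" using assms by simp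
  show "p - q \<in> carrier (poly_ring V)"
    using assms keys_diff[of p q] by auto
qed

lemma poly_ring_prod_closed:
  fixes g :: "'i \<Rightarrow> ('v, 'k::field) mpoly"
  assumes "\<And>i. i \<in> X \<Longrightarrow> g i \<in> carrier (poly_ring V)"
  shows "prod g X \<in> carrier (poly_ring V)"
  using assms
proof (induction X rule: infinite_finite_induct)
  case (insert x X)
  then show ?case
    by (simp del: poly_ring_simps add: poly_ring_closed)
qed auto

lemma poly_ring_ideal_closed:
  fixes I :: "('v, 'k::field) mpoly set"
  assumes I: "ideal I (poly_ring V)"
  shows "0 \<in> I"
    and "p \<in> I \<Longrightarrow> q \<in> I \<Longrightarrow> p + q \<in> I"
    and "p \<in> I \<Longrightarrow> a \<in> carrier (poly_ring V) \<Longrightarrow> a * p \<in> I"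
    and "p \<in> I \<Longrightarrow> - p \<in> I"
    and "p \<in> I \<Longrightarrow> q \<in> I \<Longrightarrow> p - q \<in> I"
proof -
  interpret ideal I "poly_ring V :: ('v, 'k) mpoly ring" by (rule I)
  note sub = ideal.axioms(1)[OF I]
  show "0 \<in> I" using additive_subgroup.zero_closed[OF sub] by simp
  show plus: "p \<in> I \<Longrightarrow> q \<in> I \<Longrightarrow> p + q \<in> I" for p q
    using additive_subgroup.a_closed[OF sub, of p q] by simp
  show mult: "p \<in> I \<Longrightarrow> a \<in> carrier (poly_ring V) \<Longrightarrow> a * p \<in> I" for p a
    using I_l_closed[of p a] by simp
  have m1: "- 1 \<in> carrier (poly_ring V :: ('v, 'k) mpoly ring)"
    by simp
  show minus: "p \<in> I \<Longrightarrow> - p \<in> I" for p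
    using mult[OF _ m1, of p] by simp
  show "p \<in> I \<Longrightarrow> q \<in> I \<Longrightarrow> p - q \<in> I"
    using plus[of p "- q"] minus by simp
qed

lemma poly_ring_ideal_sum:
  fixes I :: "('v, 'k::field) mpoly set"
  assumes "ideal I (poly_ring V)" "\<And>i. i \<in> X \<Longrightarrow> g i \<in> I"
  shows "sum g X \<in> I"
  using assms(2)
  by (induction X rule: infinite_finite_induct) (auto simp: poly_ring_ideal_closed[OF assms(1)])

lemma genideal_poly_ring:
  fixes G :: "('v, 'k::field) mpoly set"
  assumes "G \<subseteq> carrier (poly_ring V)"
  shows "ideal (idl V G) (poly_ring V)"
    and "G \<subseteq> idl V G"
    and "ideal I (poly_ring V) \<Longrightarrow> G \<subseteq> I \<Longrightarrow> idl V G \<subseteq> I"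
proof -
  interpret cring "poly_ring V :: ('v, 'k) mpoly ring" by (rule poly_ring_cring)
  show "ideal (idl V G) (poly_ring V)" "G \<subseteq> idl V G"
    "ideal I (poly_ring V) \<Longrightarrow> G \<subseteq> I \<Longrightarrow> idl V G \<subseteq> I"
    using genideal_ideal[OF assms] genideal_self[OF assms] genideal_minimal by auto
qed

lemma principal_poly_ring:
  fixes g :: "('v, 'k::field) mpoly"
  assumes "g \<in> carrier (poly_ring V)"
  shows "idl V {g} = {a * g | a. a \<in> carrier (poly_ring V)}"
proof -
  interpret cring "poly_ring V :: ('v, 'k) mpoly ring" by (rule poly_ring_cring)
  show ?thesis
    using cgenideal_eq_genideal[OF assms] by (simp only: cgenideal_def poly_ring_simps)
qed

lemma ideal_carrier:
  fixes I :: "('v, 'k::field) mpoly set"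
  assumes "ideal I (poly_ring V)"
  shows "I \<subseteq> carrier (poly_ring V)"
  using ideal.axioms(1)[OF assms] additive_subgroup.a_subset by blast

lemma poly_ring_idealI:
  fixes I :: "('v, 'k::field) mpoly set"
  assumes sub: "I \<subseteq> carrier (poly_ring V)" and zero: "0 \<in> I"
    and plus: "\<And>p q. p \<in> I \<Longrightarrow> q \<in> I \<Longrightarrow> p + q \<in> I"
    and mult: "\<And>p x. p \<in> I \<Longrightarrow> x \<in> carrier (poly_ring V) \<Longrightarrow> x * p \<in> I"
  shows "ideal I (poly_ring V)"
proof -
  interpret cring "poly_ring V :: ('v, 'k) mpoly ring" by (rule poly_ring_cring)
  have neg: "- p \<in> I" if "p \<in> I" for p
    using mult[OF that, of "- 1"] by simp
  show ?thesis
  proof (rule idealI[OF ring_axioms])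
    show "subgroup I (add_monoid (poly_ring V))"
    proof (rule group.subgroupI)
      show "group (add_monoid (poly_ring V :: ('v, 'k) mpoly ring))"
        by (rule a_group)
      show "I \<subseteq> carrier (add_monoid (poly_ring V))" "I \<noteq> {}" using sub zero by auto
    next
      fix p q assume p: "p \<in> I"
      have "\<ominus>\<^bsub>poly_ring V\<^esub> p = - p"
        using minus_equality[of "- p" p] sub p neg[OF p] by (auto simp del: poly_ring_simps(1))
      then show "inv\<^bsub>add_monoid (poly_ring V)\<^esub> p \<in> I"
        using neg[OF p] by (simp add: a_inv_def)
      assume "q \<in> I"
      then show "p \<otimes>\<^bsub>add_monoid (poly_ring V)\<^esub> q \<in> I"
        using plus[OF p] by simp
    qed
  qed (use mult in \<open>simp_all add: mult.commute\<close>)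
qed

lemma ideal_colon:
  fixes I :: "('v, 'k::field) mpoly set"
  assumes I: "ideal I (poly_ring V)"
  shows "ideal (colon_ideal (poly_ring V) I J) (poly_ring V)"
proof -
  note cl = poly_ring_closed poly_ring_ideal_closed[OF I]
  have mem: "x \<in> colon_ideal (poly_ring V) I J \<longleftrightarrow>
      x \<in> carrier (poly_ring V) \<and> (\<forall>y\<in>J. x * y \<in> I)" for x
    by (simp add: colon_ideal_def)
  show ?thesis
  proof (rule poly_ring_idealI)
    show "colon_ideal (poly_ring V) I J \<subseteq> carrier (poly_ring V)" using mem by blast
    show "0 \<in> colon_ideal (poly_ring V) I J" using cl by (simp add: mem)
    show "p + q \<in> colon_ideal (poly_ring V) I J"
      if "p \<in> colon_ideal (poly_ring V) I J" "q \<in> colon_ideal (poly_ring V) I J" for p q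
      using that unfolding mem by (auto simp: distrib_right cl simp del: poly_ring_simps(1))
    show "x * p \<in> colon_ideal (poly_ring V) I J"
      if "p \<in> colon_ideal (poly_ring V) I J" "x \<in> carrier (poly_ring V)" for p x
      using that unfolding mem by (auto simp: mult.assoc cl simp del: poly_ring_simps(1))
  qed
qed

lemma set_add_genideal:
  fixes G H :: "('v, 'k::field) mpoly set"
  assumes "G \<subseteq> carrier (poly_ring V)" "H \<subseteq> carrier (poly_ring V)"
  shows "idl V G <+>\<^bsub>poly_ring V\<^esub> idl V H
    = idl V (G \<union> H)"
proof -
  interpret cring "poly_ring V :: ('v, 'k) mpoly ring" by (rule poly_ring_cring)
  note i = genideal_poly_ring[OF assms(1)] genideal_poly_ring[OF assms(2)]
  have GH: "G \<union> H \<subseteq> carrier (poly_ring V)" using assms by blast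
  have IJ: "idl V G \<union> idl V H \<subseteq> carrier (poly_ring V)"
    using ideal_carrier[OF i(1)] ideal_carrier[OF i(4)] by blast
  note j = genideal_poly_ring[OF GH] genideal_poly_ring[OF IJ]
  have "idl V G <+>\<^bsub>poly_ring V\<^esub> idl V H
      = idl V (idl V G \<union> idl V H)"
    by (rule union_genideal[symmetric]) (fact i)+
  also have "\<dots> = idl V (G \<union> H)"
  proof
    show "idl V (idl V G \<union> idl V H)
        \<subseteq> idl V (G \<union> H)"
      using j(2) i(3)[OF j(1)] i(6)[OF j(1)] by (intro j(6) j(1)) auto
    show "idl V (G \<union> H)
        \<subseteq> idl V (idl V G \<union> idl V H)"
      using j(5) i(2,5) by (intro j(3) j(4)) auto
  qed
  finally show ?thesis .
qed

subsection \<open>Monomial orders and initial monomials\<close>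

lemma monomial_orderD:
  assumes "monomial_order V r"
  shows "(m, m') \<in> r \<Longrightarrow> m \<in> monomials_in V \<and> m' \<in> monomials_in V"
    and "m \<in> monomials_in V \<Longrightarrow> (m, m) \<in> r"
    and "(m, m') \<in> r \<Longrightarrow> (m', m'') \<in> r \<Longrightarrow> (m, m'') \<in> r"
    and "(m, m') \<in> r \<Longrightarrow> (m', m) \<in> r \<Longrightarrow> m = m'"
    and "m \<in> monomials_in V \<Longrightarrow> m' \<in> monomials_in V \<Longrightarrow> (m, m') \<in> r \<or> (m', m) \<in> r"
    and "(m, m') \<in> r \<Longrightarrow> u \<in> monomials_in V \<Longrightarrow> (m + u, m' + u) \<in> r"
proof -
  have lin: "linear_order_on (monomials_in V) r"
    and add: "\<forall>(m, m') \<in> r. \<forall>u \<in> monomials_in V. (m + u, m' + u) \<in> r"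
    using assms by (auto simp: monomial_order_def)
  note o = lin[unfolded linear_order_on_def partial_order_on_def preorder_on_def]
  show f: "(m, m') \<in> r \<Longrightarrow> m \<in> monomials_in V \<and> m' \<in> monomials_in V" for m m'
    using o by (auto simp: refl_on_def)
  show r: "m \<in> monomials_in V \<Longrightarrow> (m, m) \<in> r" for m
    using o by (auto simp: refl_on_def)
  show "(m, m') \<in> r \<Longrightarrow> (m', m'') \<in> r \<Longrightarrow> (m, m'') \<in> r"
    using o by (auto elim: transE)
  show "(m, m') \<in> r \<Longrightarrow> (m', m) \<in> r \<Longrightarrow> m = m'"
    using o by (auto simp: antisym_def)
  show "m \<in> monomials_in V \<Longrightarrow> m' \<in> monomials_in V \<Longrightarrow> (m, m') \<in> r \<or> (m', m) \<in> r"
    using o r by (cases "m = m'") (auto simp: total_on_def)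
  show "(m, m') \<in> r \<Longrightarrow> u \<in> monomials_in V \<Longrightarrow> (m + u, m' + u) \<in> r"
    using add by auto
qed

text \<open>If the exponent splits in only one way, a single summand of the convolution survives, so
  no cancellation can occur. This is applied to leading monomials.\<close>

lemma lookup_mult_unique:
  fixes p q :: "('v, 'k::field) mpoly"
  assumes "\<And>a b. a \<in> Poly_Mapping.keys p \<Longrightarrow> b \<in> Poly_Mapping.keys q \<Longrightarrow>
      a + b = m + m' \<Longrightarrow> a = m \<and> b = m'"
  shows "Poly_Mapping.lookup (p * q) (m + m') = Poly_Mapping.lookup p m * Poly_Mapping.lookup q m'"
proof -
  have *: "(Poly_Mapping.lookup p a * Poly_Mapping.lookup q b when m + m' = a + b)
      = (Poly_Mapping.lookup p m * Poly_Mapping.lookup q m' when (a, b) = (m, m'))" for a b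
  proof (cases "a \<in> Poly_Mapping.keys p \<and> b \<in> Poly_Mapping.keys q")
    case True
    then show ?thesis using assms[of a b] by (auto simp: when_def)
  next
    case False
    then show ?thesis by (auto simp: when_def in_keys_iff)
  qed
  have "Poly_Mapping.lookup (p * q) (m + m') =
      (\<Sum>(a, b). Poly_Mapping.lookup p a * Poly_Mapping.lookup q b when m + m' = a + b)"
    by (transfer fixing: m m') (rule prod_fun_unfold_prod)
  also have "\<dots> = (\<Sum>ab. Poly_Mapping.lookup p m * Poly_Mapping.lookup q m' when ab = (m, m'))"
    by (rule Sum_any.cong) (auto simp: * split: prod.splits)
  also have "\<dots> = Poly_Mapping.lookup p m * Poly_Mapping.lookup q m'"
    by simp
  finally show ?thesis .
qed

lemma initial_monomial_mult:
  fixes p q :: "('v, 'k::field) mpoly"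
  assumes r: "monomial_order V r"
    and p: "is_initial_monomial r p m" and q: "is_initial_monomial r q m'"
  shows "is_initial_monomial r (p * q) (m + m')"
proof -
  note o = monomial_orderD[OF r]
  have pm: "(a, m) \<in> r" if "a \<in> Poly_Mapping.keys p" for a
    using p that by (auto simp: is_initial_monomial_def)
  have qm: "(b, m') \<in> r" if "b \<in> Poly_Mapping.keys q" for b
    using q that by (auto simp: is_initial_monomial_def)
  have k: "m \<in> Poly_Mapping.keys p" "m' \<in> Poly_Mapping.keys q"
    using p q by (auto simp: is_initial_monomial_def)
  have le: "(a + b, m + m') \<in> r" if "a \<in> Poly_Mapping.keys p" "b \<in> Poly_Mapping.keys q" for a b
  proof -
    have "(a + b, m + b) \<in> r"
      using o(6)[OF pm[OF that(1)]] o(1)[OF qm[OF that(2)]] by blast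
    moreover have "(b + m, m' + m) \<in> r"
      using o(6)[OF qm[OF that(2)]] o(1)[OF pm[OF that(1)]] by blast
    ultimately show ?thesis using o(3) by (metis add.commute)
  qed
  have "a = m \<and> b = m'"
    if ab: "a \<in> Poly_Mapping.keys p" "b \<in> Poly_Mapping.keys q" "a + b = m + m'" for a b
  proof -
    have "(a + m', m + m') \<in> r"
      using o(6)[OF pm[OF ab(1)]] o(1)[OF qm[OF k(2)]] by blast
    moreover have "(b + a, m' + a) \<in> r"
      using o(6)[OF qm[OF ab(2)]] o(1)[OF pm[OF ab(1)]] by blast
    \<comment> \<open>Because \<open>a + b = m + m'\<close>, the two relations bound
      \<open>a + m'\<close> by \<open>m + m'\<close> from above and from below.\<close>
    ultimately have "a + m' = m + m'"
      using o(4)[of "a + m'" "m + m'"] ab(3) by (simp add: add.commute)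
    then show ?thesis using ab(3) by auto
  qed
  then have "Poly_Mapping.lookup (p * q) (m + m')
      = Poly_Mapping.lookup p m * Poly_Mapping.lookup q m'"
    by (rule lookup_mult_unique)
  then have "m + m' \<in> Poly_Mapping.keys (p * q)"
    using k by (auto simp: in_keys_iff)
  moreover have "(u, m + m') \<in> r" if "u \<in> Poly_Mapping.keys (p * q)" for u
    using that keys_mult[of p q] le by blast
  ultimately show ?thesis by (auto simp: is_initial_monomial_def)
qed

lemma initial_monomial_prod:
  fixes g :: "'i \<Rightarrow> ('v, 'k::field) mpoly"
  assumes r: "monomial_order V r" and "finite X"
    and "\<And>i. i \<in> X \<Longrightarrow> is_initial_monomial r (g i) (m i)"
  shows "is_initial_monomial r (prod g X) (sum m X)"
  using assms(2,3)
proof (induction X rule: finite_induct)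
  case empty
  then show ?case
    using monomial_orderD(2)[OF r, of 0] by (simp add: is_initial_monomial_def)
next
  case (insert x X)
  have "is_initial_monomial r (g x * prod g X) (m x + sum m X)"
    using insert by (intro initial_monomial_mult[OF r]) auto
  then show ?case using insert by simp
qed

lemma initial_monomial_exists:
  fixes p :: "('v, 'k::field) mpoly"
  assumes r: "monomial_order V r" and p: "p \<in> carrier (poly_ring V)" "p \<noteq> 0"
  shows "\<exists>m. is_initial_monomial r p m"
proof -
  note o = monomial_orderD[OF r]
  have "\<exists>m\<in>X. \<forall>m'\<in>X. (m', m) \<in> r" if "finite X" "X \<noteq> {}" "X \<subseteq> monomials_in V" for X
    using that
  proof (induction X rule: finite_ne_induct)
    case (singleton x)
    then show ?case using o(2) by auto
  next
    case (insert x X)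
    then obtain m where m: "m \<in> X" "\<forall>m'\<in>X. (m', m) \<in> r" by auto
    have "x \<in> monomials_in V" "m \<in> monomials_in V" using insert m by auto
    from o(5)[OF this] show ?case
    proof
      assume "(x, m) \<in> r"
      then show ?thesis using m by auto
    next
      assume "(m, x) \<in> r"
      then have "\<forall>m'\<in>X. (m', x) \<in> r" using m o(3) by blast
      then show ?thesis using o(2)[OF \<open>x \<in> monomials_in V\<close>] by auto
    qed
  qed
  from this[of "Poly_Mapping.keys p"] show ?thesis
    using p by (auto simp: is_initial_monomial_def)
qed

text \<open>Initial monomials of nonzero polynomials add up to an initial monomial of the product,
  which therefore does not vanish.\<close>

lemma poly_ring_no_zero_divisors:
  fixes p q :: "('v, 'k::field) mpoly"
  assumes r: "monomial_order V r"
    and "p \<in> carrier (poly_ring V)" "q \<in> carrier (poly_ring V)" "p * q = 0" "q \<noteq> 0"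
  shows "p = 0"
proof (rule ccontr)
  assume "p \<noteq> 0"
  then obtain m m' where "is_initial_monomial r p m" "is_initial_monomial r q m'"
    using initial_monomial_exists[OF r] assms by metis
  then have "is_initial_monomial r (p * q) (m + m')"
    by (rule initial_monomial_mult[OF r])
  then show False using assms by (simp add: is_initial_monomial_def)
qed

section \<open>Lexicographic orders, where a smaller index means a larger variable\<close>

definition lex_order :: "('v \<Rightarrow> nat) \<Rightarrow> 'v set \<Rightarrow> (('v \<Rightarrow>\<^sub>0 nat) \<times> ('v \<Rightarrow>\<^sub>0 nat)) set" where
  "lex_order idx V = {(m, m'). m \<in> monomials_in V \<and> m' \<in> monomials_in V \<and>
     (m = m' \<or> (\<exists>v\<in>V. Poly_Mapping.lookup m v < Poly_Mapping.lookup m' v \<and>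
       (\<forall>u\<in>V. idx u < idx v \<longrightarrow> Poly_Mapping.lookup m u = Poly_Mapping.lookup m' u)))}"

lemma monomials_in_eqI:
  assumes "m \<in> monomials_in V" "m' \<in> monomials_in V"
    and "\<And>v. v \<in> V \<Longrightarrow> Poly_Mapping.lookup m v = Poly_Mapping.lookup m' v"
  shows "m = m'"
proof (rule poly_mapping_eqI)
  fix v
  have "Poly_Mapping.lookup m v = 0" "Poly_Mapping.lookup m' v = 0" if "v \<notin> V"
    using that assms unfolding monomials_in_def by (metis in_keys_iff mem_Collect_eq subsetD)+
  then show "Poly_Mapping.lookup m v = Poly_Mapping.lookup m' v"
    using assms(3) by (cases "v \<in> V") auto
qed

lemma monomial_order_lex_order:
  assumes inj: "inj_on idx V"
  shows "monomial_order V (lex_order idx V)"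
proof -
  have tot: "(m, m') \<in> lex_order idx V \<or> (m', m) \<in> lex_order idx V"
    if m: "m \<in> monomials_in V" "m' \<in> monomials_in V" and ne: "m \<noteq> m'" for m m'
  proof -
    define D where "D = {v \<in> V. Poly_Mapping.lookup m v \<noteq> Poly_Mapping.lookup m' v}"
    have "D \<noteq> {}" using ne monomials_in_eqI[OF m] by (auto simp: D_def)
    then obtain v where v: "v \<in> D" "\<And>u. u \<in> D \<Longrightarrow> idx v \<le> idx u"
      using ex_has_least_nat[of "\<lambda>v. v \<in> D" _ idx] by auto
    have "\<forall>u\<in>V. idx u < idx v \<longrightarrow> Poly_Mapping.lookup m u = Poly_Mapping.lookup m' u"
    proof (intro ballI impI)
      fix u assume "u \<in> V" "idx u < idx v"
      then show "Poly_Mapping.lookup m u = Poly_Mapping.lookup m' u"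
        using v(2)[of u] by (auto simp: D_def)
    qed
    moreover have "v \<in> V" "Poly_Mapping.lookup m v < Poly_Mapping.lookup m' v \<or>
        Poly_Mapping.lookup m' v < Poly_Mapping.lookup m v"
      using v(1) by (auto simp: D_def)
    ultimately show ?thesis using m unfolding lex_order_def by auto
  qed
  have antisym: "m = m'" if "(m, m') \<in> lex_order idx V" "(m', m) \<in> lex_order idx V" for m m'
  proof (rule ccontr)
    assume ne: "m \<noteq> m'"
    from that ne obtain v w where v: "v \<in> V" "Poly_Mapping.lookup m v < Poly_Mapping.lookup m' v"
        "\<forall>u\<in>V. idx u < idx v \<longrightarrow> Poly_Mapping.lookup m u = Poly_Mapping.lookup m' u"
      and w: "w \<in> V" "Poly_Mapping.lookup m' w < Poly_Mapping.lookup m w"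
        "\<forall>u\<in>V. idx u < idx w \<longrightarrow> Poly_Mapping.lookup m' u = Poly_Mapping.lookup m u"
      unfolding lex_order_def by auto
    have "\<not> idx v < idx w" "\<not> idx w < idx v" using v w by force+
    then have "v = w" using inj v w by (simp add: inj_on_def)
    then show False using v w by simp
  qed
  have trans: "(m, m'') \<in> lex_order idx V"
    if "(m, m') \<in> lex_order idx V" "(m', m'') \<in> lex_order idx V" for m m' m''
  proof (cases "m = m' \<or> m' = m''")
    case True
    then show ?thesis using that by auto
  next
    case False
    from that False obtain v w where v: "v \<in> V" "Poly_Mapping.lookup m v < Poly_Mapping.lookup m' v"
        "\<forall>u\<in>V. idx u < idx v \<longrightarrow> Poly_Mapping.lookup m u = Poly_Mapping.lookup m' u"
      and w: "w \<in> V" "Poly_Mapping.lookup m' w < Poly_Mapping.lookup m'' w"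
        "\<forall>u\<in>V. idx u < idx w \<longrightarrow> Poly_Mapping.lookup m' u = Poly_Mapping.lookup m'' u"
      unfolding lex_order_def by auto
    have mm: "m \<in> monomials_in V" "m'' \<in> monomials_in V" using that by (auto simp: lex_order_def)
    \<comment> \<open>At the earlier of the two places of difference one comparison is strict and
      the other is strict or an equality.\<close>
    define x where "x = (if idx w < idx v then w else v)"
    have "Poly_Mapping.lookup m x < Poly_Mapping.lookup m'' x"
    proof -
      consider "idx w < idx v" | "idx v < idx w" | "idx v = idx w" by linarith
      then show ?thesis
      proof cases
        case 3
        then have "v = w" using inj v w by (simp add: inj_on_def)
        then show ?thesis using v w by (simp add: x_def)
      qed (use v w in \<open>auto simp: x_def\<close>)
    qed
    moreover have "x \<in> V" using v w by (simp add: x_def)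
    moreover have "\<forall>u\<in>V. idx u < idx x \<longrightarrow> Poly_Mapping.lookup m u = Poly_Mapping.lookup m'' u"
      using v w by (auto simp: x_def)
    ultimately show ?thesis using mm unfolding lex_order_def by blast
  qed
  have "linear_order_on (monomials_in V) (lex_order idx V)"
    unfolding linear_order_on_def partial_order_on_def preorder_on_def
  proof (intro conjI)
    show "refl_on (monomials_in V) (lex_order idx V)"
      by (auto simp: refl_on_def lex_order_def)
    show "Relation.trans (lex_order idx V)" using trans by (rule transI)
    show "Relation.antisym (lex_order idx V)" using antisym by (rule antisymI)
    show "Relation.total_on (monomials_in V) (lex_order idx V)"
      using tot by (auto simp: total_on_def)
    show "lex_order idx V \<subseteq> monomials_in V \<times> monomials_in V"
      by (auto simp: lex_order_def)
  qed
  moreover have "(0, m) \<in> lex_order idx V" if "m \<in> monomials_in V" for m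
  proof (rule ccontr)
    assume *: "(0, m) \<notin> lex_order idx V"
    then have "0 \<noteq> m" using that by (auto simp: lex_order_def)
    then have "(m, 0) \<in> lex_order idx V" using tot[OF zero_in_monomials_in that] * by blast
    then show False using \<open>0 \<noteq> m\<close> by (auto simp: lex_order_def)
  qed
  moreover have "(m + u, m' + u) \<in> lex_order idx V"
    if "(m, m') \<in> lex_order idx V" "u \<in> monomials_in V" for m m' u
    using that add_in_monomials_in unfolding lex_order_def by (auto simp: lookup_add)
  ultimately show ?thesis by (auto simp: monomial_order_def)
qed

subsection \<open>Closure properties of the Knutson family\<close>

text \<open>In a domain \<open>(g h) : (h) = (g)\<close>, so the colon operation extracts every
  factor of \<open>f\<close>.\<close>

lemma knutson_family_factor:
  fixes g h :: "('v, 'k::field) mpoly"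
  assumes r: "monomial_order V r"
    and g: "g \<in> carrier (poly_ring V)" and h: "h \<in> carrier (poly_ring V)" "h \<noteq> 0"
    and f: "f = g * h"
  shows "idl V {g} \<in> knutson_family (poly_ring V) f"
proof -
  note cl = poly_ring_closed
  have fc: "f \<in> carrier (poly_ring V)" using cl(2)[OF g h(1)] f by simp
  note P = principal_poly_ring
  have gen: "h \<in> idl V {h}"
    using genideal_poly_ring(2)[of "{h}" V] h(1) by blast
  have hi: "ideal (idl V {h}) (poly_ring V)"
    using genideal_poly_ring(1)[of "{h}" V] h(1) by blast
  have "colon_ideal (poly_ring V) (idl V {f}) (idl V {h})
      = idl V {g}"
  proof (rule Set.set_eqI, rule iffI)
    fix x assume x: "x \<in> colon_ideal (poly_ring V) (idl V {f}) (idl V {h})"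
    have "x * h \<in> idl V {f}" and xc: "x \<in> carrier (poly_ring V)"
      using x gen unfolding colon_ideal_def poly_ring_simps(2) by blast+
    then obtain a where a: "a \<in> carrier (poly_ring V)" "x * h = a * f"
      unfolding P[OF fc] by blast
    have ag: "a * g \<in> carrier (poly_ring V)" using cl(2)[OF a(1) g] .
    have "(x - a * g) * h = 0"
      using a(2) unfolding f left_diff_distrib by (simp only: mult.assoc diff_self)
    then have "x - a * g = 0"
      by (rule poly_ring_no_zero_divisors[OF r cl(4)[OF xc ag] h(1) _ h(2)])
    then show "x \<in> idl V {g}"
      unfolding P[OF g] using a(1) by (simp del: poly_ring_simps) blast
  next
    fix x assume "x \<in> idl V {g}"
    then obtain a where a: "a \<in> carrier (poly_ring V)" "x = a * g"
      unfolding P[OF g] by blast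
    have xc: "x \<in> carrier (poly_ring V)" using cl(2)[OF a(1) g] a(2) by simp
    have "x * y \<in> idl V {f}" if y: "y \<in> idl V {h}" for y
    proof -
      obtain b where b: "b \<in> carrier (poly_ring V)" "y = b * h"
        using y unfolding P[OF h(1)] by blast
      have "x * y = (a * b) * f" unfolding a(2) b(2) f by (simp only: ac_simps)
      then show ?thesis unfolding P[OF fc] using cl(2)[OF a(1) b(1)] by blast
    qed
    then show "x \<in> colon_ideal (poly_ring V) (idl V {f}) (idl V {h})"
      using xc unfolding colon_ideal_def poly_ring_simps(2) by blast
  qed
  then show ?thesis
    using knutson_family.colon[OF knutson_family.principal hi, of f] by simp
qed

lemma knutson_family_factors:
  fixes g :: "'i \<Rightarrow> ('v, 'k::field) mpoly"
  assumes r: "monomial_order V r" and X: "finite X" "i \<in> X"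
    and g: "\<And>i. i \<in> X \<Longrightarrow> g i \<in> carrier (poly_ring V)"
    and m: "\<And>i. i \<in> X \<Longrightarrow> is_initial_monomial r (g i) (m i)"
  shows "idl V {g i} \<in> knutson_family (poly_ring V) (prod g X)"
proof (rule knutson_family_factor[OF r])
  show "g i \<in> carrier (poly_ring V)" using X g by blast
  show "prod g (X - {i}) \<in> carrier (poly_ring V)" using g by (intro poly_ring_prod_closed) auto
  have "is_initial_monomial r (prod g (X - {i})) (sum m (X - {i}))"
    using X m by (intro initial_monomial_prod[OF r]) auto
  then show "prod g (X - {i}) \<noteq> 0" by (auto simp: is_initial_monomial_def)
  show "prod g X = g i * prod g (X - {i})" using X by (simp add: prod.remove)
qed

text \<open>It is enough to trap each generator in some member of the family that stays below the
  target ideal. The sum of these finitely many members is then the target itself, and their own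
  generators may be chosen freely.\<close>

lemma knutson_family_Union:
  fixes f :: "('v, 'k::field) mpoly"
  assumes G: "finite G" "G \<noteq> {}" "G \<subseteq> carrier (poly_ring V)"
    and K: "\<And>b. b \<in> G \<Longrightarrow> \<exists>H. H \<subseteq> carrier (poly_ring V) \<and> b \<in> idl V H \<and>
      idl V H \<subseteq> idl V G \<and>
      idl V H \<in> knutson_family (poly_ring V) f"
  shows "idl V G \<in> knutson_family (poly_ring V) f"
proof -
  let ?P = "\<lambda>X H. H \<subseteq> carrier (poly_ring V) \<and> X \<subseteq> idl V H \<and>
      idl V H \<subseteq> idl V G \<and>
      idl V H \<in> knutson_family (poly_ring V) f"
  have "\<exists>H. ?P X H"
    if "finite X" "X \<noteq> {}" "X \<subseteq> G" for X
    using that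
  proof (induction X rule: finite_ne_induct)
    case (singleton x)
    then have "x \<in> G" by simp
    from K[OF this] obtain H where "H \<subseteq> carrier (poly_ring V)" "x \<in> idl V H"
      "idl V H \<subseteq> idl V G"
      "idl V H \<in> knutson_family (poly_ring V) f" by (elim exE conjE)
    then show ?case by (intro exI[of _ H] conjI) simp_all
  next
    case (insert x X)
    then obtain H where "?P X H" by blast
    then have H: "H \<subseteq> carrier (poly_ring V)" "X \<subseteq> idl V H"
        "idl V H \<subseteq> idl V G"
        "idl V H \<in> knutson_family (poly_ring V) f" by blast+
    have "x \<in> G" using insert by simp
    from K[OF this] obtain H' where H': "H' \<subseteq> carrier (poly_ring V)" "x \<in> idl V H'"
        "idl V H' \<subseteq> idl V G"
        "idl V H' \<in> knutson_family (poly_ring V) f"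
      by (elim exE conjE)
    have c: "H \<union> H' \<subseteq> carrier (poly_ring V)" using H(1) H'(1) by blast
    note i = genideal_poly_ring[OF c]
    show ?case
    proof (intro exI conjI)
      show "H \<union> H' \<subseteq> carrier (poly_ring V)" by (rule c)
      have "idl V H \<subseteq> idl V (H \<union> H')"
        "idl V H' \<subseteq> idl V (H \<union> H')"
        using i(2) genideal_poly_ring(3)[OF H(1) i(1)] genideal_poly_ring(3)[OF H'(1) i(1)] by blast+
      then show "insert x X \<subseteq> idl V (H \<union> H')" using H(2) H'(2) by blast
      show "idl V (H \<union> H') \<subseteq> idl V G"
      proof (rule i(3)[OF genideal_poly_ring(1)[OF G(3)]])
        show "H \<union> H' \<subseteq> idl V G"
          using H(3) H'(3) genideal_poly_ring(2)[OF H(1)] genideal_poly_ring(2)[OF H'(1)] by blast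
      qed
      show "idl V (H \<union> H') \<in> knutson_family (poly_ring V) f"
        using knutson_family.sum[OF H(4) H'(4)] set_add_genideal[OF H(1) H'(1)] by simp
    qed
  qed
  from this[OF G(1,2)] obtain H where "?P G H" by blast
  then have H: "H \<subseteq> carrier (poly_ring V)" "G \<subseteq> idl V H"
      "idl V H \<subseteq> idl V G"
      "idl V H \<in> knutson_family (poly_ring V) f" by blast+
  have "idl V G = idl V H"
    using H genideal_poly_ring(3)[OF G(3) genideal_poly_ring(1)[OF H(1)]] by blast
  then show ?thesis using H by simp
qed

subsection \<open>Ideals defined by a grading\<close>

text \<open>The linear map of monoid algebras induced by \<open>h\<close> on exponents; it is a ring
  homomorphism when \<open>h\<close> is additive.\<close>

definition push :: "('a \<Rightarrow> 'b) \<Rightarrow> ('a \<Rightarrow>\<^sub>0 'k::comm_monoid_add) \<Rightarrow> ('b \<Rightarrow>\<^sub>0 'k)" where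
  "push h p = (\<Sum>m\<in>Poly_Mapping.keys p. Poly_Mapping.single (h m) (Poly_Mapping.lookup p m))"

lemma push_superset:
  assumes "finite Z" "Poly_Mapping.keys p \<subseteq> Z"
  shows "push h p = (\<Sum>m\<in>Z. Poly_Mapping.single (h m) (Poly_Mapping.lookup p m))"
  unfolding push_def using assms by (intro sum.mono_neutral_left) (auto simp: in_keys_iff)

lemma push_add: "push h (p + q) = push h p + push h q"
proof -
  let ?Z = "Poly_Mapping.keys p \<union> Poly_Mapping.keys q"
  have "push h p = (\<Sum>m\<in>?Z. Poly_Mapping.single (h m) (Poly_Mapping.lookup p m))"
    "push h q = (\<Sum>m\<in>?Z. Poly_Mapping.single (h m) (Poly_Mapping.lookup q m))"
    "push h (p + q) = (\<Sum>m\<in>?Z. Poly_Mapping.single (h m) (Poly_Mapping.lookup (p + q) m))"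
    using Poly_Mapping.keys_add[of p q] by (intro push_superset; auto)+
  then show ?thesis by (simp add: lookup_add single_add sum.distrib)
qed

lemma push_zero [simp]: "push h 0 = 0"
  by (simp add: push_def)

lemma push_single [simp]: "push h (Poly_Mapping.single m c) = Poly_Mapping.single (h m) c"
  by (cases "c = 0") (simp_all add: push_def)

lemma push_sum: "push h (sum g X) = (\<Sum>i\<in>X. push h (g i))"
  by (induction X rule: infinite_finite_induct) (simp_all add: push_add)

lemma push_diff:
  fixes p q :: "'a \<Rightarrow>\<^sub>0 'k::ab_group_add"
  shows "push h (p - q) = push h p - push h q"
  using push_add[of h "p - q" q] by simp

lemma push_push: "push h (push k p) = push (h \<circ> k) p"
  by (simp add: push_def[of k] push_def[of "h \<circ> k"] push_sum)

lemma sum_monomials: "(\<Sum>m\<in>Poly_Mapping.keys p. Poly_Mapping.single m (Poly_Mapping.lookup p m)) = p"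
proof (rule poly_mapping_eqI)
  fix k
  have "Poly_Mapping.lookup (\<Sum>m\<in>Poly_Mapping.keys p. Poly_Mapping.single m (Poly_Mapping.lookup p m)) k
    = (\<Sum>m\<in>Poly_Mapping.keys p. if m = k then Poly_Mapping.lookup p m else 0)"
    by (simp add: lookup_sum lookup_single when_def)
  also have "\<dots> = Poly_Mapping.lookup p k"
    by (simp add: sum.delta' in_keys_iff)
  finally show "Poly_Mapping.lookup (\<Sum>m\<in>Poly_Mapping.keys p.
      Poly_Mapping.single m (Poly_Mapping.lookup p m)) k = Poly_Mapping.lookup p k" .
qed

lemma push_mult:
  fixes p q :: "'a::comm_monoid_add \<Rightarrow>\<^sub>0 'k::comm_semiring_0"
  assumes "\<And>a b. h (a + b) = h a + h b"
  shows "push h (p * q) = push h p * push h q"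
proof -
  let ?l = "Poly_Mapping.lookup"
  have "p * q = (\<Sum>a\<in>Poly_Mapping.keys p. Poly_Mapping.single a (?l p a)) *
      (\<Sum>b\<in>Poly_Mapping.keys q. Poly_Mapping.single b (?l q b))"
    by (simp add: sum_monomials)
  also have "\<dots> = (\<Sum>a\<in>Poly_Mapping.keys p. \<Sum>b\<in>Poly_Mapping.keys q.
      Poly_Mapping.single (a + b) (?l p a * ?l q b))"
    by (simp add: sum_product mult_single)
  finally have "push h (p * q) = (\<Sum>a\<in>Poly_Mapping.keys p. \<Sum>b\<in>Poly_Mapping.keys q.
      Poly_Mapping.single (h a + h b) (?l p a * ?l q b))"
    by (simp add: push_sum assms)
  also have "\<dots> = push h p * push h q"
    by (simp add: push_def sum_product mult_single)
  finally show ?thesis .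
qed

text \<open>Multiplication by a monomial translates exponents, and translation is injective in a
  cancellative monoid, so the coefficients of \<open>q\<close> reappear unchanged.\<close>

lemma monomial_mult_eq_zero:
  fixes q :: "'a::cancel_comm_monoid_add \<Rightarrow>\<^sub>0 'k::comm_semiring_1"
  assumes "Poly_Mapping.single g 1 * q = 0"
  shows "q = 0"
proof (rule poly_mapping_eqI)
  fix k
  have "Poly_Mapping.single g 1 * q = push ((+) g) q"
    by (subst sum_monomials[of q, symmetric], subst sum_distrib_left)
      (simp add: mult_single push_def)
  then have "push ((+) g) q = 0" using assms by simp
  then have "0 = Poly_Mapping.lookup (push ((+) g) q) (g + k)" by simp
  also have "\<dots> = (\<Sum>m\<in>Poly_Mapping.keys q. if m = k then Poly_Mapping.lookup q m else 0)"
    by (simp add: push_def lookup_sum lookup_single when_def)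
  also have "\<dots> = Poly_Mapping.lookup q k"
    by (simp add: sum.delta' in_keys_iff)
  finally show "Poly_Mapping.lookup q k = Poly_Mapping.lookup 0 k" by simp
qed

lemma kernel_push_ideal:
  fixes deg :: "('v \<Rightarrow>\<^sub>0 nat) \<Rightarrow> 'g::cancel_comm_monoid_add"
  assumes deg: "\<And>a b. deg (a + b) = deg a + deg b"
  shows "ideal {p \<in> carrier (poly_ring V). push deg p = (0 :: 'g \<Rightarrow>\<^sub>0 'k::field)} (poly_ring V)"
proof -
  let ?T = "{p \<in> carrier (poly_ring V). push deg p = (0 :: 'g \<Rightarrow>\<^sub>0 'k)}"
  note cl = poly_ring_closed
  show ?thesis
  proof (rule poly_ring_idealI)
    show "p + q \<in> ?T" if "p \<in> ?T" "q \<in> ?T" for p q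
      using that cl(1)[of p V q] by (simp add: push_add)
    show "x * p \<in> ?T" if "p \<in> ?T" "x \<in> carrier (poly_ring V)" for p x
      using that cl(2)[of x V p] by (simp add: push_mult[OF deg])
  qed auto
qed

text \<open>Replace each monomial of a kernel element by a fixed representative of its degree. Every
  replacement costs a multiple of a binomial that lies in the ideal by \<open>conn\<close>, and the
  polynomial in the representatives that remains is zero.\<close>

lemma ideal_eq_kernel_push:
  fixes deg :: "('v \<Rightarrow>\<^sub>0 nat) \<Rightarrow> 'g::cancel_comm_monoid_add"
    and G :: "('v, 'k::field) mpoly set"
  assumes deg: "\<And>a b. deg (a + b) = deg a + deg b"
    and G: "G \<subseteq> carrier (poly_ring V)" "\<And>p. p \<in> G \<Longrightarrow> push deg p = 0"
    and conn: "\<And>m m'. m \<in> monomials_in V \<Longrightarrow> m' \<in> monomials_in V \<Longrightarrow> deg m = deg m' \<Longrightarrow>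
      Poly_Mapping.single m 1 - Poly_Mapping.single m' 1 \<in> idl V G"
  shows "idl V G = {p \<in> carrier (poly_ring V). push deg p = 0}"
proof
  note i = genideal_poly_ring[OF G(1)]
  note c = poly_ring_ideal_closed[OF i(1)]
  show "idl V G \<subseteq> {p \<in> carrier (poly_ring V). push deg p = 0}"
    using G by (intro i(3) kernel_push_ideal deg) blast
  show "{p \<in> carrier (poly_ring V). push deg p = 0} \<subseteq> idl V G"
  proof
    fix p :: "('v, 'k) mpoly"
    assume p: "p \<in> {p \<in> carrier (poly_ring V). push deg p = 0}"
    define rep where "rep g = (SOME m. m \<in> monomials_in V \<and> deg m = g)" for g
    have rep: "rep (deg m) \<in> monomials_in V \<and> deg (rep (deg m)) = deg m" if "m \<in> monomials_in V" for m
      unfolding rep_def by (rule someI[of _ m]) (use that in auto)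
    \<comment> \<open>The replacement factors through \<open>push deg p\<close>, which is
      zero.\<close>
    have "push (rep \<circ> deg) p = 0"
      using p by (simp add: push_push[symmetric])
    then have "p = (\<Sum>m\<in>Poly_Mapping.keys p. Poly_Mapping.single m (Poly_Mapping.lookup p m)
        - Poly_Mapping.single (rep (deg m)) (Poly_Mapping.lookup p m))"
      by (simp add: sum_subtractf sum_monomials push_def)
    also have "\<dots> \<in> idl V G"
    proof (rule poly_ring_ideal_sum[OF i(1)])
      fix m assume "m \<in> Poly_Mapping.keys p"
      then have m: "m \<in> monomials_in V" using p by auto
      have "Poly_Mapping.single 0 (Poly_Mapping.lookup p m) *
          (Poly_Mapping.single m 1 - Poly_Mapping.single (rep (deg m)) 1) \<in> idl V G"
        using rep[OF m] m by (intro c(3) conn) auto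
      then show "Poly_Mapping.single m (Poly_Mapping.lookup p m)
          - Poly_Mapping.single (rep (deg m)) (Poly_Mapping.lookup p m) \<in> idl V G"
        by (simp add: algebra_simps mult_single)
    qed
    finally show "p \<in> idl V G" .
  qed
qed

text \<open>The image of a variable is a monomial of the target algebra, hence a nonzerodivisor
  there.\<close>

lemma var_cancel_kernel_push:
  fixes p :: "('v, 'k::field) mpoly" and deg :: "('v \<Rightarrow>\<^sub>0 nat) \<Rightarrow> 'g::cancel_comm_monoid_add"
  assumes deg: "\<And>a b. deg (a + b) = deg a + deg b"
    and "push deg (var v * p) = 0"
  shows "push deg p = 0"
  using assms(2) monomial_mult_eq_zero[of "deg (Poly_Mapping.single v 1)" "push deg p"]
  by (simp add: push_mult[OF deg] var_def)

text \<open>A multidegree with one coordinate for each set in \<open>S\<close>. Functions on all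
  sets, zero outside \<open>S\<close>, are used so that degrees for every \<open>S\<close> live in
  one cancellative monoid under pointwise addition.\<close>

definition weights :: "'v set set \<Rightarrow> ('v \<Rightarrow>\<^sub>0 nat) \<Rightarrow> 'v set \<Rightarrow> nat" where
  "weights S m = (\<lambda>X. if X \<in> S then \<Sum>v\<in>X. Poly_Mapping.lookup m v else 0)"

lemma weights_add: "weights S (a + b) = weights S a + weights S b"
  by (rule ext) (simp add: weights_def lookup_add sum.distrib)

lemma weights_eqD:
  assumes "weights S m = weights S m'" "X \<in> S"
  shows "(\<Sum>v\<in>X. Poly_Mapping.lookup m v) = (\<Sum>v\<in>X. Poly_Mapping.lookup m' v)"
  using fun_cong[OF assms(1), of X] assms(2) by (simp add: weights_def)

lemma var_mult_var:
  "var a * var b = Poly_Mapping.single (Poly_Mapping.single a 1 + Poly_Mapping.single b 1) 1"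
  by (simp add: var_def mult_single)

lemma push_weights_binomial:
  assumes "\<And>X. X \<in> S \<Longrightarrow> finite X \<and>
    of_bool (a \<in> X) + of_bool (b \<in> X) = (of_bool (c \<in> X) + of_bool (d \<in> X) :: nat)"
  shows "push (weights S) (var a * var b - var c * var d :: ('v, 'k::field) mpoly) = 0"
proof -
  have 1: "(\<Sum>v\<in>X. Poly_Mapping.lookup (Poly_Mapping.single u (1::nat)) v) = of_bool (u \<in> X)"
    if "finite X" for u and X :: "'v set"
    using that by (simp add: lookup_single when_def sum.delta of_bool_def)
  have "weights S (Poly_Mapping.single a 1 + Poly_Mapping.single b 1)
      = weights S (Poly_Mapping.single c 1 + Poly_Mapping.single d 1)"
    using assms by (intro ext) (simp add: weights_def lookup_add sum.distrib 1 del: One_nat_def)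
  then show ?thesis by (simp add: var_mult_var push_diff)
qed

subsection \<open>Connectivity of monomials under quadratic moves\<close>

lemma split_monomial:
  fixes m :: "'v \<Rightarrow>\<^sub>0 nat"
  assumes "0 < Poly_Mapping.lookup m a"
  obtains m0 where "m = Poly_Mapping.single a 1 + m0"
proof
  show "m = Poly_Mapping.single a 1 + Poly_Mapping.update a (Poly_Mapping.lookup m a - 1) m"
    using assms by (intro poly_mapping_eqI) (auto simp: lookup_add lookup_update lookup_single when_def)
qed

text \<open>One exchange of \<open>a b\<close> for \<open>c d\<close> inside a monomial. The last
  equation is additive on both sides so that exponents are never subtracted.\<close>

lemma monomial_move:
  fixes I :: "('v, 'k::field) mpoly set"
  assumes I: "ideal I (poly_ring V)" and rel: "var a * var b - var c * var d \<in> I"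
    and m: "m \<in> monomials_in V" and V: "c \<in> V" "d \<in> V"
    and pos: "0 < Poly_Mapping.lookup m a" "0 < Poly_Mapping.lookup m b" "a \<noteq> b"
  obtains m1 where "m1 \<in> monomials_in V"
    "Poly_Mapping.single m 1 - Poly_Mapping.single m1 1 \<in> I"
    "m + Poly_Mapping.single c 1 + Poly_Mapping.single d 1
      = m1 + Poly_Mapping.single a 1 + Poly_Mapping.single b 1"
proof -
  obtain m' where m': "m = Poly_Mapping.single a 1 + m'"
    by (rule split_monomial[OF pos(1)])
  have "0 < Poly_Mapping.lookup m' b" using pos(2,3) unfolding m' lookup_add by (simp add: lookup_single)
  then obtain m0 where m0: "m' = Poly_Mapping.single b 1 + m0"
    by (rule split_monomial)
  define m1 where "m1 = Poly_Mapping.single c 1 + Poly_Mapping.single d 1 + m0"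
  have "Poly_Mapping.keys m0 \<subseteq> Poly_Mapping.keys m"
    unfolding m' m0 by (auto simp: in_keys_iff lookup_add)
  then have m0V: "m0 \<in> monomials_in V" using m by (auto simp: monomials_in_def)
  show ?thesis
  proof
    show "m1 \<in> monomials_in V"
      unfolding m1_def using m0V V by (intro add_in_monomials_in) (auto simp: monomials_in_def)
    have "Poly_Mapping.single m0 1 * (var a * var b - var c * var d) \<in> I"
      using m0V by (intro poly_ring_ideal_closed(3)[OF I rel]) simp
    then show "Poly_Mapping.single m 1 - Poly_Mapping.single m1 1 \<in> I"
      unfolding m1_def m' m0 var_mult_var right_diff_distrib mult_single by (simp add: ac_simps)
    show "m + Poly_Mapping.single c 1 + Poly_Mapping.single d 1
      = m1 + Poly_Mapping.single a 1 + Poly_Mapping.single b 1"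
      unfolding m1_def m' m0 by (simp add: ac_simps)
  qed
qed

text \<open>The variables \<open>x k\<close> and \<open>y k\<close> are the two entries of column \<open>k\<close>.\<close>

definition minors :: "('i \<Rightarrow> 'v) \<Rightarrow> ('i \<Rightarrow> 'v) \<Rightarrow> 'i set \<Rightarrow> ('v, 'k::field) mpoly set" where
  "minors x y U = {var (x k) * var (y l) - var (x l) * var (y k) | k l. k \<in> U \<and> l \<in> U}"

definition two_rows :: "'v set \<Rightarrow> ('i \<Rightarrow> 'v) \<Rightarrow> ('i \<Rightarrow> 'v) \<Rightarrow> 'i set \<Rightarrow> bool" where
  "two_rows V x y U \<longleftrightarrow> finite U \<and> inj_on x U \<and> inj_on y U \<and> x ` U \<inter> y ` U = {} \<and>
     x ` U \<subseteq> V \<and> y ` U \<subseteq> V"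

lemma minors_carrier:
  assumes "x ` U \<subseteq> V" "y ` U \<subseteq> V"
  shows "(minors x y U :: ('v, 'k::field) mpoly set) \<subseteq> carrier (poly_ring V)"
proof
  fix p :: "('v, 'k) mpoly" assume "p \<in> minors x y U"
  then obtain k l where "k \<in> U" "l \<in> U" "p = var (x k) * var (y l) - var (x l) * var (y k)"
    by (auto simp: minors_def)
  then show "p \<in> carrier (poly_ring V)"
    using assms by (simp only:) (intro poly_ring_closed var_in_poly_ring; blast)
qed

text \<open>The two-row case of connecting tables with equal margins. As the sums of the first row
  agree, an excess in column \<open>k\<close> comes with a deficit in some column \<open>l\<close>,
  and the minor of these columns moves one unit from \<open>k\<close> to \<open>l\<close>. Truncated
  subtraction makes the induction measure count the excesses only, so it drops by one.\<close>

lemma connected_two_rows: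
  fixes I :: "('v, 'k::field) mpoly set" and x y :: "'i \<Rightarrow> 'v"
  assumes I: "ideal I (poly_ring V)" and U: "two_rows V x y U" and sub: "minors x y U \<subseteq> I"
    and m: "m \<in> monomials_in V" and m': "m' \<in> monomials_in V"
    and out: "\<And>v. v \<notin> x ` U \<union> y ` U \<Longrightarrow> Poly_Mapping.lookup m v = Poly_Mapping.lookup m' v"
    and col: "\<And>k. k \<in> U \<Longrightarrow> Poly_Mapping.lookup m (x k) + Poly_Mapping.lookup m (y k)
      = Poly_Mapping.lookup m' (x k) + Poly_Mapping.lookup m' (y k)"
    and row: "(\<Sum>k\<in>U. Poly_Mapping.lookup m (x k)) = (\<Sum>k\<in>U. Poly_Mapping.lookup m' (x k))"
  shows "Poly_Mapping.single m 1 - Poly_Mapping.single m' 1 \<in> I"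
  using m out col row
proof (induction "\<Sum>k\<in>U. Poly_Mapping.lookup m (x k) - Poly_Mapping.lookup m' (x k)"
    arbitrary: m rule: less_induct)
  case (less m)
  let ?l = "Poly_Mapping.lookup"
  have fin: "finite U" and inj: "inj_on x U" "inj_on y U" "x ` U \<inter> y ` U = {}"
    and V: "x ` U \<subseteq> V" "y ` U \<subseteq> V" using U by (auto simp: two_rows_def)
  show ?case
  proof (cases "\<exists>k\<in>U. ?l m' (x k) < ?l m (x k)")
    case False
    then have le: "?l m (x k) \<le> ?l m' (x k)" if "k \<in> U" for k using that by (meson not_le)
    have eq: "?l m (x k) = ?l m' (x k)" if "k \<in> U" for k
      using sum_mono_inv[OF less.prems(4) le that fin] .
    have "m = m'"
    proof (rule poly_mapping_eqI)
      fix v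
      show "?l m v = ?l m' v"
        using less.prems(2)[of v] less.prems(3) eq by fastforce
    qed
    then show ?thesis using poly_ring_ideal_closed(1)[OF I] by simp
  next
    case True
    then obtain k where k: "k \<in> U" "?l m' (x k) < ?l m (x k)" by blast
    have "\<exists>l\<in>U. ?l m (x l) < ?l m' (x l)"
    proof (rule ccontr)
      assume "\<not> ?thesis"
      then have le: "?l m' (x l) \<le> ?l m (x l)" if "l \<in> U" for l using that by (meson not_le)
      show False using sum_mono_inv[OF less.prems(4)[symmetric] le k(1) fin] k by simp
    qed
    then obtain l where l: "l \<in> U" "?l m (x l) < ?l m' (x l)" by blast
    have kl: "x k \<noteq> x l" "y k \<noteq> y l" "x k \<noteq> y l" "x k \<noteq> y k" "x l \<noteq> y k" "x l \<noteq> y l"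
      using k l inj by (auto dest: inj_onD)
    have "var (x k) * var (y l) - var (x l) * var (y k) \<in> I"
      using sub k l by (auto simp: minors_def)
    \<comment> \<open>Column sums agree, so the deficit of \<open>x l\<close> is a surplus of
      \<open>y l\<close>; this makes the exchange possible.\<close>
    moreover have "0 < ?l m (y l)" "0 < ?l m (x k)" using less.prems(3)[OF l(1)] l k by auto
    ultimately obtain m1 where m1: "m1 \<in> monomials_in V"
        "Poly_Mapping.single m 1 - Poly_Mapping.single m1 1 \<in> I"
      and e: "m + Poly_Mapping.single (x l) 1 + Poly_Mapping.single (y k) 1
        = m1 + Poly_Mapping.single (x k) 1 + Poly_Mapping.single (y l) 1"
      using monomial_move[OF I, of "x k" "y l" "x l" "y k" m] less.prems(1) V k l kl by blast
    have e: "?l m v + of_bool (v = x l) + of_bool (v = y k)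
        = ?l m1 v + of_bool (v = x k) + of_bool (v = y l)" for v
      using arg_cong[OF e, of "\<lambda>m. ?l m v"]
      by (auto simp: lookup_add lookup_single when_def of_bool_def split: if_splits)
    have other: "?l m1 v = ?l m v" if "v \<notin> {x k, x l, y k, y l}" for v
      using e[of v] that by auto
    have xk: "?l m1 (x k) + 1 = ?l m (x k)" and yl: "?l m1 (y l) + 1 = ?l m (y l)"
      and xl: "?l m1 (x l) = ?l m (x l) + 1" and yk: "?l m1 (y k) = ?l m (y k) + 1"
      using e[of "x k"] e[of "x l"] e[of "y k"] e[of "y l"] kl by auto
    have xj: "?l m1 (x j) = ?l m (x j)" "?l m1 (y j) = ?l m (y j)"
      if "j \<in> U" "j \<noteq> k" "j \<noteq> l" for j
      using that k l inj by (intro other; auto dest: inj_onD)+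
    have U': "U = insert k (insert l (U - {k, l}))" using k l by blast
    have kl': "k \<noteq> l" using kl by auto
    have split: "sum g U = g k + g l + sum g (U - {k, l})" for g :: "'i \<Rightarrow> nat"
      by (subst U', subst sum.insert, use fin kl' in auto)
    have rest: "(\<Sum>j\<in>U - {k, l}. ?l m1 (x j)) = (\<Sum>j\<in>U - {k, l}. ?l m (x j))"
      "(\<Sum>j\<in>U - {k, l}. ?l m1 (x j) - ?l m' (x j)) = (\<Sum>j\<in>U - {k, l}. ?l m (x j) - ?l m' (x j))"
      using xj by (auto intro!: sum.cong)
    have "Poly_Mapping.single m1 1 - Poly_Mapping.single m' 1 \<in> I"
    proof (rule less.hyps)
      show "(\<Sum>k\<in>U. ?l m1 (x k) - ?l m' (x k)) < (\<Sum>k\<in>U. ?l m (x k) - ?l m' (x k))"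
        unfolding split rest using xk xl k l by simp
      show "(\<Sum>k\<in>U. ?l m1 (x k)) = (\<Sum>k\<in>U. ?l m' (x k))"
        using less.prems(4) xk xl unfolding split rest by simp
      show "m1 \<in> monomials_in V" by (rule m1)
      show "?l m1 v = ?l m' v" if "v \<notin> x ` U \<union> y ` U" for v
        using less.prems(2)[OF that] other[of v] that k l by auto
      show "?l m1 (x j) + ?l m1 (y j) = ?l m' (x j) + ?l m' (y j)" if "j \<in> U" for j
        using less.prems(3)[OF that] xj[OF that] xk xl yk yl by (cases "j = k \<or> j = l") auto
    qed
    from poly_ring_ideal_closed(2)[OF I m1(2) this] show ?thesis by simp
  qed
qed

text \<open>The ideal of \<open>G\<close> is the colon of the ideal of \<open>H\<close> by the
  variable: \<open>mult\<close> gives one inclusion, and \<open>cancel\<close> gives the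
  other.\<close>

lemma knutson_family_saturate:
  fixes G H :: "('v, 'k::field) mpoly set"
  assumes K: "idl V H \<in> knutson_family (poly_ring V) f"
    and G: "G \<subseteq> carrier (poly_ring V)" and H: "H \<subseteq> G" and v: "v \<in> V"
    and cancel: "\<And>p. p \<in> carrier (poly_ring V) \<Longrightarrow> var v * p \<in> idl V G \<Longrightarrow>
      p \<in> idl V G"
    and mult: "\<And>g. g \<in> G \<Longrightarrow> var v * g \<in> idl V H"
  shows "idl V G \<in> knutson_family (poly_ring V) f"
proof -
  have Hc: "H \<subseteq> carrier (poly_ring V)" using G H by blast
  note vc = var_in_poly_ring[OF v]
  have vc': "{var v} \<subseteq> carrier (poly_ring V :: ('v, 'k) mpoly ring)" using vc by simp
  note iG = genideal_poly_ring[OF G] and iH = genideal_poly_ring[OF Hc]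
    and iv = genideal_poly_ring[OF vc']
  have HG: "idl V H \<subseteq> idl V G"
    using iH(3)[OF iG(1)] iG(2) H by blast
  note P = principal_poly_ring[OF vc]
  let ?C = "colon_ideal (poly_ring V) (idl V H) (idl V {var v})"
  have Cmem: "p \<in> ?C" if p: "p \<in> carrier (poly_ring V)" "var v * p \<in> idl V H" for p
  proof -
    have "p * q \<in> idl V H" if q: "q \<in> idl V {var v}" for q
    proof -
      obtain a where a: "a \<in> carrier (poly_ring V)" "q = a * var v"
        using q unfolding P by blast
      have "a * (var v * p) \<in> idl V H"
        by (rule poly_ring_ideal_closed(3)[OF iH(1)]) (fact p(2) a(1))+
      then show ?thesis unfolding a(2) by (simp only: ac_simps)
    qed
    then show ?thesis using p(1) unfolding colon_ideal_def poly_ring_simps(2) by blast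
  qed
  have "idl V G \<subseteq> ?C"
  proof (rule iG(3))
    show "ideal ?C (poly_ring V)" by (rule ideal_colon[OF iH(1)])
    show "G \<subseteq> ?C" using Cmem mult G by blast
  qed
  moreover have "?C \<subseteq> idl V G"
  proof
    fix p assume p: "p \<in> ?C"
    then have c: "p \<in> carrier (poly_ring V)" and "p * var v \<in> idl V H"
      using iv(2) unfolding colon_ideal_def poly_ring_simps(2) by blast+
    then have "var v * p \<in> idl V G" using HG by (simp only: mult.commute) blast
    then show "p \<in> idl V G" by (rule cancel[OF c])
  qed
  ultimately have "idl V G = ?C" by blast
  then show ?thesis using knutson_family.colon[OF K iv(1)] by simp
qed


section \<open>Ideals of 2-minors of a matrix with two rows\<close>

lemma binomial_carrier:
  assumes "a \<in> V" "b \<in> V" "c \<in> V" "d \<in> V"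
  shows "(var a * var b - var c * var d :: ('v, 'k::field) mpoly) \<in> carrier (poly_ring V)"
  by (intro poly_ring_closed var_in_poly_ring assms)

lemma principal_minus:
  fixes g :: "('v, 'k::field) mpoly"
  assumes "g \<in> carrier (poly_ring V)"
  shows "idl V {- g} = idl V {g}"
proof -
  have "- g \<in> idl V {g}" "g \<in> idl V {- g}"
    using genideal_poly_ring(1,2)[of "{g}" V] genideal_poly_ring(1,2)[of "{- g}" V]
      poly_ring_closed(3)[OF assms assms] assms
      poly_ring_ideal_closed(4)[of "idl V {g}" V g]
      poly_ring_ideal_closed(4)[of "idl V {- g}" V "- g"]
    by (simp_all del: poly_ring_simps)
  then show ?thesis
    using genideal_poly_ring(1,3)[of "{g}" V] genideal_poly_ring(1,3)[of "{- g}" V]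
      poly_ring_closed(3)[OF assms assms] assms
    by (intro equalityI) (simp_all del: poly_ring_simps)
qed

lemma genideal_minors_pair:
  fixes x y :: "'i \<Rightarrow> 'v"
  assumes V: "x k \<in> V" "x l \<in> V" "y k \<in> V" "y l \<in> V"
  shows "idl V (minors x y {k, l} :: ('v, 'k::field) mpoly set)
    = idl V {var (x k) * var (y l) - var (x l) * var (y k)}"
proof -
  let ?b = "var (x k) * var (y l) - var (x l) * var (y k) :: ('v, 'k) mpoly"
  have b: "{?b} \<subseteq> carrier (poly_ring V)"
    using binomial_carrier[of "x k" V "y l" "x l" "y k"] V by blast
  have M: "(minors x y {k, l} :: ('v, 'k) mpoly set) \<subseteq> carrier (poly_ring V)"
    using V by (intro minors_carrier) auto
  note ib = genideal_poly_ring[OF b] and iM = genideal_poly_ring[OF M]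
  note c = poly_ring_ideal_closed[OF ib(1)]
  have bI: "?b \<in> idl V {?b}" using ib(2) by blast
  have "minors x y {k, l} \<subseteq> idl V {?b}"
  proof
    fix g :: "('v, 'k) mpoly" assume "g \<in> minors x y {k, l}"
    then have "g = ?b \<or> g = - ?b \<or> g = 0"
      by (auto simp: minors_def)
    then show "g \<in> idl V {?b}"
      using bI c(1) c(4)[OF bI] by blast
  qed
  moreover have "?b \<in> idl V (minors x y {k, l})"
    using iM(2) unfolding minors_def by blast
  ultimately show ?thesis
    using ib(3)[OF iM(1)] iM(3)[OF ib(1)] by blast
qed

text \<open>The ideal of minors is the kernel for the multidegree made of the column sums, the sum
  of the first row and the exponents outside the matrix. The sum of the second row follows from
  these.\<close>

lemma minors_cancel_var:
  fixes x y :: "'i \<Rightarrow> 'v" and p :: "('v, 'k::field) mpoly"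
  assumes U: "two_rows V x y U"
    and p: "p \<in> carrier (poly_ring V)" "var v * p \<in> idl V (minors x y U)"
  shows "p \<in> idl V (minors x y U)"
proof -
  define S where "S = (\<lambda>v. {v}) ` (- (x ` U \<union> y ` U)) \<union> (\<lambda>k. {x k, y k}) ` U \<union> {x ` U}"
  have fin: "finite U" and inj: "inj_on x U" "inj_on y U" "x ` U \<inter> y ` U = {}"
    and V: "x ` U \<subseteq> V" "y ` U \<subseteq> V" using U by (auto simp: two_rows_def)
  have xe: "x k = x l \<longleftrightarrow> k = l" "y k = y l \<longleftrightarrow> k = l" "x k \<noteq> y l" "y l \<noteq> x k"
    if "k \<in> U" "l \<in> U" for k l
    using inj that by (auto simp: inj_on_def)
  have M: "(minors x y U :: ('v, 'k) mpoly set) \<subseteq> carrier (poly_ring V)"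
    using V by (rule minors_carrier)
  note i = genideal_poly_ring[OF M]
  have eq: "idl V (minors x y U)
      = {p \<in> carrier (poly_ring V). push (weights S) p = (0 :: _ \<Rightarrow>\<^sub>0 'k)}"
  proof (rule ideal_eq_kernel_push[where deg = "weights S", OF weights_add M])
    fix g :: "('v, 'k) mpoly" assume "g \<in> minors x y U"
    then obtain k l where kl: "k \<in> U" "l \<in> U" "g = var (x k) * var (y l) - var (x l) * var (y k)"
      by (auto simp: minors_def)
    show "push (weights S) g = 0"
      unfolding kl(3)
    proof (rule push_weights_binomial)
      fix X assume "X \<in> S"
      then consider v where "v \<notin> x ` U \<union> y ` U" "X = {v}" | j where "j \<in> U" "X = {x j, y j}"
        | "X = x ` U" by (auto simp: S_def)
      then show "finite X \<and> of_bool (x k \<in> X) + of_bool (y l \<in> X)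
          = (of_bool (x l \<in> X) + of_bool (y k \<in> X) :: nat)"
        by cases (use fin kl xe in auto)
    qed
  next
    fix m m' :: "'v \<Rightarrow>\<^sub>0 nat"
    assume m: "m \<in> monomials_in V" "m' \<in> monomials_in V" "weights S m = weights S m'"
    note w = weights_eqD[OF m(3)]
    show "Poly_Mapping.single m 1 - Poly_Mapping.single m' (1 :: 'k) \<in> idl V (minors x y U)"
    proof (rule connected_two_rows[OF i(1) U i(2) m(1,2)])
      show "Poly_Mapping.lookup m v = Poly_Mapping.lookup m' v" if "v \<notin> x ` U \<union> y ` U" for v
        using w[of "{v}"] that by (simp add: S_def)
      show "Poly_Mapping.lookup m (x k) + Poly_Mapping.lookup m (y k)
          = Poly_Mapping.lookup m' (x k) + Poly_Mapping.lookup m' (y k)" if "k \<in> U" for k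
        using w[of "{x k, y k}"] that xe by (simp add: S_def)
      show "(\<Sum>k\<in>U. Poly_Mapping.lookup m (x k)) = (\<Sum>k\<in>U. Poly_Mapping.lookup m' (x k))"
        using w[of "x ` U"] by (simp add: S_def sum.reindex[OF inj(1)])
    qed
  qed
  show ?thesis
    using p var_cancel_kernel_push[where deg = "weights S", OF weights_add] unfolding eq by blast
qed

text \<open>With \<open>[k, l]\<close> for the minor of the columns \<open>k\<close> and
  \<open>l\<close>, the identity \<open>x u * [k, w] = x k * [u, w] + x w * [k, u]\<close> puts
  \<open>x u\<close> times every new minor into the ideal of the old minors and
  \<open>[u, w]\<close>. The colon by \<open>x u\<close> then adds the whole column at the price of
  a single minor.\<close>

lemma knutson_family_attach_column:
  fixes x y :: "'i \<Rightarrow> 'v" and f :: "('v, 'k::field) mpoly"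
  assumes K: "idl V (minors x y U) \<in> knutson_family (poly_ring V) f"
    and E: "idl V {var (x u) * var (y w) - var (x w) * var (y u)}
      \<in> knutson_family (poly_ring V) f"
    and U: "two_rows V x y (insert w U)" and u: "u \<in> U"
  shows "idl V (minors x y (insert w U)) \<in> knutson_family (poly_ring V) f"
proof -
  let ?b = "var (x u) * var (y w) - var (x w) * var (y u) :: ('v, 'k) mpoly"
  let ?H = "minors x y U \<union> {?b}"
  have V: "x ` insert w U \<subseteq> V" "y ` insert w U \<subseteq> V" using U by (auto simp: two_rows_def)
  have G: "(minors x y (insert w U) :: ('v, 'k) mpoly set) \<subseteq> carrier (poly_ring V)"
    by (rule minors_carrier[OF V])
  have HG: "?H \<subseteq> minors x y (insert w U)"
    using u by (auto simp: minors_def)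
  have Hc: "?H \<subseteq> carrier (poly_ring V)" using HG G by (rule subset_trans)
  note H1 = Hc[unfolded Un_subset_iff, THEN conjunct1] Hc[unfolded Un_subset_iff, THEN conjunct2]
  note i = genideal_poly_ring[OF Hc]
  note c = poly_ring_ideal_closed[OF i(1)]
  have "idl V ?H \<in> knutson_family (poly_ring V) f"
    using knutson_family.sum[OF K E] unfolding set_add_genideal[OF H1] .
  then show ?thesis
  proof (rule knutson_family_saturate[OF _ G HG, where v = "x u"])
    show "x u \<in> V" using V u by auto
    fix p :: "('v, 'k) mpoly"
    assume "p \<in> carrier (poly_ring V)" "var (x u) * p \<in> idl V (minors x y (insert w U))"
    then show "p \<in> idl V (minors x y (insert w U))"
      by (rule minors_cancel_var[OF U])
  next
    have bI: "?b \<in> idl V ?H" using subsetD[OF i(2)] by simp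
    have mI: "var (x k) * var (y l) - var (x l) * var (y k) \<in> idl V ?H"
      if "k \<in> U" "l \<in> U" for k l
      using that by (intro subsetD[OF i(2)]) (auto simp: minors_def)
    have vc: "(var (x k) :: ('v, 'k) mpoly) \<in> carrier (poly_ring V)" if "k \<in> insert w U" for k
      using V that by (intro var_in_poly_ring) blast
    have kw: "var (x u) * (var (x k) * var (y w) - var (x w) * var (y k)) \<in> idl V ?H"
      if k: "k \<in> U" for k
    proof -
      have "var (x k) * ?b + var (x w) * (var (x k) * var (y u) - var (x u) * var (y k))
          \<in> idl V ?H"
        using k u by (intro c(2) c(3) bI mI vc) auto
      then show ?thesis by (simp add: algebra_simps)
    qed
    fix g :: "('v, 'k) mpoly" assume "g \<in> minors x y (insert w U)"
    then obtain k l where kl: "k \<in> insert w U" "l \<in> insert w U"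
        "g = var (x k) * var (y l) - var (x l) * var (y k)"
      by (auto simp: minors_def)
    consider "k \<in> U" "l \<in> U" | "k \<in> U" "l = w" | "k = w" "l \<in> U" | "k = w" "l = w"
      using kl by blast
    then show "var (x u) * g \<in> idl V ?H"
    proof cases
      case 1
      then show ?thesis unfolding kl(3) using u by (intro c(3) mI vc) auto
    next
      case 2
      then show ?thesis unfolding kl(3) using kw by blast
    next
      case 3
      then show ?thesis using c(4)[OF kw[of l]] unfolding kl(3) by (simp add: algebra_simps)
    next
      case 4
      then show ?thesis unfolding kl(3) using c(1) by simp
    qed
  qed
qed


subsection \<open>Two blocks meeting in a corner cell\<close>

text \<open>
  The corner cell has the entries \<open>x p\<close>, \<open>y p\<close>, \<open>x q\<close>, \<open>y q\<close>; the second block is the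
  matrix with rows \<open>x p, y p, zp\<close> and \<open>x q, y q, zq\<close>.
\<close>

definition elbow_minors ::
    "('i \<Rightarrow> 'v) \<Rightarrow> ('i \<Rightarrow> 'v) \<Rightarrow> 'i \<Rightarrow> 'i \<Rightarrow> 'v \<Rightarrow> 'v \<Rightarrow> ('v, 'k::field) mpoly set" where
  "elbow_minors x y p q zp zq =
     {var (x p) * var (y q) - var (x q) * var (y p),
      var (x p) * var zq - var (x q) * var zp,
      var (y p) * var zq - var (y q) * var zp}"

lemma elbow_minors_carrier:
  assumes "x p \<in> V" "x q \<in> V" "y p \<in> V" "y q \<in> V" "zp \<in> V" "zq \<in> V"
  shows "elbow_minors x y p q zp zq \<subseteq> carrier (poly_ring V)"
  unfolding elbow_minors_def using assms
  by (intro insert_subsetI binomial_carrier empty_subsetI)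

lemma weights_move:
  assumes e: "m + Poly_Mapping.single c 1 + Poly_Mapping.single d 1
      = m1 + Poly_Mapping.single a 1 + Poly_Mapping.single b (1::nat)"
    and "\<And>X. X \<in> S \<Longrightarrow> finite X \<and>
      of_bool (a \<in> X) + of_bool (b \<in> X) = (of_bool (c \<in> X) + of_bool (d \<in> X) :: nat)"
  shows "weights S m1 = weights S m"
proof (rule ext)
  fix X
  have 1: "(\<Sum>v\<in>X. Poly_Mapping.lookup (Poly_Mapping.single u (1::nat)) v) = of_bool (u \<in> X)"
    if "finite X" for u and X :: "'a set"
    using that by (simp add: lookup_single when_def sum.delta of_bool_def)
  show "weights S m1 X = weights S m X"
  proof (cases "X \<in> S")
    case True
    have "(\<Sum>v\<in>X. Poly_Mapping.lookup (m + Poly_Mapping.single c 1 + Poly_Mapping.single d 1) v)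
      = (\<Sum>v\<in>X. Poly_Mapping.lookup (m1 + Poly_Mapping.single a 1 + Poly_Mapping.single b 1) v)"
      by (simp only: e)
    then show ?thesis
      using assms(2)[OF True] True 1[of X]
      by (simp add: weights_def lookup_add sum.distrib del: One_nat_def)
  qed (simp add: weights_def)
qed

text \<open>Both matrices share the corner cell, so the columns \<open>p\<close> and
  \<open>q\<close> of the first are weighed together with \<open>zp\<close> and \<open>zq\<close>,
  as rows of the second. Monomials of equal degree are connected in two stages: minors of the second
  matrix adjust the exponents of \<open>zp\<close> and \<open>zq\<close>, and then only the two-row
  matrix is left.\<close>

lemma elbow_minors_cancel_var:
  fixes x y :: "'i \<Rightarrow> 'v" and g :: "('v, 'k::field) mpoly"
  assumes U: "two_rows V x y U" and pq: "p \<in> U" "q \<in> U" "p \<noteq> q"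
    and z: "zp \<in> V" "zq \<in> V" "zp \<noteq> zq" "zp \<notin> x ` U \<union> y ` U" "zq \<notin> x ` U \<union> y ` U"
    and g: "g \<in> carrier (poly_ring V)"
      "var v * g \<in> idl V (minors x y U \<union> elbow_minors x y p q zp zq)"
  shows "g \<in> idl V (minors x y U \<union> elbow_minors x y p q zp zq)"
proof -
  let ?l = "Poly_Mapping.lookup"
  let ?G = "minors x y U \<union> elbow_minors x y p q zp zq :: ('v, 'k) mpoly set"
  define S where "S = (\<lambda>v. {v}) ` (- (x ` U \<union> y ` U \<union> {zp, zq}))
    \<union> (\<lambda>k. {x k, y k}) ` (U - {p, q}) \<union> {{x p, y p, zp}, {x q, y q, zq}, x ` U, y ` U, {zp, zq}}"
  have fin: "finite U" and inj: "inj_on x U" "inj_on y U" "x ` U \<inter> y ` U = {}"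
    and V: "x ` U \<subseteq> V" "y ` U \<subseteq> V" using U by (auto simp: two_rows_def)
  have xe: "x k = x l \<longleftrightarrow> k = l" "y k = y l \<longleftrightarrow> k = l" "x k \<noteq> y l" "y l \<noteq> x k"
    if "k \<in> U" "l \<in> U" for k l
    using inj that by (auto simp: inj_on_def)
  have ze: "x k \<noteq> zp" "x k \<noteq> zq" "y k \<noteq> zp" "y k \<noteq> zq" "zp \<noteq> x k" "zq \<noteq> x k" "zp \<noteq> y k" "zq \<noteq> y k"
    if "k \<in> U" for k
    using z that by auto
  have Scases: "(\<exists>v. v \<notin> x ` U \<union> y ` U \<union> {zp, zq} \<and> X = {v}) \<or> (\<exists>j. j \<in> U - {p, q} \<and> X = {x j, y j})
      \<or> X = {x p, y p, zp} \<or> X = {x q, y q, zq} \<or> X = x ` U \<or> X = y ` U \<or> X = {zp, zq}"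
    if X: "X \<in> S" for X
  proof -
    consider v where "v \<in> - (x ` U \<union> y ` U \<union> {zp, zq})" "X = {v}"
      | j where "j \<in> U - {p, q}" "X = {x j, y j}"
      | "X \<in> {{x p, y p, zp}, {x q, y q, zq}, x ` U, y ` U, {zp, zq}}"
      using X unfolding S_def by (elim UnE imageE)
    then show ?thesis
    proof cases
      case 1
      then show ?thesis by (intro disjI1 exI[of _ v]) simp
    next
      case 2
      then show ?thesis by (intro disjI2[OF disjI1] exI[of _ j] conjI)
    next
      case 3
      then show ?thesis unfolding insert_iff empty_iff by argo
    qed
  qed
  have bin1: "finite X \<and> of_bool (x k \<in> X) + of_bool (y l \<in> X)
      = (of_bool (x l \<in> X) + of_bool (y k \<in> X) :: nat)" if "X \<in> S" "k \<in> U" "l \<in> U" for X k l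
    using Scases[OF that(1)]
    by (elim disjE exE conjE) (use fin that(2,3) xe ze pq z in auto)
  have bin2: "finite X \<and> of_bool (x p \<in> X) + of_bool (zq \<in> X)
      = (of_bool (x q \<in> X) + of_bool (zp \<in> X) :: nat)" if "X \<in> S" for X
    using Scases[OF that(1)]
    by (elim disjE exE conjE) (use fin xe ze pq z in auto)
  have bin3: "finite X \<and> of_bool (y p \<in> X) + of_bool (zq \<in> X)
      = (of_bool (y q \<in> X) + of_bool (zp \<in> X) :: nat)" if "X \<in> S" for X
    using Scases[OF that(1)]
    by (elim disjE exE conjE) (use fin xe ze pq z in auto)
  have G: "?G \<subseteq> carrier (poly_ring V)"
    using minors_carrier[OF V] elbow_minors_carrier[of x p V q y zp zq] V pq z by auto
  note i = genideal_poly_ring[OF G]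
  note c = poly_ring_ideal_closed[OF i(1)]
  have rel: "var (x p) * var zq - var (x q) * var zp \<in> idl V ?G"
    "var (y p) * var zq - var (y q) * var zp \<in> idl V ?G"
    by (intro subsetD[OF i(2)]; simp add: elbow_minors_def)+
  have rel': "var zp * var (x q) - var zq * var (x p) \<in> idl V ?G"
    "var zp * var (y q) - var zq * var (y p) \<in> idl V ?G"
    using c(4)[OF rel(1)] c(4)[OF rel(2)] by (simp_all add: mult.commute)
  \<comment> \<open>Lowers the exponent of \<open>a\<close> to its value in \<open>m'\<close>. The
    variable \<open>a\<close> is whichever of \<open>zp\<close> and \<open>zq\<close> is in excess,
    and \<open>b\<close> is the other one; \<open>t\<close> is the column of the corner cell that
    gives up a unit, and \<open>r\<close> the one that receives it.\<close>
  have shift: "\<exists>m1\<in>monomials_in V. weights S m1 = weights S m \<and> ?l m1 a = ?l m' a \<and>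
      Poly_Mapping.single m 1 - Poly_Mapping.single m1 (1 :: 'k) \<in> idl V ?G"
    if ab: "(a, b, r, t) = (zp, zq, p, q) \<or> (a, b, r, t) = (zq, zp, q, p)"
      and m: "m \<in> monomials_in V" "weights S m = weights S m'" "?l m' a \<le> ?l m a" for m m' a b r t
    using m
  proof (induction "?l m a" arbitrary: m rule: less_induct)
    case (less m)
    show ?case
    proof (cases "?l m a = ?l m' a")
      case True
      then show ?thesis using less.prems c(1) by (intro bexI[of _ m]) auto
    next
      case False
      note w = weights_eqD[OF less.prems(2)]
      have gt: "?l m' a < ?l m a" using False less.prems by simp
      have "?l m zp + ?l m zq = ?l m' zp + ?l m' zq"
        using w[of "{zp, zq}"] z by (simp add: S_def)
      moreover have "?l m (x q) + ?l m (y q) + ?l m zq = ?l m' (x q) + ?l m' (y q) + ?l m' zq"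
        "?l m (x p) + ?l m (y p) + ?l m zp = ?l m' (x p) + ?l m' (y p) + ?l m' zp"
        using w[of "{x q, y q, zq}"] w[of "{x p, y p, zp}"] z pq xe ze by (simp_all add: S_def)
      \<comment> \<open>The excess at \<open>a\<close> is a deficit at \<open>b\<close>, and the sum
        over the triple containing \<open>b\<close> turns it into a positive entry of the corner
        cell in column \<open>t\<close>.\<close>
      ultimately have "0 < ?l m (x t) + ?l m (y t)" using gt ab by auto
      then have "0 < ?l m (x t) \<or> 0 < ?l m (y t)" by simp
      then obtain \<xi> where \<xi>: "\<xi> = x \<or> \<xi> = y" "0 < ?l m (\<xi> t)" by blast
      have bin: "finite X \<and> of_bool (a \<in> X) + of_bool (\<xi> t \<in> X)
          = (of_bool (b \<in> X) + of_bool (\<xi> r \<in> X) :: nat)" if "X \<in> S" for X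
        using ab \<xi>(1) bin2[OF that] bin3[OF that]
        by (elim disjE) (simp_all add: add.commute)
      have rt: "var a * var (\<xi> t) - var b * var (\<xi> r) \<in> idl V ?G"
      proof -
        have "var zq * var (x p) - var zp * var (x q) \<in> idl V ?G"
          "var zq * var (y p) - var zp * var (y q) \<in> idl V ?G"
          using rel by (simp_all add: mult.commute)
        then show ?thesis using rel' ab \<xi>(1) by auto
      qed
      have ne: "a \<noteq> \<xi> t" "a \<noteq> b" "a \<noteq> \<xi> r" using ab \<xi>(1) ze pq z by auto
      have inV: "b \<in> V" "\<xi> r \<in> V" using ab \<xi>(1) V pq z by auto
      have "0 < ?l m a" using gt by simp
      from monomial_move[OF i(1) rt less.prems(1) inV this \<xi>(2) ne(1)]
      obtain m1 where m1: "m1 \<in> monomials_in V"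
          "Poly_Mapping.single m 1 - Poly_Mapping.single m1 (1 :: 'k) \<in> idl V ?G"
        and e: "m + Poly_Mapping.single b 1 + Poly_Mapping.single (\<xi> r) 1
          = m1 + Poly_Mapping.single a 1 + Poly_Mapping.single (\<xi> t) 1" .
      have wm1: "weights S m1 = weights S m" by (rule weights_move[OF e bin])
      have a1: "?l m a = ?l m1 a + 1"
        using arg_cong[OF e, of "\<lambda>m. ?l m a"] ne by (simp add: lookup_add lookup_single when_def)
      obtain m2 where m2: "m2 \<in> monomials_in V" "weights S m2 = weights S m1" "?l m2 a = ?l m' a"
          "Poly_Mapping.single m1 1 - Poly_Mapping.single m2 (1 :: 'k) \<in> idl V ?G"
        using less.hyps[of m1] a1 gt m1(1) wm1 less.prems(2) by auto
      have "Poly_Mapping.single m 1 - Poly_Mapping.single m2 (1 :: 'k) \<in> idl V ?G"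
        using c(2)[OF m1(2) m2(4)] by simp
      then show ?thesis using m2 wm1 by (intro bexI[of _ m2]) auto
    qed
  qed
  have eq: "idl V ?G
      = {p \<in> carrier (poly_ring V). push (weights S) p = (0 :: _ \<Rightarrow>\<^sub>0 'k)}"
  proof (rule ideal_eq_kernel_push[where deg = "weights S", OF weights_add G])
    fix h :: "('v, 'k) mpoly" assume "h \<in> ?G"
    then consider k l where "k \<in> U" "l \<in> U" "h = var (x k) * var (y l) - var (x l) * var (y k)"
      | "h = var (x p) * var zq - var (x q) * var zp" | "h = var (y p) * var zq - var (y q) * var zp"
      using pq by (auto simp: minors_def elbow_minors_def)
    then show "push (weights S) h = 0"
      by cases (simp_all add: push_weights_binomial bin1 bin2 bin3)
  next
    fix m m' :: "'v \<Rightarrow>\<^sub>0 nat"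
    assume m: "m \<in> monomials_in V" "m' \<in> monomials_in V" "weights S m = weights S m'"
    have zsum: "?l m zp + ?l m zq = ?l m' zp + ?l m' zq"
      using weights_eqD[OF m(3), of "{zp, zq}"] z by (simp add: S_def)
    obtain m1 where m1: "m1 \<in> monomials_in V" "weights S m1 = weights S m"
        "?l m1 zp = ?l m' zp \<or> ?l m1 zq = ?l m' zq"
        "Poly_Mapping.single m 1 - Poly_Mapping.single m1 (1 :: 'k) \<in> idl V ?G"
    proof (cases "?l m' zp \<le> ?l m zp")
      case True
      from shift[OF _ m(1,3) this, of zq p q] show ?thesis using that by blast
    next
      case False
      then have "?l m' zq \<le> ?l m zq" using zsum by simp
      from shift[OF _ m(1,3) this, of zp q p] show ?thesis using that by blast
    qed
    note w = weights_eqD[OF m1(2)[unfolded m(3)]]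
    have zeq: "?l m1 zp = ?l m' zp" "?l m1 zq = ?l m' zq"
      using w[of "{zp, zq}"] z m1(3) by (auto simp: S_def)
    have "Poly_Mapping.single m1 1 - Poly_Mapping.single m' (1 :: 'k) \<in> idl V ?G"
    proof (rule connected_two_rows[OF i(1) U _ m1(1) m(2)])
      show "minors x y U \<subseteq> idl V ?G" using i(2) by (rule subset_trans[rotated]) simp
      show "?l m1 v = ?l m' v" if "v \<notin> x ` U \<union> y ` U" for v
        using w[of "{v}"] that zeq by (cases "v = zp \<or> v = zq") (auto simp: S_def)
      show "?l m1 (x k) + ?l m1 (y k) = ?l m' (x k) + ?l m' (y k)" if "k \<in> U" for k
      proof -
        consider "k = p" | "k = q" | "k \<in> U - {p, q}" using \<open>k \<in> U\<close> by blast
        then show ?thesis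
        proof cases
          case 1
          then show ?thesis using w[of "{x p, y p, zp}"] zeq pq xe ze by (simp add: S_def)
        next
          case 2
          then show ?thesis using w[of "{x q, y q, zq}"] zeq pq xe ze by (simp add: S_def)
        next
          case 3
          then show ?thesis using w[of "{x k, y k}"] xe by (simp add: S_def)
        qed
      qed
      show "(\<Sum>k\<in>U. ?l m1 (x k)) = (\<Sum>k\<in>U. ?l m' (x k))"
        using w[of "x ` U"] by (simp add: S_def sum.reindex[OF inj(1)])
    qed
    from c(2)[OF m1(4) this]
    show "Poly_Mapping.single m 1 - Poly_Mapping.single m' (1 :: 'k) \<in> idl V ?G" by simp
  qed
  show ?thesis
    using g var_cancel_kernel_push[where deg = "weights S", OF weights_add] unfolding eq by blast
qed

text \<open>For a block whose last cell has no factor of its own: the missing minor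
  \<open>[p, q]\<close> is taken from the second matrix. Column \<open>q\<close> is then attached at
  \<open>p\<close> as before, but the cancellation of \<open>x p\<close> takes place modulo both
  matrices at once.\<close>

lemma knutson_family_elbow:
  fixes x y :: "'i \<Rightarrow> 'v" and f :: "('v, 'k::field) mpoly"
  assumes K: "idl V (minors x y U) \<in> knutson_family (poly_ring V) f"
    and E: "idl V (elbow_minors x y p q zp zq) \<in> knutson_family (poly_ring V) f"
    and U: "two_rows V x y (insert q U)" and pq: "p \<in> U" "p \<noteq> q"
    and z: "zp \<in> V" "zq \<in> V" "zp \<noteq> zq" "zp \<notin> x ` insert q U \<union> y ` insert q U"
      "zq \<notin> x ` insert q U \<union> y ` insert q U"
  shows "idl V (minors x y (insert q U) \<union> elbow_minors x y p q zp zq)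
    \<in> knutson_family (poly_ring V) f"
proof -
  let ?E = "elbow_minors x y p q zp zq :: ('v, 'k) mpoly set"
  let ?H = "minors x y U \<union> ?E"
  have V: "x ` insert q U \<subseteq> V" "y ` insert q U \<subseteq> V" using U by (auto simp: two_rows_def)
  have Ec: "?E \<subseteq> carrier (poly_ring V)"
    using V pq z by (intro elbow_minors_carrier) auto
  have Mc: "(minors x y (insert q U) :: ('v, 'k) mpoly set) \<subseteq> carrier (poly_ring V)"
    by (rule minors_carrier[OF V])
  have G: "minors x y (insert q U) \<union> ?E \<subseteq> carrier (poly_ring V)"
    using Mc Ec by (rule Un_least)
  have sub: "minors x y U \<subseteq> (minors x y (insert q U) :: ('v, 'k) mpoly set)"
    by (auto simp: minors_def)
  have HG: "?H \<subseteq> minors x y (insert q U) \<union> ?E" using sub by (rule Un_mono) simp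
  have Hc: "?H \<subseteq> carrier (poly_ring V)" using HG G by (rule subset_trans)
  have M1: "(minors x y U :: ('v, 'k) mpoly set) \<subseteq> carrier (poly_ring V)"
    using sub Mc by (rule subset_trans)
  note i = genideal_poly_ring[OF Hc]
  note c = poly_ring_ideal_closed[OF i(1)]
  have "idl V ?H \<in> knutson_family (poly_ring V) f"
    using knutson_family.sum[OF K E] unfolding set_add_genideal[OF M1 Ec] .
  then show ?thesis
  proof (rule knutson_family_saturate[OF _ G HG, where v = "x p"])
    show "x p \<in> V" using V pq by auto
    fix g :: "('v, 'k) mpoly"
    assume "g \<in> carrier (poly_ring V)"
      "var (x p) * g \<in> idl V (minors x y (insert q U) \<union> ?E)"
    then show "g \<in> idl V (minors x y (insert q U) \<union> ?E)"
      using elbow_minors_cancel_var[OF U _ _ pq(2) z] pq by auto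
  next
    have eI: "e \<in> idl V ?H" if "e \<in> ?E" for e
      using that by (intro subsetD[OF i(2)]) simp
    have mI: "var (x k) * var (y l) - var (x l) * var (y k) \<in> idl V ?H"
      if "k \<in> U" "l \<in> U" for k l
      using that by (intro subsetD[OF i(2)]) (auto simp: minors_def)
    have pqI: "var (x p) * var (y q) - var (x q) * var (y p) \<in> idl V ?H"
      by (intro eI) (simp add: elbow_minors_def)
    have vc: "(var (x k) :: ('v, 'k) mpoly) \<in> carrier (poly_ring V)" if "k \<in> insert q U" for k
      using V that by (intro var_in_poly_ring) blast
    have kq: "var (x p) * (var (x k) * var (y q) - var (x q) * var (y k)) \<in> idl V ?H"
      if k: "k \<in> U" for k
    proof -
      have "var (x k) * (var (x p) * var (y q) - var (x q) * var (y p))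
          + var (x q) * (var (x k) * var (y p) - var (x p) * var (y k))
          \<in> idl V ?H"
        using k pq by (intro c(2) c(3) pqI mI vc) auto
      then show ?thesis by (simp add: algebra_simps)
    qed
    fix g :: "('v, 'k) mpoly" assume "g \<in> minors x y (insert q U) \<union> ?E"
    then consider "g \<in> ?E" | k l where "k \<in> insert q U" "l \<in> insert q U"
        "g = var (x k) * var (y l) - var (x l) * var (y k)"
      by (auto simp: minors_def)
    then show "var (x p) * g \<in> idl V ?H"
    proof cases
      case 1
      then show ?thesis using pq by (intro c(3) eI vc) auto
    next
      case kl: 2
      consider "k \<in> U" "l \<in> U" | "k \<in> U" "l = q" | "k = q" "l \<in> U" | "k = q" "l = q"
        using kl by blast
      then show ?thesis
      proof cases
        case 1
        then show ?thesis unfolding kl(3) using pq by (intro c(3) mI vc) auto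
      next
        case 2
        then show ?thesis unfolding kl(3) using kq by blast
      next
        case 3
        then show ?thesis using c(4)[OF kq[of l]] unfolding kl(3) by (simp add: algebra_simps)
      next
        case 4
        then show ?thesis unfolding kl(3) using c(1) by simp
      qed
    qed
  qed
qed

section \<open>Sequences of turns\<close>

text \<open>
  The path turns left at cell \<open>k\<close> if \<open>\<tau> k = 1\<close> and right if \<open>\<tau> k = -1\<close>; \<open>\<eta> k\<close> is the next turn
  strictly after \<open>k\<close>, and \<open>D k\<close> the number of steps to it. The label \<open>(k, s)\<close> stands for the
  vertex of cell \<open>k\<close> that is in front of a walker entering the cell, on the left if \<open>s = 1\<close> and on
  the right if \<open>s = -1\<close>; every vertex of the path has exactly one label. In these terms
  \<open>gap k s\<close> lies on side \<open>s\<close> of the common edge of the cells \<open>k\<close> and \<open>k + 1\<close>, and \<open>rear k s\<close> on the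
  opposite edge of cell \<open>k\<close>. The factor \<open>i\<close> has the leading labels \<open>diag1 i (side i)\<close>,
  \<open>diag2 i (side i)\<close> and the trailing labels \<open>diag1 i (- side i)\<close>, \<open>diag2 i (- side i)\<close>.
\<close>

locale turning =
  fixes \<tau> \<eta> :: "int \<Rightarrow> int" and D :: "int \<Rightarrow> nat" and N :: nat
  assumes turn_cases: "\<tau> k = 0 \<or> \<tau> k = 1 \<or> \<tau> k = -1"
    and no_double_turn: "\<tau> k \<noteq> 0 \<Longrightarrow> \<tau> (k + 1) \<noteq> \<tau> k"
    and next_cases: "\<eta> k = 1 \<or> \<eta> k = -1"
    and next_turn: "\<eta> k = (if \<tau> (k + 1) = 0 then \<eta> (k + 1) else \<tau> (k + 1))"
    and next_distance: "D k = (if \<tau> (k + 1) = 0 then Suc (D (k + 1)) else 1)"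
    and distance_le: "D k \<le> N"
begin

text \<open>If the path turns towards side \<open>s\<close>, the vertex is the pivot of the turn. It
  already lies in front of cell \<open>k - 1\<close>, which is straight or turns the other way, and
  so it carries a label of that cell.\<close>

definition gap :: "int \<Rightarrow> int \<Rightarrow> int \<times> int" where
  "gap k s = (if \<tau> k = 0 then (k, s)
     else if \<tau> k = s then (if \<tau> (k - 1) = 0 then (k - 1, s) else (k - 1, - s))
     else (k, - s))"

definition rear :: "int \<Rightarrow> int \<Rightarrow> int \<times> int" where
  "rear k s = (if \<tau> k = 0 then gap (k - 1) s else if s = \<tau> k then gap (k - 1) (- s) else (k, s))"

definition uturn :: "int \<Rightarrow> bool" where
  "uturn k \<longleftrightarrow> \<tau> k \<noteq> 0 \<and> \<eta> k = \<tau> k"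

text \<open>A straight cell leads with the rear vertex on the side of the next turn and the front
  vertex on the other side, and a domino does the same with its outer edges. A corner cell that
  keeps its own minor takes the opposite diagonal.\<close>

definition side :: "int \<Rightarrow> int" where
  "side i = (if \<not> uturn (i + 1) \<and> \<tau> i \<noteq> 0 then - \<eta> i else \<eta> i)"

definition diag1 :: "int \<Rightarrow> int \<Rightarrow> int \<times> int" where
  "diag1 i s = (if uturn (i + 1) then rear i s else gap (i - 1) s)"

definition diag2 :: "int \<Rightarrow> int \<Rightarrow> int \<times> int" where
  "diag2 i s = (if uturn (i + 1) then (i + 1, - s) else (i, - s))"

text \<open>
  Variables with a small key are large in the lexicographic order. Each factor has a label that
  occurs in no factor coming after it, if the corner cells are taken first and then
  each block is traversed backwards from its last corner. The labels occurring in no such way get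
  the largest key.
\<close>

definition key :: "int \<times> int \<Rightarrow> nat" where
  "key = (\<lambda>(k, s). if \<tau> k = 0 then (if s = - \<eta> k then (if uturn (k + 1) then 0 else D k) else N + 1)
     else if \<not> uturn k then (if s = - \<tau> k then 0 else N + 1)
     else if \<tau> (k - 1) = 0 then (if s = - \<tau> k then 1 else N + 1)
     else (if s = \<tau> k then D k else N + 1))"

definition init_labels :: "int \<Rightarrow> (int \<times> int) set" where
  "init_labels i = {diag1 i (side i), diag2 i (side i)}"


text \<open>The factor whose leading term contains the given label. As a left inverse of the leading
  labels it reduces their disjointness to evaluating a function.\<close>

definition owner :: "int \<times> int \<Rightarrow> int" where
  "owner = (\<lambda>(k, s).
     if uturn k then (if s = \<tau> k then k else k - 1)
     else if s = (if \<tau> k = 0 then - \<eta> k else \<eta> k)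
     then (if \<tau> k = 0 \<and> uturn (k + 1) then k + 1 else k)
     else (if \<tau> (k + 1) \<noteq> 0 \<and> (uturn (k + 1) \<or> uturn (k + 2)) then k + 2 else k + 1))"

text \<open>The finite list of local states, so that identities between labels become case splits
  with concrete signs.\<close>

lemma window:
  "\<tau> k = 0 \<and> (\<eta> k = 1 \<or> \<eta> k = -1) \<or> \<tau> k = 1 \<and> (\<eta> k = 1 \<and> \<tau> (k + 1) = 0 \<or> \<eta> k = - 1) \<or>
    \<tau> k = -1 \<and> (\<eta> k = 1 \<or> \<eta> k = -1 \<and> \<tau> (k + 1) = 0)"
  using turn_cases[of k] next_cases[of k] no_double_turn[of k] next_turn[of k] turn_cases[of "k + 1"]
  by auto

lemma owner_diag2: "owner (diag2 i (side i)) = i"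
  unfolding diag2_def side_def owner_def uturn_def
  by (insert window[of i] next_turn[of i], elim disjE conjE; simp?;
      insert window[of "i + 1"], elim disjE conjE; simp)



text \<open>Here \<open>u\<close> is \<open>side (k + 1)\<close>. The situation left out by the
  second assumption is a domino that starts at a corner, the only one where \<open>diag1\<close> is
  not a \<open>gap\<close> label.\<close>

lemma owner_gap:
  assumes u: "u = (if \<tau> (k + 1) = 0 then \<eta> (k + 1) else - \<eta> (k + 1))"
    and k: "\<tau> (k + 1) = 0 \<or> \<not> uturn (k + 2)"
  shows "owner (gap k u) = k + 1"
proof -
  have u1: "u = 1 \<or> u = -1" using u next_cases[of "k + 1"] by auto
  have \<eta>: "\<eta> k = (if \<tau> (k + 1) = 0 then u else \<tau> (k + 1))" using next_turn[of k] u by simp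
  consider "\<tau> k = 0" | "\<tau> k = u" | "\<tau> k = - u" using turn_cases[of k] u1 by auto
  then show ?thesis
  proof cases
    case 1
    have "gap k u = (k, u)" using 1 by (simp add: gap_def)
    moreover have "\<not> uturn k" using 1 by (simp add: uturn_def)
    moreover have "\<tau> (k + 1) = 0 \<or> \<tau> (k + 1) = u \<or> \<tau> (k + 1) = - u"
      using turn_cases[of "k + 1"] u1 by auto
    moreover have "uturn (k + 1) \<longleftrightarrow> \<tau> (k + 1) = - u" if "\<tau> (k + 1) \<noteq> 0"
      using that u by (auto simp: uturn_def)
    ultimately show ?thesis using 1 \<eta> u1 k by (auto simp: owner_def)
  next
    case 2
    \<comment> \<open>The label is the pivot at \<open>k\<close>, read off at cell
      \<open>k - 1\<close>. A U-turn starts at \<open>k\<close> or \<open>k + 1\<close>, which is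
      the branch of \<open>owner\<close> that skips two cells.\<close>
    have ut: "uturn k \<or> uturn (k + 1)"
      using 2 \<eta> u1 turn_cases[of "k + 1"] no_double_turn[of k] u by (auto simp: uturn_def split: if_splits)
    have \<eta>': "\<eta> (k - 1) = u" using next_turn[of "k - 1"] 2 u1 by auto
    define w where "w = (if \<tau> (k - 1) = 0 then u else - u)"
    have g: "gap k u = (k - 1, w)" using 2 u1 by (auto simp: gap_def w_def)
    have nu: "\<not> uturn (k - 1)"
      using \<eta>' 2 u1 no_double_turn[of "k - 1"] by (auto simp: uturn_def)
    have "w \<noteq> (if \<tau> (k - 1) = 0 then - \<eta> (k - 1) else \<eta> (k - 1))"
      using u1 by (auto simp: w_def \<eta>')
    then show ?thesis using ut nu 2 u1 by (auto simp: owner_def g add.commute[of 1])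
  next
    case 3
    have g: "gap k u = (k, - u)" using 3 u1 by (auto simp: gap_def)
    have t: "\<tau> (k + 1) = 0 \<or> \<tau> (k + 1) = u"
      using turn_cases[of "k + 1"] no_double_turn[of k] 3 u1 by auto
    then have \<eta>': "\<eta> k = u" using \<eta> by auto
    have nu: "\<not> uturn k" using \<eta>' 3 u1 by (auto simp: uturn_def)
    have "\<tau> (k + 1) = 0 \<or> \<not> uturn (k + 1)" using t u u1 by (auto simp: uturn_def)
    then show ?thesis using nu \<eta>' 3 u1 k by (auto simp: owner_def g)
  qed
qed

lemma turn_before_uturn:
  assumes "uturn (i + 1)"
  shows "\<eta> i = \<tau> (i + 1)" "\<tau> i = 0 \<or> \<tau> i = - \<eta> i"
  using assms next_turn[of i] turn_cases[of i] turn_cases[of "i + 1"] no_double_turn[of i]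
  by (auto simp: uturn_def)

lemma owner_diag1: "owner (diag1 i (side i)) = i"
proof (cases "uturn (i + 1) \<and> \<tau> i \<noteq> 0")
  case True
  then have t: "\<tau> i = - \<eta> i" using turn_before_uturn by blast
  have "\<eta> i \<noteq> \<tau> i" using t True by auto
  then have "diag1 i (side i) = (i, \<eta> i)"
    using True by (auto simp: diag1_def side_def rear_def)
  moreover have "\<not> uturn i" using \<open>\<eta> i \<noteq> \<tau> i\<close> by (simp add: uturn_def)
  ultimately show ?thesis using True by (simp add: owner_def)
next
  case False
  then have "diag1 i (side i) = gap (i - 1) (if \<tau> i = 0 then \<eta> i else - \<eta> i)"
    by (auto simp: diag1_def side_def rear_def)
  then show ?thesis using owner_gap[of _ "i - 1"] False by (auto simp: add.commute[of 1])
qed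

lemma diag1_neq_diag2: "diag1 i (side i) \<noteq> diag2 i (side i)"
proof (cases "uturn (i + 1)")
  case True
  then show ?thesis by (auto simp: diag1_def diag2_def rear_def gap_def)
next
  case False
  then show ?thesis by (auto simp: diag1_def diag2_def gap_def)
qed

lemma init_labels_disjoint:
  assumes "l \<in> init_labels i" "l \<in> init_labels j"
  shows "i = j"
proof -
  have "owner l = i" "owner l = j"
    using assms owner_diag1 owner_diag2 by (auto simp: init_labels_def)
  then show ?thesis by simp
qed

section \<open>Comparison of the keys of leading and trailing labels\<close>

lemma key_simps:
  "key (k, s) = (if \<tau> k = 0 then (if s = - \<eta> k then (if uturn (k + 1) then 0 else D k) else N + 1)
     else if \<not> uturn k then (if s = - \<tau> k then 0 else N + 1)
     else if \<tau> (k - 1) = 0 then (if s = - \<tau> k then 1 else N + 1)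
     else (if s = \<tau> k then D k else N + 1))"
  by (simp add: key_def)

text \<open>The leading label announced with \<open>key\<close>. A domino that starts in a straight
  cell has it on its far edge; a U-turn corner after a straight cell has it on the edge skipped by
  that domino.\<close>

definition lead :: "int \<Rightarrow> int \<times> int" where
  "lead i = (if \<tau> i = 0 then (if uturn (i + 1) then (i + 1, - \<eta> i) else (i, - \<eta> i))
     else if \<not> uturn i then (i, - \<tau> i)
     else if \<tau> (i - 1) = 0 then (i - 1, - \<tau> i) else (i, \<tau> i))"

lemma distance_pos: "0 < D k"
  using next_distance[of k] by auto

lemma lead_init: "lead i \<in> init_labels i"
proof -
  consider "\<tau> i = 0" "uturn (i + 1)" | "\<tau> i = 0" "\<not> uturn (i + 1)"
    | "\<tau> i \<noteq> 0" "\<not> uturn i" "uturn (i + 1)" | "\<tau> i \<noteq> 0" "\<not> uturn i" "\<not> uturn (i + 1)"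
    | "uturn i" by blast
  then show ?thesis
  proof cases
    case 5
    then have t: "\<tau> i \<noteq> 0" "\<eta> i = \<tau> i" by (auto simp: uturn_def)
    have nu: "\<not> uturn (i + 1)" using t turn_before_uturn[of i] by auto
    have "\<tau> (i - 1) = 0 \<or> \<tau> (i - 1) = - \<tau> i"
      using t turn_cases[of i] turn_cases[of "i - 1"] no_double_turn[of "i - 1"] by auto
    then show ?thesis using 5 t nu
      by (auto simp: lead_def init_labels_def diag1_def diag2_def side_def gap_def)
  next
    case 3
    then show ?thesis using turn_before_uturn[of i]
      by (auto simp: lead_def init_labels_def diag1_def diag2_def side_def rear_def)
  next
    case 4
    then have "\<eta> i = - \<tau> i" using turn_cases[of i] next_cases[of i] by (auto simp: uturn_def)
    then show ?thesis using 4
      by (auto simp: lead_def init_labels_def diag1_def diag2_def side_def)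
  qed (auto simp: lead_def init_labels_def diag1_def diag2_def side_def)
qed


text \<open>This controls the vertex behind cell \<open>k + 1\<close> away from the next turn. If
  that cell is straight, \<open>D k\<close> exceeds \<open>D (k + 1)\<close> by one, which makes the
  comparison with its leading label strict.\<close>

lemma key_gap:
  assumes "\<not> uturn (k + 1)"
  shows "D k \<le> key (gap k (- \<eta> k))"
proof -
  have e: "\<eta> k \<noteq> 0" "- \<eta> k \<noteq> \<eta> k" using next_cases[of k] by auto
  consider "\<tau> k = 0" | "\<tau> k = \<eta> k" | "\<tau> k = - \<eta> k" using turn_cases[of k] next_cases[of k] by auto
  then show ?thesis
  proof cases
    case 1
    then show ?thesis using assms by (simp add: gap_def key_simps)
  next
    case 2
    then have "gap k (- \<eta> k) = (k, \<eta> k)" using e by (simp add: gap_def)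
    then show ?thesis using 2 e distance_le[of k] by (simp add: key_simps)
  next
    case 3
    have \<eta>': "\<eta> (k - 1) = - \<eta> k" using next_turn[of "k - 1"] 3 e by simp
    have "\<tau> (k - 1) = 0 \<or> \<tau> (k - 1) = \<eta> k"
      using turn_cases[of "k - 1"] no_double_turn[of "k - 1"] 3 next_cases[of k] by auto
    then show ?thesis
    proof
      assume t: "\<tau> (k - 1) = 0"
      then have "gap k (- \<eta> k) = (k - 1, - \<eta> k)" using 3 e by (simp add: gap_def)
      then show ?thesis using t e \<eta>' distance_le[of k] by (simp add: key_simps)
    next
      assume t: "\<tau> (k - 1) = \<eta> k"
      then have "gap k (- \<eta> k) = (k - 1, \<eta> k)" using 3 e by (simp add: gap_def)
      moreover have "\<not> uturn (k - 1)" using t \<eta>' e by (simp add: uturn_def)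
      ultimately show ?thesis using t e \<eta>' distance_le[of k] by (simp add: key_simps)
    qed
  qed
qed

text \<open>Keys drop along a block towards its last corner, so a straight cell wins against the
  vertex behind it by \<open>key_gap\<close>. A corner cell leads with key 0 and only needs positive
  trailing keys, except for a U-turn directly after another corner, whose key is \<open>D i\<close>
  as for a straight cell.\<close>

lemma key_lead:
  assumes "l = diag1 i (- side i) \<or> l = diag2 i (- side i)"
  shows "key (lead i) < key l"
proof -
  have e: "\<eta> i \<noteq> 0" "- \<eta> i \<noteq> \<eta> i" using next_cases[of i] by auto
  have N: "D k < N + 1" for k using distance_le[of k] by simp
  consider "\<tau> i = 0" "uturn (i + 1)" | "\<tau> i = 0" "\<not> uturn (i + 1)" | "\<tau> i \<noteq> 0" "\<not> uturn i"
    | "uturn i" "\<tau> i \<noteq> 0" "\<tau> (i - 1) = 0" | "uturn i" "\<tau> i \<noteq> 0" "\<tau> (i - 1) \<noteq> 0"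
    by (auto simp: uturn_def)
  then show ?thesis
  proof cases
    case 1
    have \<eta>': "\<eta> (i - 1) = \<eta> i" and D': "D (i - 1) = D i + 1"
      using next_turn[of "i - 1"] next_distance[of "i - 1"] 1 by simp_all
    have t: "\<tau> (i + 1) = \<eta> i" using turn_before_uturn[OF 1(2)] by simp
    have "1 < key (gap (i - 1) (- \<eta> i))"
      using key_gap[of "i - 1"] 1 \<eta>' D' distance_pos[of i] by (auto simp: uturn_def)
    moreover have "1 < key (i + 1, \<eta> i)"
      using 1 t e N[of i] distance_pos[of i] by (simp add: key_simps)
    \<comment> \<open>The value 1 is \<open>D i\<close>, since the next cell is the corner; key 0 is
      reserved for the corner cell, which comes before the domino.\<close>
    moreover have "key (lead i) = 1"
      using 1 t e by (simp add: lead_def key_simps)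
    ultimately show ?thesis
      using assms 1 by (auto simp: diag1_def diag2_def side_def rear_def)
  next
    case 2
    have \<eta>': "\<eta> (i - 1) = \<eta> i" and D': "D (i - 1) = D i + 1"
      using next_turn[of "i - 1"] next_distance[of "i - 1"] 2 by simp_all
    have "D i < key (gap (i - 1) (- \<eta> i))"
      using key_gap[of "i - 1"] 2 \<eta>' D' by (auto simp: uturn_def)
    moreover have "D i < key (i, \<eta> i)"
      using 2 e N[of i] by (simp add: key_simps)
    moreover have "key (lead i) = D i"
      using 2 by (simp add: lead_def key_simps)
    ultimately show ?thesis
      using assms 2 by (auto simp: diag1_def diag2_def side_def)
  next
    case 3
    have \<eta>': "\<eta> (i - 1) = \<tau> i" using next_turn[of "i - 1"] 3 by simp
    have t: "\<eta> i = - \<tau> i" using 3 turn_cases[of i] next_cases[of i] by (auto simp: uturn_def)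
    have "0 < key (gap (i - 1) (- \<tau> i))"
      using key_gap[of "i - 1"] 3 \<eta>' distance_pos[of "i - 1"] by auto
    moreover have "0 < key (i, \<tau> i)" using 3 by (simp add: key_simps)
    moreover have "0 < key (i + 1, \<eta> i)" if "uturn (i + 1)"
      using that turn_before_uturn[OF that] 3 distance_pos[of "i + 1"] by (simp add: key_simps)
    moreover have "key (lead i) = 0" using 3 by (simp add: lead_def key_simps)
    ultimately show ?thesis
      using assms 3 t by (auto simp: diag1_def diag2_def side_def rear_def split: if_splits)
  next
    case 4
    then have t: "\<eta> i = \<tau> i" by (simp add: uturn_def)
    have nu: "\<not> uturn (i + 1)" using turn_before_uturn[of i] t e 4 by auto
    have \<eta>': "\<eta> (i - 1) = \<tau> i" using next_turn[of "i - 1"] 4 by simp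
    have "key (lead i) = 0" using 4 \<eta>' by (simp add: lead_def key_simps)
    moreover have "0 < key (gap (i - 1) (\<tau> i))" "0 < key (i, - \<tau> i)"
      using 4 \<eta>' by (simp_all add: gap_def key_simps)
    ultimately show ?thesis
      using assms 4 t nu by (auto simp: diag1_def diag2_def side_def)
  next
    case 5
    then have t: "\<eta> i = \<tau> i" by (simp add: uturn_def)
    have nu: "\<not> uturn (i + 1)" using turn_before_uturn[of i] t e 5 by auto
    have \<eta>': "\<eta> (i - 1) = \<tau> i" using next_turn[of "i - 1"] 5 by simp
    have t': "\<tau> (i - 1) = - \<tau> i"
      using turn_cases[of i] turn_cases[of "i - 1"] no_double_turn[of "i - 1"] 5 by auto
    have "key (lead i) = D i" using 5 by (simp add: lead_def key_simps)
    moreover have "D i < key (gap (i - 1) (\<tau> i))"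
      using 5 \<eta>' t' N[of i] by (simp add: gap_def key_simps uturn_def)
    moreover have "D i < key (i, - \<tau> i)" using 5 N[of i] by (simp add: key_simps)
    ultimately show ?thesis
      using assms 5 t nu by (auto simp: diag1_def diag2_def side_def)
  qed
qed

end

section \<open>Geometry of closed paths\<close>

definition units :: "(int \<times> int) set" where
  "units = {(1, 0), (0, 1), (-1, 0), (0, -1)}"

definition verts :: "int \<times> int \<Rightarrow> (int \<times> int) set" where
  "verts p = {p, p + (1, 0), p + (0, 1), p + (1, 1)}"

text \<open>
  The vertex of the cell with lower left corner \<open>p\<close> that is in front of an observer facing the
  direction \<open>e\<close>, on the left for \<open>s = 1\<close> and on the right for \<open>s = -1\<close>.
\<close>

definition front :: "int \<times> int \<Rightarrow> int \<times> int \<Rightarrow> int \<Rightarrow> int \<times> int" where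
  "front p e s = p + ((1 + fst e - s * snd e) div 2, (1 + snd e + s * fst e) div 2)"

definition cross :: "int \<times> int \<Rightarrow> int \<times> int \<Rightarrow> int" where
  "cross e e' = fst e * snd e' - snd e * fst e'"

lemma cross_units:
  assumes "e \<in> units" "e' \<in> units" "e + e' \<noteq> 0"
  shows "cross e e' = 0 \<or> cross e e' = 1 \<or> cross e e' = -1"
    and "cross e e' = 0 \<longleftrightarrow> e' = e"
proof -
  have "\<forall>e\<in>units. \<forall>e'\<in>units. fst e + fst e' = 0 \<and> snd e + snd e' = 0 \<or>
      (cross e e' = 0 \<or> cross e e' = 1 \<or> cross e e' = -1) \<and> (cross e e' = 0 \<longleftrightarrow> e' = e)"
    by (simp add: units_def cross_def)
  then show "cross e e' = 0 \<or> cross e e' = 1 \<or> cross e e' = -1" "cross e e' = 0 \<longleftrightarrow> e' = e"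
    using assms by (auto simp: prod_eq_iff)
qed

text \<open>How the four vertices of a corner cell are renamed when the direction of view changes
  from \<open>e\<close> to \<open>e'\<close>.\<close>

lemma front_turn:
  assumes "e \<in> units" "e' \<in> units" "s = 1 \<or> s = -1"
  shows "cross e e' = s \<Longrightarrow> front p e' s = front p e s - e"
    and "cross e e' = - s \<Longrightarrow> front p e' s = front p e (- s)"
    and "cross e e' = s \<Longrightarrow> front p e' (- s) - e' = front p e (- s)"
    and "cross e e' = s \<Longrightarrow> front p e' s - e' = front p e (- s) - e"
  using assms unfolding units_def by (auto simp: cross_def front_def simp flip: zero_prod_def)

lemma front_verts:
  assumes "e \<in> units" "s = 1 \<or> s = -1"
  shows "front p e s \<in> verts p" "front p e s - e \<in> verts p" "front p e s \<notin> verts (p - e)"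
  using assms by (cases p; auto simp: units_def front_def verts_def)+

lemma verts_iff:
  "v \<in> verts p \<longleftrightarrow> fst p \<le> fst v \<and> fst v \<le> fst p + 1 \<and> snd p \<le> snd v \<and> snd v \<le> snd p + 1"
  by (cases p; cases v; auto simp: verts_def)

text \<open>Two straight steps leave no common vertex; with a turn in between only the pivot remains
  common, and it belongs to the middle cell.\<close>

lemma verts_two_steps:
  assumes "e \<in> units" "e' \<in> units" "e + e' \<noteq> 0"
  shows "verts p \<inter> verts (p + e + e') \<subseteq> verts (p + e)"
proof
  fix v assume v: "v \<in> verts p \<inter> verts (p + e + e')"
  have "fst e + fst e' \<noteq> 0 \<or> snd e + snd e' \<noteq> 0" using assms(3) by (auto simp: prod_eq_iff)
  then show "v \<in> verts (p + e)"
    using v assms(1,2) unfolding Int_iff verts_iff units_def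
    by (elim insertE emptyE) simp_all
qed

lemma front_inj:
  assumes "e \<in> units" "s = 1 \<or> s = -1" "t = 1 \<or> t = -1" "front p e s = front p e t"
  shows "s = t"
  using assms by (cases p; auto simp: units_def front_def)

section \<open>Closed paths as periodic integer sequences of lower left corners\<close>

locale closed_path =
  fixes a :: "int \<Rightarrow> int \<times> int" and n :: int
  assumes n_ge: "6 \<le> n"
    and periodic: "a (k + n) = a k"
    and step: "a (k + 1) - a k \<in> units"
    and inj: "a i = a j \<Longrightarrow> n dvd i - j"
    and near: "verts (a i) \<inter> verts (a j) \<noteq> {} \<Longrightarrow> \<exists>\<delta>\<in>{-2..2}. n dvd i - j - \<delta>"
    and positive: "1 \<le> fst (a k)" "1 \<le> snd (a k)"
begin

definition d :: "int \<Rightarrow> int \<times> int" where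
  "d k = a (k + 1) - a k"

lemma d_units: "d k \<in> units"
  using step by (simp add: d_def)

lemma a_step: "a (k + 1) = a k + d k" "a k = a (k - 1) + d (k - 1)" "a k - d (k - 1) = a (k - 1)"
  by (simp_all add: d_def)

lemma periodic_mult: "a (k + j * n) = a k"
proof -
  have nat: "a (k + int m * n) = a k" for m k
  proof (induction m)
    case (Suc m)
    then show ?case using periodic[of "k + int m * n"] by (simp add: algebra_simps)
  qed simp
  show ?thesis
  proof (cases "0 \<le> j")
    case True
    then show ?thesis using nat[of k "nat j"] by simp
  next
    case False
    then show ?thesis using nat[of "k + j * n" "nat (- j)"] by simp
  qed
qed

lemma a_eq_iff: "a i = a j \<longleftrightarrow> n dvd i - j"
proof
  assume "n dvd i - j"
  then obtain c where "i - j = n * c" by (rule dvdE)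
  then have "i = j + c * n" by (simp add: algebra_simps)
  then show "a i = a j" by (simp add: periodic_mult)
qed (rule inj)

lemma d_periodic: "d (k + j * n) = d k"
  using periodic_mult[of k j] periodic_mult[of "k + 1" j] by (simp add: d_def ac_simps)

lemma not_dvd: "n dvd c \<Longrightarrow> \<bar>c\<bar> < 6 \<Longrightarrow> c = 0"
  using n_ge dvd_imp_le_int[of c n] by force

lemma no_reverse: "d k + d (k + 1) \<noteq> 0"
proof
  assume "d k + d (k + 1) = 0"
  then have "a (k + 2) = a k" by (simp add: d_def add.assoc)
  then show False using not_dvd[of 2] by (simp add: a_eq_iff)
qed

definition \<tau> :: "int \<Rightarrow> int" where
  "\<tau> k = cross (d (k - 1)) (d k)"

lemma \<tau>_cases: "\<tau> k = 0 \<or> \<tau> k = 1 \<or> \<tau> k = -1"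
  unfolding \<tau>_def using cross_units(1)[OF d_units d_units, of "k - 1" k] no_reverse[of "k - 1"] by simp

lemma \<tau>_zero_iff: "\<tau> k = 0 \<longleftrightarrow> d k = d (k - 1)"
  unfolding \<tau>_def using cross_units(2)[OF d_units d_units, of "k - 1" k] no_reverse[of "k - 1"] by simp

lemma \<tau>_periodic: "\<tau> (k + j * n) = \<tau> k"
  using d_periodic[of "k - 1" j] d_periodic[of k j] by (simp add: \<tau>_def algebra_simps)

text \<open>Two equal turns in a row would make the cells \<open>k - 1\<close> and
  \<open>k + 2\<close> neighbours. They are three steps apart, while touching cells are at cyclic
  distance at most 2; as \<open>3 - \<delta>\<close> lies between 1 and 5, the bound
  \<open>6 \<le> n\<close> excludes this.\<close>

lemma no_double:
  assumes "\<tau> k \<noteq> 0" shows "\<tau> (k + 1) \<noteq> \<tau> k"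
proof
  assume e: "\<tau> (k + 1) = \<tau> k"
  have "d (k + 1) = - d (k - 1)"
    using e assms d_units[of "k - 1"] d_units[of k] d_units[of "k + 1"]
    by (auto simp: \<tau>_def units_def cross_def)
  then have "a (k + 2) = a (k - 1) + d k"
    using a_step(1)[of "k - 1"] a_step(1)[of k] a_step(1)[of "k + 1"] by (simp add: add.assoc)
  then have "verts (a (k + 2)) \<inter> verts (a (k - 1)) \<noteq> {}"
    using d_units[of k] by (cases "a (k - 1)") (auto simp: verts_def units_def)
  from near[OF this] obtain \<delta> where "\<delta> \<in> {-2..2}" "n dvd 3 - \<delta>" by auto
  then show False using not_dvd[of "3 - \<delta>"] by auto
qed

text \<open>Without turns one period would translate the path by \<open>n\<close> times a unit
  vector. Corners guarantee that the least distance in \<open>D\<close> exists.\<close>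

lemma corner_exists: "\<exists>k. \<tau> k \<noteq> 0"
proof (rule ccontr)
  assume "\<nexists>k. \<tau> k \<noteq> 0"
  then have "d k = d (k - 1)" for k using \<tau>_zero_iff by blast
  then have *: "d (int m) = d 0" for m
    by (induction m) (simp_all, metis add.commute add_diff_cancel_right' of_nat_Suc)
  have "a (int m) = a 0 + (int m * fst (d 0), int m * snd (d 0))" for m
  proof (induction m)
    case (Suc m)
    have "a (int (Suc m)) = a (int m) + d 0"
      using a_step(1)[of "int m"] *[of m] by (simp add: add.commute)
    then show ?case using Suc by (cases "d 0") (simp add: algebra_simps)
  qed (simp flip: zero_prod_def)
  from this[of "nat n"] have "(n * fst (d 0), n * snd (d 0)) = (0, 0)"
    using periodic[of 0] n_ge by (simp add: zero_prod_def)
  then show False using n_ge d_units[of 0] by (auto simp: units_def)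
qed

definition D :: "int \<Rightarrow> nat" where
  "D k = (LEAST m. 0 < m \<and> \<tau> (k + int m) \<noteq> 0)"

definition \<eta> :: "int \<Rightarrow> int" where
  "\<eta> k = \<tau> (k + int (D k))"

lemma D_spec: "0 < D k" "\<tau> (k + int (D k)) \<noteq> 0" "D k \<le> nat n"
proof -
  obtain c where c: "\<tau> c \<noteq> 0" using corner_exists by blast
  \<comment> \<open>The representative of \<open>c - k\<close> modulo \<open>n\<close> in the range
    from 1 to \<open>n\<close>; shifting by one before and after the reduction avoids the value
    0.\<close>
  define m where "m = nat ((c - k - 1) mod n + 1)"
  have m: "0 < m" "m \<le> nat n"
  proof -
    have "0 \<le> (c - k - 1) mod n" "(c - k - 1) mod n < n" using n_ge by auto
    then show "0 < m" "m \<le> nat n" by (simp_all add: m_def)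
  qed
  have "k + int m = c + (- ((c - k - 1) div n)) * n"
  proof -
    have "0 \<le> (c - k - 1) mod n" using n_ge by auto
    then have "k + int m = k + 1 + (c - k - 1) mod n" by (simp add: m_def)
    then show ?thesis using div_mult_mod_eq[of "c - k - 1" n] by linarith
  qed
  then have "\<tau> (k + int m) \<noteq> 0" using c by (simp only: \<tau>_periodic) simp
  then have P: "0 < m \<and> \<tau> (k + int m) \<noteq> 0" using m by simp
  show "0 < D k" "\<tau> (k + int (D k)) \<noteq> 0"
    using LeastI[of "\<lambda>m. 0 < m \<and> \<tau> (k + int m) \<noteq> 0", OF P] by (simp_all add: D_def)
  show "D k \<le> nat n"
    using Least_le[of "\<lambda>m. 0 < m \<and> \<tau> (k + int m) \<noteq> 0", OF P] m by (simp add: D_def)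
qed

lemma D_rec: "D k = (if \<tau> (k + 1) = 0 then Suc (D (k + 1)) else 1)"
proof (cases "\<tau> (k + 1) = 0")
  case True
  have "D k = Suc (D (k + 1))"
    unfolding D_def[of k]
  proof (rule Least_equality)
    show "0 < Suc (D (k + 1)) \<and> \<tau> (k + int (Suc (D (k + 1)))) \<noteq> 0"
      using D_spec(2)[of "k + 1"] by (simp add: ac_simps)
  next
    fix m assume m: "0 < m \<and> \<tau> (k + int m) \<noteq> 0"
    then have "m \<noteq> 1" using True by auto
    then obtain m' where m': "m = Suc m'" "0 < m'" using m by (cases m) auto
    have "D (k + 1) \<le> m'"
      unfolding D_def using m m' by (intro Least_le) (simp add: ac_simps)
    then show "Suc (D (k + 1)) \<le> m" using m' by simp
  qed
  then show ?thesis using True by simp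
next
  case False
  then have "D k = 1" unfolding D_def by (intro Least_equality) auto
  then show ?thesis using False by simp
qed

lemma \<eta>_rec: "\<eta> k = (if \<tau> (k + 1) = 0 then \<eta> (k + 1) else \<tau> (k + 1))"
  using D_rec[of k] by (simp add: \<eta>_def ac_simps)

sublocale turning \<tau> \<eta> D "nat n"
proof
  show "\<eta> k = 1 \<or> \<eta> k = -1" for k
    using \<tau>_cases[of "k + int (D k)"] D_spec(2)[of k] by (simp add: \<eta>_def)
qed (use \<tau>_cases no_double \<eta>_rec D_rec D_spec(3) in auto)

lemma D_periodic: "D (k + j * n) = D k"
proof -
  have "\<tau> (k + j * n + int m) = \<tau> (k + int m)" for m
    using \<tau>_periodic[of "k + int m" j] by (simp add: ac_simps)
  then show ?thesis by (simp add: D_def)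
qed

lemma \<eta>_periodic: "\<eta> (k + j * n) = \<eta> k"
  using \<tau>_periodic[of "k + int (D k)" j] by (simp add: \<eta>_def D_periodic ac_simps)

definition F :: "int \<times> int \<Rightarrow> int \<times> int" where
  "F = (\<lambda>(k, s). front (a k) (d (k - 1)) s)"

lemma F_simp: "F (k, s) = front (a k) (d (k - 1)) s"
  by (simp add: F_def)

lemma F_gap:
  assumes s: "s = 1 \<or> s = -1"
  shows "F (gap k s) = front (a k) (d k) s"
proof -
  have t: "\<tau> k = cross (d (k - 1)) (d k)" for k by (rule \<tau>_def)
  note u = d_units[of "k - 1"] d_units[of k]
  have shift: "front (a k) e s - d (k - 1) = front (a (k - 1)) e s" for e
    using a_step(2)[of k] by (simp add: front_def)
  consider "\<tau> k = 0" | "\<tau> k = s" | "\<tau> k = - s" using \<tau>_cases[of k] s by auto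
  then show ?thesis
  proof cases
    case 1
    then show ?thesis using \<tau>_zero_iff[of k] by (simp add: gap_def F_simp)
  next
    case 3
    then show ?thesis using front_turn(2)[OF u s] t[of k] s by (auto simp: gap_def F_simp)
  next
    case 2
    \<comment> \<open>For a turn towards \<open>s\<close> the vertex is the pivot, which is also in
      front of cell \<open>k - 1\<close>.\<close>
    have "front (a k) (d k) s = front (a k) (d (k - 1)) s - d (k - 1)"
      using front_turn(1)[OF u s] 2 t[of k] by simp
    then have pivot: "front (a k) (d k) s = front (a (k - 1)) (d (k - 1)) s"
      using shift by simp
    consider "\<tau> (k - 1) = 0" | "\<tau> (k - 1) = - s"
      using \<tau>_cases[of "k - 1"] s no_double[of "k - 1"] 2 by auto
    then show ?thesis
    proof cases
      case 1
      then show ?thesis using 2 s pivot \<tau>_zero_iff[of "k - 1"] by (auto simp: gap_def F_simp)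
    next
      case m: 2
      have "front (a (k - 1)) (d (k - 1)) s = front (a (k - 1)) (d (k - 2)) (- s)"
        using front_turn(2)[OF d_units d_units s, of "k - 2" "k - 1"] m t[of "k - 1"] by simp
      then show ?thesis using 2 s pivot m by (auto simp: gap_def F_simp)
    qed
  qed
qed

lemma F_gap':
  assumes "s = 1 \<or> s = -1"
  shows "F (gap (k - 1) s) = front (a k) (d (k - 1)) s - d (k - 1)"
  using F_gap[OF assms, of "k - 1"] a_step(2)[of k] by (simp add: front_def)

lemma F_rear:
  assumes s: "s = 1 \<or> s = -1"
  shows "F (rear k s) = front (a k) (d k) s - d k"
proof -
  have s': "- s = 1 \<or> - s = -1" using s by auto
  have t: "\<tau> k = cross (d (k - 1)) (d k)" by (rule \<tau>_def)
  note u = d_units[of "k - 1"] d_units[of k]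
  consider "\<tau> k = 0" | "\<tau> k = s" | "\<tau> k = - s" using \<tau>_cases[of k] s by auto
  then show ?thesis
  proof cases
    case 1
    then show ?thesis using \<tau>_zero_iff[of k] F_gap'[OF s, of k] by (simp add: rear_def)
  next
    case 2
    then show ?thesis using F_gap'[OF s', of k] front_turn(4)[OF u s] t s by (auto simp: rear_def)
  next
    case 3
    then show ?thesis using front_turn(3)[OF u s'] t s by (auto simp: rear_def F_simp)
  qed
qed

lemma F_periodic: "F (k + j * n, s) = F (k, s)"
  using d_periodic[of "k - 1" j] by (simp add: F_simp periodic_mult algebra_simps)

text \<open>The vertex labelled \<open>(k, s)\<close> lies in cell \<open>k\<close> but not in cell
  \<open>k - 1\<close>. Equal vertices force cells at distance at most 2; distance 1 contradicts
  this directly, and at distance 2 a common vertex would also lie in the middle cell.\<close>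

lemma F_inj:
  assumes "F (k, s) = F (l, t)" "s = 1 \<or> s = -1" "t = 1 \<or> t = -1"
  shows "n dvd k - l \<and> s = t"
proof -
  have in_cell: "F (k, s) \<in> verts (a k)" "F (k, s) \<notin> verts (a (k - 1))" if "s = 1 \<or> s = -1" for k s
    using front_verts[OF d_units that, of "a k" "k - 1"] by (simp_all only: F_simp a_step(3) not_False_eq_True)
  have next2: "verts (a k) \<inter> verts (a (k + 2)) \<subseteq> verts (a (k + 1))" for k
    using verts_two_steps[OF d_units[of k] d_units[of "k + 1"] no_reverse, of "a k"]
      a_step(1)[of k] a_step(1)[of "k + 1"] by (simp add: add.assoc)
  have pos: False if e: "F (k, s) = F (k + \<delta>, t)" "s = 1 \<or> s = -1" "t = 1 \<or> t = -1" "\<delta> = 1 \<or> \<delta> = 2"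
    for k s t \<delta>
  proof (cases "\<delta> = 1")
    case True
    then show ?thesis using in_cell(1)[OF e(2), of k] in_cell(2)[OF e(3), of "k + \<delta>"] e(1) by simp
  next
    case False
    then have "\<delta> = 2" using e(4) by simp
    then show ?thesis
      using in_cell(1)[OF e(2), of k] in_cell[OF e(3), of "k + 2"] e(1) next2[of k] by (auto simp: add.commute[of 1])
  qed
  have "verts (a k) \<inter> verts (a l) \<noteq> {}"
    using in_cell(1)[OF assms(2), of k] in_cell(1)[OF assms(3), of l] assms(1) by auto
  from near[OF this] obtain \<delta> where \<delta>1: "\<delta> \<in> {-2..2}" "n dvd k - l - \<delta>" by blast
  from \<delta>1(2) obtain c where "k - l - \<delta> = n * c" by (rule dvdE)
  note \<delta> = \<delta>1(1) this
  then have k: "k = (l + \<delta>) + c * n" by (simp add: algebra_simps)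
  have e: "F (l + \<delta>, s) = F (l, t)" using assms(1) F_periodic[of "l + \<delta>" c s] k by simp
  have "\<delta> = 0"
  proof (rule ccontr)
    assume "\<delta> \<noteq> 0"
    then consider "\<delta> = 1 \<or> \<delta> = 2" | "- \<delta> = 1 \<or> - \<delta> = 2" using \<delta>(1) by fastforce
    then show False
    proof cases
      case 1
      then show ?thesis using pos[of l t \<delta> s] e assms by auto
    next
      case 2
      then show ?thesis using pos[of "l + \<delta>" s "- \<delta>" t] e assms by auto
    qed
  qed
  moreover have "s = t"
    using e \<open>\<delta> = 0\<close> front_inj[OF d_units assms(2,3)] by (simp add: F_simp)
  ultimately show ?thesis using \<delta>(2) by simp
qed

end

section \<open>Leading terms of the factors\<close>

lemma initial_monomial_lex_binomial:
  assumes inj: "inj_on idx V" and V: "a \<in> V" "b \<in> V" "c \<in> V" "d \<in> V"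
    and less: "idx l < idx c" "idx l < idx d" "l = a \<or> l = b"
  shows "is_initial_monomial (lex_order idx V) (var a * var b - var c * var d :: ('v, 'k::field) mpoly)
    (Poly_Mapping.single a 1 + Poly_Mapping.single b 1)"
proof -
  let ?m = "Poly_Mapping.single a 1 + Poly_Mapping.single b 1 :: 'v \<Rightarrow>\<^sub>0 nat"
  let ?m' = "Poly_Mapping.single c 1 + Poly_Mapping.single d 1 :: 'v \<Rightarrow>\<^sub>0 nat"
  define v where "v = (if idx a \<le> idx b then a else b)"
  have v: "v \<in> V" "idx v < idx c" "idx v < idx d" "v = a \<or> v = b" "idx v \<le> idx a" "idx v \<le> idx b"
    using V less by (auto simp: v_def)
  have "Poly_Mapping.lookup ?m' v = 0"
    using v by (auto simp: lookup_add lookup_single when_def)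
  moreover have "0 < Poly_Mapping.lookup ?m v"
    using v(4) by (auto simp: lookup_add lookup_single when_def)
  moreover have "Poly_Mapping.lookup ?m u = 0" "Poly_Mapping.lookup ?m' u = 0" if "idx u < idx v" for u
    using v that by (auto simp: lookup_add lookup_single when_def)
  moreover have mm: "?m \<in> monomials_in V" "?m' \<in> monomials_in V"
    using V by (intro add_in_monomials_in; simp add: monomials_in_def)+
  ultimately have less': "(?m', ?m) \<in> lex_order idx V" and ne: "?m \<noteq> ?m'"
    using v(1) unfolding lex_order_def by (auto intro!: bexI[of _ v])
  have "(?m, ?m) \<in> lex_order idx V"
    using monomial_orderD(2)[OF monomial_order_lex_order[OF inj]] mm by blast
  moreover have "?m \<in> Poly_Mapping.keys (var a * var b - var c * var d :: ('v, 'k) mpoly)"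
    using ne by (simp add: var_mult_var in_keys_iff lookup_minus lookup_single when_def)
  moreover have "Poly_Mapping.keys (var a * var b - var c * var d :: ('v, 'k) mpoly) \<subseteq> {?m, ?m'}"
    using keys_diff[of "var a * var b :: ('v, 'k) mpoly" "var c * var d"] by (auto simp: var_mult_var)
  ultimately show ?thesis
    using less' unfolding is_initial_monomial_def by blast
qed

text \<open>Directions and backward steps need negative coordinates, so the geometry lives over the
  integers and is transported to vertices at the end.\<close>

definition pt :: "int \<times> int \<Rightarrow> point" where
  "pt v = (nat (fst v), nat (snd v))"

lemma pt_inj:
  assumes "0 \<le> fst v" "0 \<le> snd v" "0 \<le> fst w" "0 \<le> snd w" "pt v = pt w"
  shows "v = w"
  using assms by (auto simp: pt_def prod_eq_iff)

context turning
begin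

lemma side_cases: "side i = 1 \<or> side i = -1"
  using next_cases[of i] by (auto simp: side_def)

lemma snd_labels:
  assumes "s = 1 \<or> s = -1"
  shows "snd (diag1 i s) = 1 \<or> snd (diag1 i s) = -1" "snd (diag2 i s) = 1 \<or> snd (diag2 i s) = -1"
  using assms by (auto simp: diag1_def diag2_def rear_def gap_def)

lemma fst_labels:
  "fst (diag1 i s) \<in> {i - 2..i}" "fst (diag2 i s) \<in> {i..i + 1}"
  by (auto simp: diag1_def diag2_def rear_def gap_def)

end

context closed_path
begin

lemma uturn_periodic: "uturn (k + j * n) = uturn k"
  by (simp add: uturn_def \<tau>_periodic \<eta>_periodic)

lemma gap_periodic: "gap (k + j * n) s = (fst (gap k s) + j * n, snd (gap k s))"
  using \<tau>_periodic[of "k - 1" j] by (auto simp: gap_def \<tau>_periodic algebra_simps)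

lemma rear_periodic: "rear (k + j * n) s = (fst (rear k s) + j * n, snd (rear k s))"
  using gap_periodic[of "k - 1" j] by (auto simp: rear_def \<tau>_periodic algebra_simps)

lemma uturn_periodic': "uturn (k + j * n + c) = uturn (k + c)"
  using uturn_periodic[of "k + c" j] by (simp add: ac_simps)

lemma side_periodic: "side (i + j * n) = side i"
  by (simp add: side_def uturn_periodic' \<tau>_periodic \<eta>_periodic)

lemma diag1_periodic: "diag1 (i + j * n) s = (fst (diag1 i s) + j * n, snd (diag1 i s))"
  using gap_periodic[of "i - 1" j s]
  unfolding diag1_def uturn_periodic' rear_periodic by (auto simp: algebra_simps)

lemma diag2_periodic: "diag2 (i + j * n) s = (fst (diag2 i s) + j * n, snd (diag2 i s))"
  unfolding diag2_def uturn_periodic' by (auto simp: algebra_simps)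

lemma init_labels_periodic:
  assumes "(k, s) \<in> init_labels i"
  shows "(k + j * n, s) \<in> init_labels (i + j * n)"
  using assms by (auto simp: init_labels_def side_periodic diag1_periodic diag2_periodic prod_eq_iff)

lemma key_periodic: "key (k + j * n, s) = key (k, s)"
proof -
  have "\<tau> (k + j * n - 1) = \<tau> (k - 1)" using \<tau>_periodic[of "k - 1" j] by (simp add: algebra_simps)
  then show ?thesis
    unfolding key_simps uturn_periodic uturn_periodic' \<tau>_periodic \<eta>_periodic D_periodic by simp
qed

lemma front_in_verts: "s = 1 \<or> s = -1 \<Longrightarrow> front (a k) (d j) s \<in> verts (a k)"
  using front_verts(1)[OF d_units] by blast

lemma verts_positive: "v \<in> verts (a k) \<Longrightarrow> 1 \<le> fst v \<and> 1 \<le> snd v"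
  using positive[of k] by (auto simp: verts_iff)

definition V :: "point set" where
  "V = (\<Union>k. pt ` verts (a k))"

lemma V_I: "v \<in> verts (a k) \<Longrightarrow> pt v \<in> V"
  by (auto simp: V_def)

lemma finite_V: "finite V"
proof -
  have "V = (\<Union>k\<in>{0..<n}. pt ` verts (a k))"
  proof -
    have "a k = a (k mod n)" for k
      using periodic_mult[of "k mod n" "k div n"] by simp
    moreover have "k mod n \<in> {0..<n}" for k using n_ge by simp
    ultimately show ?thesis unfolding V_def by (auto, metis atLeastLessThan_iff image_eqI)
  qed
  then show ?thesis by (simp add: verts_def)
qed

definition PF :: "int \<times> int \<Rightarrow> point" where
  "PF l = pt (F l)"

lemma PF_V: "snd l = 1 \<or> snd l = -1 \<Longrightarrow> PF l \<in> V"
  using V_I[OF front_in_verts[of "snd l" "fst l" "fst l - 1"]] by (simp add: PF_def F_def split_beta)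

lemma PF_eqD:
  assumes "PF l = PF l'" "snd l = 1 \<or> snd l = -1" "snd l' = 1 \<or> snd l' = -1"
  shows "n dvd fst l - fst l'" "snd l = snd l'"
proof -
  have "F l \<in> verts (a (fst l))" "F l' \<in> verts (a (fst l'))"
    using front_in_verts assms(2,3) by (simp_all add: F_def split_beta)
  then have "0 \<le> fst (F l)" "0 \<le> snd (F l)" "0 \<le> fst (F l')" "0 \<le> snd (F l')"
    using verts_positive[of "F l" "fst l"] verts_positive[of "F l'" "fst l'"] by auto
  then have "F l = F l'" using pt_inj assms(1) by (simp add: PF_def)
  then show "n dvd fst l - fst l'" "snd l = snd l'"
    using F_inj[of "fst l" "snd l" "fst l'" "snd l'"] assms by auto
qed

text \<open>Any two labels of a vertex differ by a multiple of the period, which \<open>key\<close>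
  ignores, so the choice is harmless.\<close>

definition point_key :: "point \<Rightarrow> nat" where
  "point_key v = key (SOME l. (snd l = 1 \<or> snd l = -1) \<and> PF l = v)"

lemma point_key_PF:
  assumes "snd l = 1 \<or> snd l = -1"
  shows "point_key (PF l) = key l"
proof -
  define l' where "l' = (SOME l'. (snd l' = 1 \<or> snd l' = -1) \<and> PF l' = PF l)"
  have l': "(snd l' = 1 \<or> snd l' = -1) \<and> PF l' = PF l"
    unfolding l'_def by (rule someI[of _ l]) (use assms in simp)
  then have "n dvd fst l' - fst l" "snd l' = snd l"
    using PF_eqD assms by blast+
  then obtain c where "fst l' - fst l = n * c" by (auto elim: dvdE)
  then have "fst l' = fst l + c * n" by (simp add: algebra_simps)
  then have "key l' = key l"
    using key_periodic[of "fst l" c "snd l"] \<open>snd l' = snd l\<close> by (metis prod.collapse)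
  then show ?thesis by (simp add: point_key_def l'_def)
qed

definition factor :: "int \<Rightarrow> (point, 'k::field) mpoly" where
  "factor i = var (PF (diag1 i (side i))) * var (PF (diag2 i (side i)))
     - var (PF (diag1 i (- side i))) * var (PF (diag2 i (- side i)))"

definition factor_init :: "int \<Rightarrow> (point \<Rightarrow>\<^sub>0 nat)" where
  "factor_init i = Poly_Mapping.single (PF (diag1 i (side i))) 1
     + Poly_Mapping.single (PF (diag2 i (side i))) 1"

lemma labels_V:
  "PF (diag1 i (side i)) \<in> V" "PF (diag2 i (side i)) \<in> V"
  "PF (diag1 i (- side i)) \<in> V" "PF (diag2 i (- side i)) \<in> V"
  using side_cases[of i] by (auto intro!: PF_V snd_labels)

lemma factor_carrier: "(factor i :: (point, 'k::field) mpoly) \<in> carrier (poly_ring V)"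
  unfolding factor_def by (rule binomial_carrier) (rule labels_V)+

lemma factor_periodic: "factor (i + j * n) = factor i"
proof -
  have "F (fst l + j * n, snd l) = F l" for l by (cases l) (simp add: F_periodic)
  then show ?thesis by (simp add: factor_def PF_def side_periodic diag1_periodic diag2_periodic)
qed

lemma factor_order:
  "\<exists>r. monomial_order V r \<and>
    (\<forall>i. is_initial_monomial r (factor i :: (point, 'k::field) mpoly) (factor_init i))"
proof -
  obtain enum :: "point \<Rightarrow> nat" and N where enum: "enum ` V = {i. i < N}" "inj_on enum V"
    using finite_imp_inj_to_nat_seg[OF finite_V] by auto
  \<comment> \<open>Keys repeat, while an order needs an injective index: the enumeration breaks
    ties and, being below \<open>N\<close>, never overrides the key.\<close>
  define idx where "idx v = point_key v * N + enum v" for v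
  have N: "enum v < N" if "v \<in> V" for v using enum(1) that by auto
  have less: "idx u < idx v" if "point_key u < point_key v" "u \<in> V" for u v
  proof -
    have "idx u < (point_key u + 1) * N" using N[OF that(2)] by (simp add: idx_def)
    also have "\<dots> \<le> point_key v * N" using that(1) by (intro mult_right_mono) auto
    finally show ?thesis by (simp add: idx_def)
  qed
  have inj: "inj_on idx V"
  proof (rule inj_onI)
    fix u v assume uv: "u \<in> V" "v \<in> V" "idx u = idx v"
    then have "point_key u = point_key v" using less[of u v] less[of v u] by force
    then have "enum u = enum v" using uv by (simp add: idx_def)
    then show "u = v" using uv enum(2) by (simp add: inj_on_def)
  qed
  have "is_initial_monomial (lex_order idx V) (factor i :: (point, 'k) mpoly) (factor_init i)" for i
  proof -
    have l: "lead i = diag1 i (side i) \<or> lead i = diag2 i (side i)"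
      using lead_init[of i] by (simp add: init_labels_def)
    then have snd_lead: "snd (lead i) = 1 \<or> snd (lead i) = -1"
      using snd_labels[OF side_cases[of i], of i] by metis
    have sm: "- side i = 1 \<or> - side i = -1" using side_cases[of i] by auto
    show ?thesis
      unfolding factor_def factor_init_def
    proof (rule initial_monomial_lex_binomial[OF inj labels_V])
      show "idx (PF (lead i)) < idx (PF (diag1 i (- side i)))"
        "idx (PF (lead i)) < idx (PF (diag2 i (- side i)))"
        unfolding atomize_conj
        by (intro conjI less PF_V snd_lead)
          (simp_all only: point_key_PF[OF snd_lead] point_key_PF[OF snd_labels(1)[OF sm]]
            point_key_PF[OF snd_labels(2)[OF sm]]
            key_lead[OF disjI1[OF refl]] key_lead[OF disjI2[OF refl]])
      show "PF (lead i) = PF (diag1 i (side i)) \<or> PF (lead i) = PF (diag2 i (side i))"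
        using l by auto
    qed
  qed
  then show ?thesis using monomial_order_lex_order[OF inj] by blast
qed

lemma squarefree_init: "squarefree_monomial (\<Sum>i\<in>{0..<n}. factor_init i)"
  unfolding squarefree_monomial_def
proof
  fix v
  let ?f = "\<lambda>i. Poly_Mapping.lookup (factor_init i) v"
  have lab: "snd l = 1 \<or> snd l = -1" if "l \<in> init_labels i" for l i
    using that snd_labels[OF side_cases[of i], of i] by (auto simp: init_labels_def)
  have le1: "?f i \<le> 1" for i
  proof -
    have "PF (diag1 i (side i)) \<noteq> PF (diag2 i (side i))"
    proof
      assume e: "PF (diag1 i (side i)) = PF (diag2 i (side i))"
      note s = snd_labels[OF side_cases[of i], of i]
      \<comment> \<open>The labels belong to cells at most three steps apart, fewer than one
        period.\<close>
      have "fst (diag1 i (side i)) - fst (diag2 i (side i)) = 0"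
        using PF_eqD(1)[OF e s] fst_labels[of i "side i"] by (intro not_dvd) auto
      then have "diag1 i (side i) = diag2 i (side i)"
        using PF_eqD(2)[OF e s] by (simp add: prod_eq_iff)
      then show False using diag1_neq_diag2 by blast
    qed
    then show ?thesis by (auto simp: factor_init_def lookup_add lookup_single when_def)
  qed
  have uniq: "i = j" if ij: "i \<in> {0..<n}" "j \<in> {0..<n}" "?f i \<noteq> 0" "?f j \<noteq> 0" for i j
  proof -
    have ex: "\<exists>l\<in>init_labels i. PF l = v" if "?f i \<noteq> 0" for i
      using that by (auto simp: factor_init_def init_labels_def lookup_add lookup_single when_def split: if_splits)
    obtain l l' where l: "l \<in> init_labels i" "PF l = v" "l' \<in> init_labels j" "PF l' = v"
      using ex[OF ij(3)] ex[OF ij(4)] by blast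
    have e: "n dvd fst l - fst l'" "snd l = snd l'"
      using PF_eqD[of l l'] lab l by auto
    then obtain c where "fst l - fst l' = n * c" by (auto elim: dvdE)
    then have "l = (fst l' + c * n, snd l')" using e(2) by (simp add: algebra_simps prod_eq_iff)
    then have "l \<in> init_labels (j + c * n)"
      using init_labels_periodic[of "fst l'" "snd l'" j c] l(3) by simp
    then have "i = j + c * n" using init_labels_disjoint l(1) by blast
    then have "n dvd i - j" by simp
    then show ?thesis using ij(1,2) zdvd_imp_le[of n "\<bar>i - j\<bar>"] by fastforce
  qed
  have "(\<Sum>i\<in>{0..<n}. ?f i) \<le> 1"
  proof (cases "\<exists>i\<in>{0..<n}. ?f i \<noteq> 0")
    case True
    then obtain i where i: "i \<in> {0..<n}" "?f i \<noteq> 0" by blast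
    have "(\<Sum>i\<in>{0..<n}. ?f i) = ?f i + (\<Sum>j\<in>{0..<n} - {i}. ?f j)"
      by (rule sum.remove) (use i in auto)
    also have "(\<Sum>j\<in>{0..<n} - {i}. ?f j) = 0"
      using uniq[OF i(1) _ i(2)] by (intro sum.neutral) auto
    finally show ?thesis using le1[of i] by simp
  next
    case False
    then have "(\<Sum>i\<in>{0..<n}. ?f i) = 0" by (intro sum.neutral) auto
    then show ?thesis by simp
  qed
  then show "Poly_Mapping.lookup (\<Sum>i\<in>{0..<n}. factor_init i) v \<le> 1"
    by (simp add: lookup_sum)
qed

end

text \<open>
  The columns of the matrix of a straight row of cells starting at \<open>p\<close> in direction \<open>e\<close>:
  column \<open>j\<close> is the front edge of the \<open>j\<close>-th cell, column \<open>-1\<close> is the rear edge of the cell \<open>p\<close>.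
\<close>

definition shift :: "int \<Rightarrow> int \<times> int \<Rightarrow> int \<times> int" where
  "shift j e = (j * fst e, j * snd e)"

definition edge :: "int \<times> int \<Rightarrow> int \<times> int \<Rightarrow> int \<Rightarrow> int \<Rightarrow> point" where
  "edge p e s j = pt (front p e s + shift j e)"

definition cell_binomial :: "int \<times> int \<Rightarrow> (point, 'k::field) mpoly" where
  "cell_binomial p = var (pt p) * var (pt (p + (1, 1))) - var (pt (p + (1, 0))) * var (pt (p + (0, 1)))"

lemma shift_simps:
  "shift 0 e = 0" "shift 1 e = e" "shift (i + j) e = shift i e + shift j e"
  "shift (i - j) e = shift i e - shift j e" "shift (- 1) e = - e"
  by (simp_all add: shift_def prod_eq_iff algebra_simps)

lemma minorsI:
  "k \<in> U \<Longrightarrow> l \<in> U \<Longrightarrow> var (x k) * var (y l) - var (x l) * var (y k) \<in> minors x y U"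
  by (auto simp: minors_def)

lemma front_shift: "front (p + q) e s = front p e s + q"
  by (simp add: front_def add.commute add.left_commute)

lemma edge_shift: "edge (p + shift i e) e s j = edge p e s (i + j)"
  by (simp add: edge_def front_shift shift_simps ac_simps)

lemma edge_step_binomial:
  fixes p e :: "int \<times> int" and s j :: int
  assumes "e \<in> units" "s = 1 \<or> s = -1"
  defines "b \<equiv> var (edge p e s (j - 1)) * var (edge p e (- s) j)
    - var (edge p e s j) * var (edge p e (- s) (j - 1)) :: (point, 'k::field) mpoly"
  shows "b = cell_binomial (p + shift j e) \<or> b = - cell_binomial (p + shift j e)"
proof -
  obtain x y where xy: "p + shift j e = (x, y)" by force
  have "front p e t + shift (j - 1) e = front (p + shift j e) e t - e"
    "front p e t + shift j e = front (p + shift j e) e t" for t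
    by (simp_all add: front_shift shift_simps)
  then have b: "b = var (pt (front (x, y) e s - e)) * var (pt (front (x, y) e (- s)))
      - var (pt (front (x, y) e s)) * var (pt (front (x, y) e (- s) - e))"
    unfolding b_def edge_def xy by simp
  show ?thesis
    using assms(1,2) unfolding b xy cell_binomial_def units_def
    by (elim insertE emptyE disjE) (simp_all add: front_def algebra_simps)
qed

section \<open>Straight runs of the path and the factors in their coordinates\<close>

context closed_path
begin

definition segment :: "int \<Rightarrow> nat \<Rightarrow> int \<times> int \<Rightarrow> bool" where
  "segment i m e \<longleftrightarrow> e \<in> units \<and> (\<forall>j\<le>m. a (i + int j) = a i + shift (int j) e)"

lemma segmentD:
  assumes "segment i m e" "0 \<le> j" "j \<le> int m"
  shows "a (i + j) = a i + shift j e"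
  using assms(1,3) spec[OF conjunct2[OF assms(1)[unfolded segment_def]], of "nat j"] assms(2)
  by (simp add: le_nat_iff nat_le_iff)

lemma segment_d:
  assumes "segment i m e" "0 \<le> j" "j < int m"
  shows "d (i + j) = e"
  using segmentD[OF assms(1), of j] segmentD[OF assms(1), of "j + 1"] assms(2,3)
  by (simp add: d_def shift_simps ac_simps)

lemma segment_straight:
  assumes "segment i m e" "0 < j" "j < int m"
  shows "\<tau> (i + j) = 0"
  using segment_d[OF assms(1), of j] segment_d[OF assms(1), of "j - 1"] assms(2,3)
  by (simp add: \<tau>_zero_iff algebra_simps)

lemma segment_edge:
  assumes "segment i m e" "0 \<le> j" "j \<le> int m"
  shows "edge (a i) e s j = pt (front (a (i + j)) e s)"
    and "edge (a i) e s (j - 1) = pt (front (a (i + j)) e s - e)"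
  using segmentD[OF assms] by (simp_all add: edge_def front_shift shift_simps add_diff_eq)

lemma segment_edge_verts:
  assumes "segment i m e" "s = 1 \<or> s = -1" "-1 \<le> j" "j \<le> int m"
  shows "\<exists>k. front (a i) e s + shift j e \<in> verts (a k)"
proof (cases "j = -1")
  case True
  then show ?thesis
    using front_verts(2)[of e s "a i"] assms by (auto simp: segment_def shift_simps)
next
  case False
  then have "front (a i) e s + shift j e = front (a (i + j)) e s"
    using segmentD[OF assms(1), of j] assms by (simp add: front_shift)
  then show ?thesis
    using front_verts(1)[of e s] assms by (metis segment_def)
qed

lemma segment_two_rows:
  assumes g: "segment i m e" and s: "s = 1 \<or> s = -1" and U: "U \<subseteq> {-1..int m}"
  shows "two_rows V (edge (a i) e s) (edge (a i) e (- s)) U"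
proof -
  have s': "- s = 1 \<or> - s = -1" using s by auto
  have e: "e \<in> units" using g by (simp add: segment_def)
  have pos: "0 \<le> fst (front (a i) e t + shift j e) \<and> 0 \<le> snd (front (a i) e t + shift j e)"
    if "t = 1 \<or> t = -1" "j \<in> U" for t j
  proof -
    have "- 1 \<le> j" "j \<le> int m" using U that by auto
    from segment_edge_verts[OF g that(1) this] obtain k
      where "front (a i) e t + shift j e \<in> verts (a k)" by blast
    from verts_positive[OF this] show ?thesis by simp
  qed
  have inj: "t = t' \<and> j = j'"
    if "edge (a i) e t j = edge (a i) e t' j'" "t = 1 \<or> t = -1" "t' = 1 \<or> t' = -1" "j \<in> U" "j' \<in> U"
    for t t' j j'
  proof -
    have "front (a i) e t + shift j e = front (a i) e t' + shift j' e"
      using pt_inj[of "front (a i) e t + shift j e" "front (a i) e t' + shift j' e"]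
        pos[OF that(2,4)] pos[OF that(3,5)] that(1) by (simp add: edge_def)
    then show ?thesis using e that(2,3) unfolding units_def
      by (elim insertE emptyE disjE) (simp_all add: front_def shift_def prod_eq_iff)
  qed
  have inV: "edge (a i) e t j \<in> V" if "t = 1 \<or> t = -1" "j \<in> U" for t j
  proof -
    have "- 1 \<le> j" "j \<le> int m" using U that by auto
    from segment_edge_verts[OF g that(1) this] obtain k
      where "front (a i) e t + shift j e \<in> verts (a k)" by blast
    then show ?thesis unfolding edge_def by (rule V_I)
  qed
  have "finite U" using U finite_subset by blast
  moreover have "inj_on (edge (a i) e t) U" if "t = 1 \<or> t = -1" for t
    using inj[of t _ t] that by (auto intro: inj_onI)
  moreover have "edge (a i) e s ` U \<inter> edge (a i) e (- s) ` U = {}"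
  proof (rule equals0I)
    fix v assume v: "v \<in> edge (a i) e s ` U \<inter> edge (a i) e (- s) ` U"
    obtain j where j: "j \<in> U" "v = edge (a i) e s j" using v by (elim IntE imageE)
    obtain j' where j': "j' \<in> U" "v = edge (a i) e (- s) j'" using v by (elim IntE imageE)
    have "s = - s" using inj[of s j "- s" j'] s s' j j' by simp
    then show False using s by auto
  qed
  ultimately show ?thesis
    using inV s s' unfolding two_rows_def by auto
qed

lemma factor_cell:
  assumes "\<not> uturn (i + 1)"
  shows "(factor i :: (point, 'k::field) mpoly) = cell_binomial (a i) \<or>
    (factor i :: (point, 'k) mpoly) = - cell_binomial (a i)"
proof -
  define s where "s = side i"
  have s: "s = 1 \<or> s = -1" "- s = 1 \<or> - s = -1" using side_cases[of i] by (auto simp: s_def)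
  have d2: "PF (diag2 i t) = edge (a i) (d (i - 1)) (- t) 0" for t
    using assms by (simp add: diag2_def PF_def F_simp edge_def shift_simps)
  have d1: "PF (diag1 i t) = edge (a i) (d (i - 1)) t (0 - 1)" if "t = 1 \<or> t = -1" for t
    using F_gap'[OF that, of i] assms by (simp add: diag1_def PF_def edge_def shift_simps)
  have "factor i = var (edge (a i) (d (i - 1)) s (0 - 1)) * var (edge (a i) (d (i - 1)) (- s) 0)
      - var (edge (a i) (d (i - 1)) s 0) * (var (edge (a i) (d (i - 1)) (- s) (0 - 1)) :: (point, 'k) mpoly)"
    using d1[OF s(1)] d1[OF s(2)] d2[of s] d2[of "- s"]
    by (simp add: factor_def mult.commute flip: s_def)
  then show ?thesis
    using edge_step_binomial[OF d_units s(1), of "a i" "i - 1" 0, where 'k = 'k] by (simp add: shift_simps)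
qed

text \<open>In the run \<open>i\<close>, \<open>i + 1\<close> the domino is the minor of the outer
  columns -1 and 1, and column 0 is skipped.\<close>

lemma factor_domino:
  fixes i s :: int
  assumes "uturn (i + 1)" and s: "s = 1 \<or> s = -1"
  defines "b \<equiv> var (edge (a i) (d i) s (- 1)) * var (edge (a i) (d i) (- s) 1)
      - var (edge (a i) (d i) s 1) * var (edge (a i) (d i) (- s) (- 1)) :: (point, 'k::field) mpoly"
  shows "b = factor i \<or> b = - factor i"
proof -
  have s': "- s = 1 \<or> - s = -1" using s by auto
  have d2: "PF (diag2 i t) = edge (a i) (d i) (- t) 1" for t
    using assms(1) a_step(1)[of i] by (simp add: diag2_def PF_def F_simp edge_def shift_simps front_shift)
  have d1: "PF (diag1 i t) = edge (a i) (d i) t (- 1)" if "t = 1 \<or> t = -1" for t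
    using F_rear[OF that, of i] assms(1) by (simp add: diag1_def PF_def edge_def shift_simps)
  have "side i = s \<or> side i = - s" using side_cases[of i] s by auto
  then show ?thesis
    using d1[OF s] d1[OF s'] d2[of s] d2[of "- s"]
    unfolding b_def by (elim disjE) (simp_all add: factor_def mult.commute)
qed

end


section \<open>Ideals of straight runs in the Knutson family\<close>

locale closed_path_family = closed_path +
  fixes f :: "(point, 'k::field) mpoly"
  assumes factor_family: "idl V {factor i} \<in> knutson_family (poly_ring V) f"
begin

abbreviation family :: "(point, 'k) mpoly set set" where
  "family \<equiv> knutson_family (poly_ring V) f"

lemma principal_family:
  assumes "b = factor i \<or> b = - factor i"
  shows "idl V {b} \<in> family"
proof -
  have "(factor i :: (point, 'k) mpoly) \<in> carrier (poly_ring V)" by (rule factor_carrier)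
  from principal_minus[OF this] show ?thesis using assms factor_family[of i] by auto
qed

lemma edge_binomial_family:
  assumes g: "segment i m e" and j: "0 \<le> j" "j \<le> int m" and nu: "\<not> uturn (i + j + 1)"
    and s: "s = 1 \<or> s = -1"
  shows "idl V {var (edge (a i) e s (j - 1)) * var (edge (a i) e (- s) j)
    - var (edge (a i) e s j) * var (edge (a i) e (- s) (j - 1))} \<in> family"
proof (rule principal_family)
  have e: "e \<in> units" using g by (simp add: segment_def)
  show "var (edge (a i) e s (j - 1)) * var (edge (a i) e (- s) j)
    - var (edge (a i) e s j) * var (edge (a i) e (- s) (j - 1)) = (factor (i + j) :: (point, 'k) mpoly) \<or>
    var (edge (a i) e s (j - 1)) * var (edge (a i) e (- s) j)
    - var (edge (a i) e s j) * var (edge (a i) e (- s) (j - 1)) = - (factor (i + j) :: (point, 'k) mpoly)"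
    using edge_step_binomial[OF e s, of "a i" j, where 'k = 'k] factor_cell[OF nu, where 'k = 'k]
      segmentD[OF g j] by auto
qed

text \<open>As long as no factor is a domino, the factors are minors of consecutive columns, and
  each cell attaches its front column to the previous one.\<close>

lemma start_family:
  assumes g: "segment i m e" and s: "s = 1 \<or> s = -1"
    and "t \<le> m" and "\<And>j. 0 \<le> j \<Longrightarrow> j \<le> int t \<Longrightarrow> \<not> uturn (i + j + 1)"
  shows "idl V (minors (edge (a i) e s) (edge (a i) e (- s)) {-1..int t}) \<in> family"
  using assms(3,4)
proof (induction t)
  case 0
  let ?U = "{-1, 0} :: int set"
  have U: "?U \<subseteq> {-1..int m}" by auto
  note r = segment_two_rows[OF g s U]
  have "idl V (minors (edge (a i) e s) (edge (a i) e (- s)) ?U) \<in> family"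
    using r edge_binomial_family[OF g _ _ _ s, of 0] 0 by (subst genideal_minors_pair) (auto simp: two_rows_def)
  moreover have "{-1..int 0} = ?U" by auto
  ultimately show ?case by simp
next
  case (Suc t)
  have U: "insert (int (Suc t)) {-1..int t} = {-1..int (Suc t)}" by auto
  have "idl V (minors (edge (a i) e s) (edge (a i) e (- s))
      (insert (int (Suc t)) {-1..int t})) \<in> family"
  proof (rule knutson_family_attach_column[where u = "int t"])
    show "idl V (minors (edge (a i) e s) (edge (a i) e (- s)) {-1..int t}) \<in> family"
      using Suc by simp
    show "idl V {var (edge (a i) e s (int t)) * var (edge (a i) e (- s) (int (Suc t)))
        - var (edge (a i) e s (int (Suc t))) * var (edge (a i) e (- s) (int t))} \<in> family"
      using edge_binomial_family[OF g _ _ _ s, of "int (Suc t)"] Suc.prems(1) Suc.prems(2)[of "int (Suc t)"]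
      by simp
    show "two_rows V (edge (a i) e s) (edge (a i) e (- s)) (insert (int (Suc t)) {-1..int t})"
      unfolding U using Suc.prems by (intro segment_two_rows[OF g s]) auto
  qed auto
  then show ?case unfolding U .
qed

lemma uturn_not_consecutive: "uturn k \<Longrightarrow> \<not> uturn (k + 1)"
  using turn_before_uturn[of k] next_cases[of k] by (auto simp: uturn_def)

lemma domino_family:
  assumes g: "segment i m e" and m: "1 \<le> m" and ut: "uturn (i + int m)" and s: "s = 1 \<or> s = -1"
  shows "idl V {var (edge (a i) e s (int m - 2)) * var (edge (a i) e (- s) (int m))
    - var (edge (a i) e s (int m)) * var (edge (a i) e (- s) (int m - 2))} \<in> family"
proof -
  let ?k = "i + (int m - 1)"
  have ut': "uturn (?k + 1)" using ut by simp
  have d: "d ?k = e" using segment_d[OF g, of "int m - 1"] m by simp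
  have a: "a ?k = a i + shift (int m - 1) e" using segmentD[OF g, of "int m - 1"] m by simp
  have E: "edge (a ?k) (d ?k) t j = edge (a i) e t (int m - 1 + j)" for t j
    by (simp add: a d edge_shift)
  show ?thesis
    using principal_family[OF factor_domino[OF ut' s]] unfolding E by simp
qed

text \<open>Only the cell before the last one can carry a domino. In that case the last column is
  attached first, by the domino, to the column two places before it, and the skipped column is then
  attached to the last one by the minor of the last cell.\<close>

lemma segment_family:
  assumes g: "segment i m e" and s: "s = 1 \<or> s = -1" and nu: "\<not> uturn (i + int m + 1)"
  shows "idl V (minors (edge (a i) e s) (edge (a i) e (- s)) {-1..int m}) \<in> family"
proof (cases "1 \<le> m \<and> uturn (i + int m)")
  case False
  have "\<not> uturn (i + j + 1)" if "0 \<le> j" "j \<le> int m" for j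
  proof -
    consider "j = int m" | "j + 1 = int m" | "j + 1 < int m" using \<open>j \<le> int m\<close> by linarith
    then show ?thesis
    proof cases
      case 2
      then have "uturn (i + j + 1) = uturn (i + int m)" "1 \<le> m" using that by (auto simp: add.assoc)
      then show ?thesis using False by simp
    next
      case 3
      then show ?thesis using segment_straight[OF g, of "j + 1"] that by (simp add: uturn_def add.assoc)
    qed (use nu in simp)
  qed
  then show ?thesis by (intro start_family[OF g s]) auto
next
  case True
  let ?x = "edge (a i) e s" and ?y = "edge (a i) e (- s)" and ?m = "int m"
  have dom: "idl V {var (?x (?m - 2)) * var (?y ?m) - var (?x ?m) * var (?y (?m - 2))} \<in> family"
    using domino_family[OF g _ _ s] True by blast
  \<comment> \<open>The sign is reversed because column \<open>m\<close> is now the old column and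
    column \<open>m - 1\<close> the new one.\<close>
  have last: "idl V {var (?x ?m) * var (?y (?m - 1)) - var (?x (?m - 1)) * var (?y ?m)} \<in> family"
  proof -
    have V: "two_rows V ?x ?y {?m - 1, ?m}" using True by (intro segment_two_rows[OF g s]) auto
    have "(var (?x (?m - 1)) * var (?y ?m) - var (?x ?m) * var (?y (?m - 1)) :: (point, 'k) mpoly)
        \<in> carrier (poly_ring V)"
      using V by (intro binomial_carrier) (auto simp: two_rows_def)
    from principal_minus[OF this] show ?thesis
      using edge_binomial_family[OF g _ _ _ s, of ?m] nu by simp
  qed
  have "idl V (minors ?x ?y (insert ?m {-1..?m - 2})) \<in> family"
  proof (cases "m = 1")
    \<comment> \<open>For a run of two cells there is no earlier minor to start from: the domino
      itself is the initial matrix, with columns -1 and 1.\<close>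
    case True
    have V: "two_rows V ?x ?y {?m - 2, ?m}" using True by (intro segment_two_rows[OF g s]) auto
    have "idl V (minors ?x ?y {?m - 2, ?m}) \<in> family"
      using V dom by (subst genideal_minors_pair) (auto simp: two_rows_def)
    moreover have "insert ?m {-1..?m - 2} = {?m - 2, ?m}" using True by auto
    ultimately show ?thesis by simp
  next
    case False
    then have m: "2 \<le> m" using True by simp
    show ?thesis
    proof (rule knutson_family_attach_column[where u = "?m - 2"])
      have "\<not> uturn (i + j + 1)" if "0 \<le> j" "j \<le> int (m - 2)" for j
        using segment_straight[OF g, of "j + 1"] that m by (simp add: uturn_def add.assoc)
      then have "idl V (minors ?x ?y {-1..int (m - 2)}) \<in> family"
        by (intro start_family[OF g s]) auto
      then show "idl V (minors ?x ?y {-1..?m - 2}) \<in> family"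
        using m by (simp add: of_nat_diff)
      show "two_rows V ?x ?y (insert ?m {-1..?m - 2})"
        by (intro segment_two_rows[OF g s]) auto
      show "?m - 2 \<in> {-1..?m - 2}" using m by simp
    qed (rule dom)
  qed
  then have "idl V (minors ?x ?y (insert (?m - 1) (insert ?m {-1..?m - 2}))) \<in> family"
  proof (rule knutson_family_attach_column[OF _ last])
    show "two_rows V ?x ?y (insert (?m - 1) (insert ?m {-1..?m - 2}))"
      using True by (intro segment_two_rows[OF g s]) auto
  qed simp
  moreover have "insert (?m - 1) (insert ?m {-1..?m - 2}) = {-1..?m}" using True by auto
  ultimately show ?thesis by simp
qed

lemma segment_two: "segment k 1 (d k)"
  unfolding segment_def using d_units[of k] a_step(1)[of k]
  by (auto simp: le_Suc_eq shift_simps)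

lemma segment_extend:
  assumes "segment i m e" "d (i + int m) = e"
  shows "segment i (Suc m) e"
  using assms a_step(1)[of "i + int m"] segmentD[OF assms(1), of "int m"]
  by (auto simp: segment_def le_Suc_eq shift_simps ac_simps)

lemma minors_sign:
  assumes "H \<subseteq> carrier (poly_ring V)" "(g :: (point, 'k) mpoly) \<in> idl V H"
    "h = g \<or> h = - g"
  shows "h \<in> idl V H"
  using assms poly_ring_ideal_closed(4)[OF genideal_poly_ring(1)[OF assms(1)]] by auto

text \<open>
  The corner cell \<open>k = i + m\<close> is not a factor, but it lies in the domino block \<open>k, k + 1\<close>,
  so that the elbow formed by the two blocks is obtained as a whole.
\<close>

lemma elbow_family:
  assumes g: "segment i m e" and m: "1 \<le> m" and ut: "uturn (i + int m + 1)" and \<tau>: "\<tau> (i + int m) \<noteq> 0"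
  defines "s \<equiv> \<tau> (i + int m)" and "k \<equiv> i + int m"
  shows "\<exists>E. idl V (minors (edge (a i) e s) (edge (a i) e (- s)) {-1..int m} \<union> E) \<in> family
    \<and> E \<subseteq> minors (edge (a k) (d k) s) (edge (a k) (d k) (- s)) {-1..1}"
proof -
  let ?x = "edge (a i) e s" and ?y = "edge (a i) e (- s)" and ?m = "int m"
  let ?x' = "edge (a k) (d k) s" and ?y' = "edge (a k) (d k) (- s)"
  have s: "s = 1 \<or> s = -1" using \<tau> \<tau>_cases[of "i + int m"] by (auto simp: s_def)
  have s': "- s = 1 \<or> - s = -1" using s by auto
  have e: "e \<in> units" using g by (simp add: segment_def)
  have dk: "d (k - 1) = e" using segment_d[OF g, of "int m - 1"] m by (simp add: k_def algebra_simps)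
  have cr: "cross e (d k) = s" using dk by (simp add: s_def \<tau>_def k_def)
  have ak: "a k = a i + shift ?m e" using segmentD[OF g, of ?m] by (simp add: k_def)
  have x: "?x ?m = pt (front (a k) e s)" "?x (?m - 1) = pt (front (a k) e s - e)"
    "?y ?m = pt (front (a k) e (- s))" "?y (?m - 1) = pt (front (a k) e (- s) - e)"
    using segment_edge[OF g, of ?m] by (simp_all add: k_def)
  \<comment> \<open>The turn exchanges rows and columns of the corner cell: column
    \<open>m - 1\<close> of the first run lies in the row \<open>?x'\<close> of the second run, and
    column \<open>m\<close> in the row \<open>?y'\<close>.\<close>
  have x': "?x' 0 = ?x (?m - 1)" "?y' 0 = ?x ?m" "?x' (- 1) = ?y (?m - 1)" "?y' (- 1) = ?y ?m"
  proof -
    show "?x' 0 = ?x (?m - 1)"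
      using front_turn(1)[OF e d_units s cr, of "a k"] unfolding x by (simp add: edge_def shift_simps)
    have "cross e (d k) = - (- s)" using cr by simp
    from front_turn(2)[OF e d_units s' this, of "a k"]
    show "?y' 0 = ?x ?m" unfolding x by (simp add: edge_def shift_simps)
    show "?x' (- 1) = ?y (?m - 1)"
      using arg_cong[OF front_turn(4)[OF e d_units s cr, of "a k"], of pt]
      unfolding x by (simp only: edge_def shift_simps add_uminus_conv_diff)
    show "?y' (- 1) = ?y ?m"
      using arg_cong[OF front_turn(3)[OF e d_units s cr, of "a k"], of pt]
      unfolding x by (simp only: edge_def shift_simps add_uminus_conv_diff)
  qed
  define zp where "zp = ?x' 1"
  define zq where "zq = ?y' 1"
  have g': "segment k 1 (d k)" by (rule segment_two)
  have r': "two_rows V ?x' ?y' {-1..1}" by (rule segment_two_rows[OF g' s]) simp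
  let ?E = "elbow_minors ?x ?y (?m - 1) ?m zp zq :: (point, 'k) mpoly set"
  have E: "?E = {var (?x' 0) * var (?y' (- 1)) - var (?x' (- 1)) * var (?y' 0),
      var (?x' 0) * var (?y' 1) - var (?x' 1) * var (?y' 0),
      var (?x' (- 1)) * var (?y' 1) - var (?x' 1) * var (?y' (- 1))}"
    unfolding elbow_minors_def x' zp_def zq_def by (simp add: mult.commute)
  have Ec: "?E \<subseteq> minors ?x' ?y' {-1..1}"
    unfolding E by (intro insert_subsetI minorsI empty_subsetI) auto
  have M'c: "(minors ?x' ?y' {-1..1} :: (point, 'k) mpoly set) \<subseteq> carrier (poly_ring V)"
    using r' by (intro minors_carrier) (auto simp: two_rows_def)
  have Ecar: "?E \<subseteq> carrier (poly_ring V)" using Ec M'c by (rule subset_trans)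
  note iE = genideal_poly_ring[OF Ecar] and iM = genideal_poly_ring[OF M'c]
  note cE = poly_ring_ideal_closed[OF iE(1)]
  have sub: "minors ?x' ?y' {-1..1} \<subseteq> idl V ?E"
  proof
    fix h :: "(point, 'k) mpoly" assume "h \<in> minors ?x' ?y' {-1..1}"
    then obtain u w where uw: "u \<in> {-1..1}" "w \<in> {-1..1}"
      and h: "h = var (?x' u) * var (?y' w) - var (?x' w) * var (?y' u)"
      by (auto simp: minors_def)
    have three: "{-1..1} = {-1, 0, 1 :: int}" by auto
    have "h = 0 \<or> h \<in> ?E \<or> - h \<in> ?E"
      using uw unfolding h E three by (elim insertE emptyE) simp_all
    then show "h \<in> idl V ?E"
      using cE(1) cE(4)[of "- h"] iE(2) by auto
  qed
  have "idl V ?E = idl V (minors ?x' ?y' {-1..1})"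
    using iM(3)[OF iE(1) sub] iE(3)[OF iM(1)] Ec iM(2) by blast
  also have "\<dots> \<in> family"
    using segment_family[OF g' s] uturn_not_consecutive[OF ut] by (simp add: k_def add.assoc)
  finally have EK: "idl V ?E \<in> family" .
  have nk: "\<not> uturn k" using uturn_not_consecutive[of k] ut by (auto simp: k_def)
  have "\<not> uturn (i + j + 1)" if "0 \<le> j" "j \<le> int (m - 1)" for j
  proof (cases "j + 1 = int m")
    case True
    then have "i + j + 1 = k" by (simp add: k_def)
    then show ?thesis using nk by simp
  next
    case False
    then show ?thesis
      using segment_straight[OF g, of "j + 1"] that m by (simp add: uturn_def add.assoc)
  qed
  then have UK: "idl V (minors ?x ?y {-1..?m - 1}) \<in> family"
    using start_family[OF g s, of "m - 1"] m by (simp add: of_nat_diff)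
  have U: "insert ?m {-1..?m - 1} = {-1..?m}" by auto
  have r: "two_rows V ?x ?y {-1..?m}" by (rule segment_two_rows[OF g s]) simp
  have "zp \<in> ?x' ` {-1..1}" "zq \<in> ?y' ` {-1..1}" by (auto simp: zp_def zq_def)
  then have z: "zp \<in> V" "zq \<in> V" "zp \<noteq> zq" using r' unfolding two_rows_def by blast+
  have new: "?x' 1 \<noteq> edge (a i) e t j \<and> ?y' 1 \<noteq> edge (a i) e t j"
    if t: "t = 1 \<or> t = -1" and j: "j \<in> {-1..?m}" for t j
  proof -
    obtain k1 where "front (a i) e t + shift j e \<in> verts (a k1)"
      using segment_edge_verts[OF g t, of j] j by auto
    note p1 = verts_positive[OF this]
    have p2: "1 \<le> fst (front (a k) (d k) s' + shift 1 (d k)) \<and> 1 \<le> snd (front (a k) (d k) s' + shift 1 (d k))"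
      if s': "s' = 1 \<or> s' = -1" for s'
    proof -
      obtain k' where "front (a k) (d k) s' + shift 1 (d k) \<in> verts (a k')"
        using segment_edge_verts[OF g' s', of 1] by auto
      then show ?thesis by (rule verts_positive)
    qed
    have "edge (a k) (d k) s' 1 \<noteq> edge (a i) e t j" if s': "s' = 1 \<or> s' = -1" for s'
    proof
      assume "edge (a k) (d k) s' 1 = edge (a i) e t j"
      then have "front (a k) (d k) s' + shift 1 (d k) = front (a i) e t + shift j e"
        using pt_inj[of "front (a k) (d k) s' + shift 1 (d k)" "front (a i) e t + shift j e"]
          p1 p2[OF s'] by (simp add: edge_def)
      then show False
        using e d_units[of k] cr s s' t unfolding units_def ak
        by (elim insertE emptyE disjE) (simp_all add: front_def shift_def cross_def prod_eq_iff)
    qed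
    then show ?thesis using s s' by blast
  qed
  have "idl V (minors ?x ?y (insert ?m {-1..?m - 1}) \<union> ?E) \<in> family"
  proof (rule knutson_family_elbow[OF UK EK])
    show "two_rows V ?x ?y (insert ?m {-1..?m - 1})" unfolding U by (rule r)
    show "?m - 1 \<in> {-1..?m - 1}" "?m - 1 \<noteq> ?m" using m by auto
    show "zp \<notin> ?x ` insert ?m {-1..?m - 1} \<union> ?y ` insert ?m {-1..?m - 1}"
      "zq \<notin> ?x ` insert ?m {-1..?m - 1} \<union> ?y ` insert ?m {-1..?m - 1}"
      unfolding U zp_def zq_def using new[OF s] new[OF s'] by (auto simp del: atLeastAtMost_iff)
  qed (rule z)+
  then show ?thesis unfolding U using Ec by blast
qed


definition segment_minors :: "(point, 'k) mpoly set" where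
  "segment_minors = (\<Union>(i, m, e)\<in>{(i, m, e). segment i m e}. \<Union>s\<in>{1, -1}.
     minors (edge (a i) e s) (edge (a i) e (- s)) {-1..int m})"

lemma segment_minorsI:
  assumes "segment i m e" "s = 1 \<or> s = -1"
  shows "minors (edge (a i) e s) (edge (a i) e (- s)) {-1..int m} \<subseteq> segment_minors"
  using assms unfolding segment_minors_def by blast

lemma segment_minors_carrier: "segment_minors \<subseteq> carrier (poly_ring V)"
proof
  fix g assume "g \<in> segment_minors"
  then obtain i m e s where g: "segment i m e" "s = 1 \<or> s = -1"
      "g \<in> minors (edge (a i) e s) (edge (a i) e (- s)) {-1..int m}"
    unfolding segment_minors_def by blast
  have "two_rows V (edge (a i) e s) (edge (a i) e (- s)) {-1..int m}"
    by (rule segment_two_rows[OF g(1,2)]) simp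
  then have "(minors (edge (a i) e s) (edge (a i) e (- s)) {-1..int m} :: (point, 'k) mpoly set)
      \<subseteq> carrier (poly_ring V)"
    by (intro minors_carrier) (simp_all add: two_rows_def)
  then show "g \<in> carrier (poly_ring V)" using g(3) by (rule subsetD)
qed

text \<open>A run is good unless the cell after its end starts a U-turn, so that the factor of its
  last cell is a domino. If the last cell is straight or the only one, the run is prolonged by the
  U-turn corner; otherwise the domino bends away and the elbow is used. The larger ideal still stays
  below the polyomino ideal because all its generators are minors of runs.\<close>

lemma segment_cover:
  assumes g: "segment i m e" and e: "m = 0 \<Longrightarrow> e = d i" and s: "s = 1 \<or> s = -1"
  shows "\<exists>H. H \<subseteq> segment_minors \<and> idl V H \<in> family \<and>
    var (edge (a i) e s (- 1)) * var (edge (a i) e (- s) (int m))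
      - var (edge (a i) e s (int m)) * var (edge (a i) e (- s) (- 1)) \<in> idl V H"
proof -
  define g where "g t = (var (edge (a i) e t (- 1)) * var (edge (a i) e (- t) (int m))
      - var (edge (a i) e t (int m)) * var (edge (a i) e (- t) (- 1)) :: (point, 'k) mpoly)" for t
  have sign: "g s \<in> idl V H"
    if H: "H \<subseteq> segment_minors" "g t \<in> H" and t: "t = 1 \<or> t = -1" for H t
  proof -
    have c: "H \<subseteq> carrier (poly_ring V)" using H(1) segment_minors_carrier by (rule subset_trans)
    have "t = s \<or> t = - s" using s t by auto
    then have "g s = g t \<or> g s = - g t" by (auto simp: g_def mult.commute)
    then show ?thesis
      using minors_sign[OF c _ , of "g t" "g s"] genideal_poly_ring(2)[OF c] H(2) by blast
  qed
  have "\<exists>H. H \<subseteq> segment_minors \<and> idl V H \<in> family \<and> g s \<in> idl V H"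
  proof (cases "uturn (i + int m + 1)")
    case False
    let ?H = "minors (edge (a i) e s) (edge (a i) e (- s)) {-1..int m} :: (point, 'k) mpoly set"
    have "g s \<in> ?H" unfolding g_def by (intro minorsI) auto
    then show ?thesis
      using segment_minorsI[OF assms(1) s] segment_family[OF assms(1) s False] sign[of ?H s] s by blast
  next
    case ut: True
    show ?thesis
    proof (cases "m = 0 \<or> \<tau> (i + int m) = 0")
      case True
      \<comment> \<open>For a single cell the assumption on \<open>e\<close> is what directs the run
        towards the next cell of the path.\<close>
      have "d (i + int m) = e"
      proof (cases "m = 0")
        case False
        then have "\<tau> (i + int m) = 0" using True by simp
        then show ?thesis
          using segment_d[OF assms(1), of "int m - 1"] False by (simp add: \<tau>_zero_iff algebra_simps)
      qed (use e in simp)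
      then have g': "segment i (Suc m) e" by (rule segment_extend[OF assms(1)])
      let ?H = "minors (edge (a i) e s) (edge (a i) e (- s)) {-1..int (Suc m)} :: (point, 'k) mpoly set"
      have "g s \<in> ?H" unfolding g_def by (intro minorsI) auto
      moreover have "\<not> uturn (i + int (Suc m) + 1)"
        using uturn_not_consecutive[OF ut] by (simp add: ac_simps)
      ultimately show ?thesis
        using segment_minorsI[OF g' s] segment_family[OF g' s] sign[of ?H s] s by blast
    next
      case False
      define t where "t = \<tau> (i + int m)"
      have t: "t = 1 \<or> t = -1" using False \<tau>_cases[of "i + int m"] by (auto simp: t_def)
      let ?M = "minors (edge (a i) e t) (edge (a i) e (- t)) {-1..int m} :: (point, 'k) mpoly set"
      have m: "1 \<le> m" "\<tau> (i + int m) \<noteq> 0" using False by auto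
      from elbow_family[OF assms(1) m(1) ut m(2)]
      obtain E where E: "idl V (?M \<union> E) \<in> family"
        "E \<subseteq> minors (edge (a (i + int m)) (d (i + int m)) t) (edge (a (i + int m)) (d (i + int m)) (- t)) {-1..1}"
        unfolding t_def by blast
      have "minors (edge (a (i + int m)) (d (i + int m)) t)
          (edge (a (i + int m)) (d (i + int m)) (- t)) {-1..1} \<subseteq> segment_minors"
        using segment_minorsI[OF segment_two t] by simp
      then have "?M \<union> E \<subseteq> segment_minors"
        using segment_minorsI[OF assms(1) t] E(2) by blast
      moreover have "g t \<in> ?M \<union> E" unfolding g_def by (intro UnI1 minorsI) auto
      ultimately show ?thesis using E(1) sign[of "?M \<union> E" t] t by blast
    qed
  qed
  then show ?thesis unfolding g_def .
qed

end

section \<open>Polyominoes\<close>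

lemma mem_cell: "w \<in> cell u \<longleftrightarrow>
    fst u \<le> fst w \<and> fst w \<le> fst u + 1 \<and> snd u \<le> snd w \<and> snd w \<le> snd u + 1"
  by (auto simp: cell_def less_eq_prod_def)

lemma cell_inj: "cell u = cell v \<Longrightarrow> u = v"
proof -
  assume e: "cell u = cell v"
  have "u \<in> cell v" "v \<in> cell u" using mem_cell[of u u] mem_cell[of v v] e by simp_all
  then show "u = v" by (simp add: mem_cell prod_eq_iff)
qed

lemma cell_subset_interval:
  "cell u \<subseteq> {b..c} \<longleftrightarrow> fst b \<le> fst u \<and> fst u < fst c \<and> snd b \<le> snd u \<and> snd u < snd c"
proof
  assume s: "cell u \<subseteq> {b..c}"
  have "u \<in> cell u" "u + (1, 1) \<in> cell u" by (simp_all add: mem_cell)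
  then have "u \<in> {b..c}" "u + (1, 1) \<in> {b..c}" using s by blast+
  then show "fst b \<le> fst u \<and> fst u < fst c \<and> snd b \<le> snd u \<and> snd u < snd c"
    by (simp add: less_eq_prod_def)
next
  assume "fst b \<le> fst u \<and> fst u < fst c \<and> snd b \<le> snd u \<and> snd u < snd c"
  then show "cell u \<subseteq> {b..c}" by (auto simp: mem_cell less_eq_prod_def)
qed

definition corner :: "point \<Rightarrow> int \<times> int" where
  "corner u = (int (fst u), int (snd u))"

lemma pt_corner [simp]: "pt (corner u) = u"
  by (simp add: pt_def corner_def)

lemma corner_pt: "0 \<le> fst p \<Longrightarrow> 0 \<le> snd p \<Longrightarrow> corner (pt p) = p"
  by (simp add: pt_def corner_def prod_eq_iff)

lemma cell_pt_verts:
  assumes "0 \<le> fst p" "0 \<le> snd p"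
  shows "cell (pt p) = pt ` verts p"
proof (rule Set.set_eqI, rule iffI)
  fix w assume "w \<in> cell (pt p)"
  then have "corner w \<in> verts p" using assms by (auto simp: mem_cell verts_iff corner_def pt_def)
  then show "w \<in> pt ` verts p" using image_eqI[of w pt "corner w"] by simp
next
  fix w assume "w \<in> pt ` verts p"
  then show "w \<in> cell (pt p)" using assms by (auto simp: mem_cell verts_iff pt_def)
qed

lemma common_edge_units:
  assumes e: "cell u \<inter> cell v \<in> cell_edges (cell u)" and ne: "u \<noteq> v"
  shows "corner v - corner u \<in> units"
proof -
  obtain w w' where w: "w \<in> cell u \<inter> cell v" "w' \<in> cell u \<inter> cell v" "adjacent w w'"
  proof -
    from e obtain w w' where "cell u \<inter> cell v = {w, w'}" "adjacent w w'"
      unfolding cell_edges_def by blast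
    then show ?thesis using that[of w w'] by blast
  qed
  note m = w(1,2)[unfolded Int_iff mem_cell]
  consider "w' = w + (1, 0)" | "w' = w + (0, 1)" using w(3) unfolding adjacent_def by blast
  then show ?thesis
  proof cases
    case 1
    then have "fst u = fst v" "snd v \<le> snd u + 1" "snd u \<le> snd v + 1" using m by auto
    moreover have "snd u \<noteq> snd v" using ne \<open>fst u = fst v\<close> by (simp add: prod_eq_iff)
    ultimately have "fst (corner v - corner u) = 0" "snd (corner v - corner u) \<in> {1, -1}"
      by (auto simp: corner_def)
    then show ?thesis by (auto simp: units_def prod_eq_iff)
  next
    case 2
    then have "snd u = snd v" "fst v \<le> fst u + 1" "fst u \<le> fst v + 1" using m by auto
    moreover have "fst u \<noteq> fst v" using ne \<open>snd u = snd v\<close> by (simp add: prod_eq_iff)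
    ultimately have "snd (corner v - corner u) = 0" "fst (corner v - corner u) \<in> {1, -1}"
      by (auto simp: corner_def)
    then show ?thesis by (auto simp: units_def prod_eq_iff)
  qed
qed

text \<open>Cells adjacent in the plane are adjacent along the path: \<open>near\<close> leaves
  distances up to 2, and two unit steps never add up to a unit vector.\<close>

lemma (in closed_path) neighbour:
  assumes e: "e \<in> units" and l: "a l = a i + e"
  shows "a (i + 1) = a i + e \<or> a (i - 1) = a i + e"
proof -
  have "verts (a i) \<inter> verts (a l) \<noteq> {}"
    using e unfolding l by (cases "a i") (auto simp: verts_def units_def)
  from near[OF this] obtain \<delta> where \<delta>: "\<delta> \<in> {-2..2}" "n dvd i - l - \<delta>" by blast
  then have "a (i - \<delta>) = a i + e" using l a_eq_iff[of "i - \<delta>" l] by (simp add: algebra_simps)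
  moreover have "\<delta> = -2 \<or> \<delta> = -1 \<or> \<delta> = 0 \<or> \<delta> = 1 \<or> \<delta> = 2" using \<delta>(1) by auto
  moreover have "e \<noteq> 0" using e by (auto simp: units_def prod_eq_iff)
  moreover have two: "d k + d (k + 1) \<noteq> e'" if "e' \<in> units" for k e'
    using d_units[of k] d_units[of "k + 1"] that unfolding units_def by (elim insertE emptyE) simp_all
  moreover have "a (i + 2) = a i + (d i + d (i + 1))"
    using a_step(1)[of i] a_step(1)[of "i + 1"] by (simp add: add.assoc)
  moreover have "a i = a (i - 2) + (d (i - 2) + d (i - 1))"
    using a_step(1)[of "i - 2"] a_step(1)[of "i - 1"] by (simp add: add.assoc)
  moreover have "- e \<in> units" using e by (auto simp: units_def)
  ultimately show ?thesis
    using two[OF e, of i] two[of "- e" "i - 2"] by (auto simp: algebra_simps add_eq_0_iff)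
qed

text \<open>In a 2 by 2 square the cells at \<open>p + (1, 0)\<close> and \<open>p + (0, 1)\<close>
  are the path neighbours of cell \<open>i\<close>, and the fourth cell is a path neighbour of both.
  It is then reached from \<open>i\<close> by two steps in either direction, so \<open>n\<close>
  would divide 4.\<close>

lemma (in closed_path) no_square:
  assumes "a i = p" "a j = p + (1, 0)" "a k = p + (0, 1)" "a l = p + (1, 1)"
  shows False
proof -
  have u: "(1, 0) \<in> units" "(0, 1) \<in> units" by (simp_all add: units_def)
  have ne: "p + (1, 0) \<noteq> p + (0, 1)" by (simp add: prod_eq_iff)
  have up: False if c: "a (i + c) = p + (1, 0)" "a (i - c) = p + (0, 1)" "c = 1 \<or> c = -1" for c
  proof -
    have "a l = a (i + c) + (0, 1)" "a l = a (i - c) + (1, 0)"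
      using c assms(4) by (simp_all add: prod_eq_iff)
    from neighbour[OF u(2) this(1)] neighbour[OF u(1) this(2)]
    have "a (i + c + 1) = a l \<or> a (i + c - 1) = a l" "a (i - c + 1) = a l \<or> a (i - c - 1) = a l"
      using \<open>a l = a (i + c) + (0, 1)\<close> \<open>a l = a (i - c) + (1, 0)\<close> by simp_all
    moreover have "a l \<noteq> a i" using assms by (simp add: prod_eq_iff)
    ultimately have "a (i + 2) = a (i - 2)" using c(3) by (auto simp: algebra_simps)
    then have "n dvd 4" using a_eq_iff[of "i + 2" "i - 2"] by simp
    then show False using not_dvd[of 4] by simp
  qed
  have "a (i + 1) = p + (1, 0) \<or> a (i - 1) = p + (1, 0)"
    "a (i + 1) = p + (0, 1) \<or> a (i - 1) = p + (0, 1)"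
    using neighbour[OF u(1), of j i] neighbour[OF u(2), of k i] assms by simp_all
  then show False using up[of 1] up[of "- 1"] ne by auto
qed

text \<open>By \<open>neighbour\<close> the path cannot leave and re-enter a row of occupied cells.
  After the first step the direction is settled, since the cell behind already accounts for one of
  the two path neighbours.\<close>

lemma (in closed_path) straight_path:
  assumes u: "u \<in> units" and occ: "\<And>j. j \<le> m \<Longrightarrow> \<exists>k. a k = p + shift (int j) u"
  shows "\<exists>i. (\<forall>j\<le>m. a (i + int j) = p + shift (int j) u) \<or> (\<forall>j\<le>m. a (i - int j) = p + shift (int j) u)"
  using occ
proof (induction m)
  case 0
  then obtain k where "a k = p + shift 0 u" by auto
  then show ?case by (intro exI[of _ k]) simp
next
  case (Suc m)
  then obtain i where i: "(\<forall>j\<le>m. a (i + int j) = p + shift (int j) u) \<or>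
      (\<forall>j\<le>m. a (i - int j) = p + shift (int j) u)" by auto
  obtain l where l: "a l = p + shift (int (Suc m)) u" using Suc.prems by blast
  have ne: "p + shift (int (Suc m)) u \<noteq> p + shift (int m - 1) u"
    using u by (auto simp: units_def shift_def)
  have next': "a (k + 1) = p + shift (int (Suc m)) u \<or> a (k - 1) = p + shift (int (Suc m)) u"
    if "a k = p + shift (int m) u" for k
  proof -
    have *: "p + shift (int (Suc m)) u = a k + u" using that by (simp add: shift_simps ac_simps)
    from neighbour[OF u l[unfolded *]] show ?thesis unfolding * .
  qed
  show ?case
  proof (cases "m = 0")
    case True
    have a0: "a i = p + shift 0 u" using i True by auto
    from next'[of i] a0 True have "a (i + 1) = p + shift 1 u \<or> a (i - 1) = p + shift 1 u" by simp
    then show ?thesis using a0 True by (intro exI[of _ i]) (auto simp: le_Suc_eq)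
  next
    case False
    from i show ?thesis
    proof
      assume f: "\<forall>j\<le>m. a (i + int j) = p + shift (int j) u"
      have "a (i + int m - 1) = p + shift (int m - 1) u"
        using f[rule_format, of "m - 1"] False by (simp add: of_nat_diff algebra_simps)
      then have "a (i + int (Suc m)) = p + shift (int (Suc m)) u"
        using next'[of "i + int m"] f ne by (auto simp: ac_simps)
      then show ?thesis using f by (intro exI[of _ i]) (auto simp: le_Suc_eq)
    next
      assume f: "\<forall>j\<le>m. a (i - int j) = p + shift (int j) u"
      have "a (i - int m + 1) = p + shift (int m - 1) u"
        using f[rule_format, of "m - 1"] False by (simp add: of_nat_diff algebra_simps)
      then have "a (i - int (Suc m)) = p + shift (int (Suc m)) u"
        using next'[of "i - int m"] f ne by (auto simp: algebra_simps)
      then show ?thesis using f by (intro exI[of _ i]) (auto simp: le_Suc_eq)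
    qed
  qed
qed

section \<open>Binomials of rectangles and of columns in a row of cells\<close>

definition rectangle_binomial :: "int \<times> int \<Rightarrow> int \<times> int \<Rightarrow> (point, 'k::field) mpoly" where
  "rectangle_binomial v w = var (pt v) * var (pt w) - var (pt (fst v, snd w)) * var (pt (fst w, snd v))"

definition row_binomial :: "int \<times> int \<Rightarrow> int \<times> int \<Rightarrow> int \<Rightarrow> int \<Rightarrow> int \<Rightarrow> (point, 'k::field) mpoly" where
  "row_binomial p e s u w = var (edge p e s u) * var (edge p e (- s) w) - var (edge p e s w) * var (edge p e (- s) u)"

text \<open>Columns are front edges, so the columns \<open>u\<close> and \<open>w\<close> enclose
  exactly the cells from \<open>u + 1\<close> to \<open>w\<close>.\<close>

lemma row_binomial_rectangle:
  fixes p e :: "int \<times> int" and s u w :: int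
  assumes e: "e \<in> units" and s: "s = 1 \<or> s = -1" and uw: "u < w"
  defines "b \<equiv> row_binomial p e s u w :: (point, 'k::field) mpoly"
  shows "\<exists>v v'. fst v < fst v' \<and> snd v < snd v' \<and> (b = rectangle_binomial v v' \<or> b = - rectangle_binomial v v')
    \<and> (\<forall>x y. fst v \<le> x \<and> x < fst v' \<and> snd v \<le> y \<and> y < snd v' \<longrightarrow>
        (\<exists>j\<in>{u + 1..w}. (x, y) = p + shift j e))"
proof -
  obtain x y where p: "p = (x, y)" by force
  consider "e = (1, 0)" | "e = (0, 1)" | "e = (-1, 0)" | "e = (0, -1)" using e by (auto simp: units_def)
  then show ?thesis
  proof cases
    case 1
    show ?thesis
    proof (rule exI[of _ "(x + 1 + u, y)"], rule exI[of _ "(x + 1 + w, y + 1)"], intro conjI allI impI)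
      show "b = rectangle_binomial (x + 1 + u, y) (x + 1 + w, y + 1) \<or>
          b = - rectangle_binomial (x + 1 + u, y) (x + 1 + w, y + 1)"
        using s unfolding b_def row_binomial_def rectangle_binomial_def p 1 edge_def front_def shift_def
        by (elim disjE) (simp_all add: mult.commute)
      fix x' y' assume "fst (x + 1 + u, y) \<le> x' \<and> x' < fst (x + 1 + w, y + 1) \<and>
        snd (x + 1 + u, y) \<le> y' \<and> y' < snd (x + 1 + w, y + 1)"
      then show "\<exists>j\<in>{u + 1..w}. (x', y') = p + shift j e"
        by (intro bexI[of _ "x' - x"]) (auto simp: 1 p shift_def)
    qed (use uw in auto)
  next
    case 2
    show ?thesis
    proof (rule exI[of _ "(x, y + 1 + u)"], rule exI[of _ "(x + 1, y + 1 + w)"], intro conjI allI impI)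
      show "b = rectangle_binomial (x, y + 1 + u) (x + 1, y + 1 + w) \<or>
          b = - rectangle_binomial (x, y + 1 + u) (x + 1, y + 1 + w)"
        using s unfolding b_def row_binomial_def rectangle_binomial_def p 2 edge_def front_def shift_def
        by (elim disjE) (simp_all add: mult.commute)
      fix x' y' assume "fst (x, y + 1 + u) \<le> x' \<and> x' < fst (x + 1, y + 1 + w) \<and>
        snd (x, y + 1 + u) \<le> y' \<and> y' < snd (x + 1, y + 1 + w)"
      then show "\<exists>j\<in>{u + 1..w}. (x', y') = p + shift j e"
        by (intro bexI[of _ "y' - y"]) (auto simp: 2 p shift_def)
    qed (use uw in auto)
  next
    case 3
    show ?thesis
    proof (rule exI[of _ "(x - w, y)"], rule exI[of _ "(x - u, y + 1)"], intro conjI allI impI)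
      show "b = rectangle_binomial (x - w, y) (x - u, y + 1) \<or>
          b = - rectangle_binomial (x - w, y) (x - u, y + 1)"
        using s unfolding b_def row_binomial_def rectangle_binomial_def p 3 edge_def front_def shift_def
        by (elim disjE) (simp_all add: mult.commute)
      fix x' y' assume "fst (x - w, y) \<le> x' \<and> x' < fst (x - u, y + 1) \<and>
        snd (x - w, y) \<le> y' \<and> y' < snd (x - u, y + 1)"
      then show "\<exists>j\<in>{u + 1..w}. (x', y') = p + shift j e"
        by (intro bexI[of _ "x - x'"]) (auto simp: 3 p shift_def)
    qed (use uw in auto)
  next
    case 4
    show ?thesis
    proof (rule exI[of _ "(x, y - w)"], rule exI[of _ "(x + 1, y - u)"], intro conjI allI impI)
      show "b = rectangle_binomial (x, y - w) (x + 1, y - u) \<or>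
          b = - rectangle_binomial (x, y - w) (x + 1, y - u)"
        using s unfolding b_def row_binomial_def rectangle_binomial_def p 4 edge_def front_def shift_def
        by (elim disjE) (simp_all add: mult.commute)
      fix x' y' assume "fst (x, y - w) \<le> x' \<and> x' < fst (x + 1, y - u) \<and>
        snd (x, y - w) \<le> y' \<and> y' < snd (x + 1, y - u)"
      then show "\<exists>j\<in>{u + 1..w}. (x', y') = p + shift j e"
        by (intro bexI[of _ "y - y'"]) (auto simp: 4 p shift_def)
    qed (use uw in auto)
  qed
qed

text \<open>The rectangle is read in both directions because the path may traverse it either
  way.\<close>

lemma rectangle_row_binomial:
  fixes p :: "int \<times> int" and m :: int
  assumes e: "e = (1, 0) \<or> e = (0, 1)"
  defines "b \<equiv> rectangle_binomial p (p + (1, 1) + shift m e) :: (point, 'k::field) mpoly"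
  shows "b = row_binomial p e 1 (- 1) m \<or> b = - row_binomial p e 1 (- 1) m"
    and "b = row_binomial (p + shift m e) (- e) 1 (- 1) m \<or> b = - row_binomial (p + shift m e) (- e) 1 (- 1) m"
proof -
  obtain x y where p: "p = (x, y)" by force
  have "e = (1, 0) \<Longrightarrow> b = - row_binomial p e 1 (- 1) m"
    "e = (0, 1) \<Longrightarrow> b = row_binomial p e 1 (- 1) m"
    "e = (1, 0) \<Longrightarrow> b = - row_binomial (p + shift m e) (- e) 1 (- 1) m"
    "e = (0, 1) \<Longrightarrow> b = row_binomial (p + shift m e) (- e) 1 (- 1) m"
    unfolding b_def rectangle_binomial_def row_binomial_def edge_def shift_def front_def p
    by (simp_all add: algebra_simps)
  then show "b = row_binomial p e 1 (- 1) m \<or> b = - row_binomial p e 1 (- 1) m"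
    "b = row_binomial (p + shift m e) (- e) 1 (- 1) m \<or> b = - row_binomial (p + shift m e) (- e) 1 (- 1) m"
    using e by blast+
qed


section \<open>Inner intervals of the polyomino as runs of the path\<close>

locale closed_path_cells = closed_path +
  fixes P :: "point set set"
  assumes P_def: "P = range (\<lambda>k. cell (pt (a k)))"
begin

lemma vertices_P: "vertices P = V"
proof -
  have "cell (pt (a k)) = pt ` verts (a k)" for k
    using positive[of k] by (intro cell_pt_verts) simp_all
  then show ?thesis by (simp add: vertices_def P_def V_def)
qed

lemma cell_in_P: "cell c \<in> P \<longleftrightarrow> (\<exists>k. a k = corner c)"
proof
  assume "cell c \<in> P"
  then obtain k where "cell c = cell (pt (a k))" unfolding P_def by blast
  then have "c = pt (a k)" by (rule cell_inj)
  then have "a k = corner c" using corner_pt[of "a k"] positive[of k] by simp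
  then show "\<exists>k. a k = corner c" by blast
next
  assume "\<exists>k. a k = corner c"
  then show "cell c \<in> P" unfolding P_def by (metis pt_corner rangeI)
qed

lemma inner_interval_iff:
  "inner_interval P b c \<longleftrightarrow> fst b < fst c \<and> snd b < snd c \<and>
    (\<forall>x y. int (fst b) \<le> x \<and> x < int (fst c) \<and> int (snd b) \<le> y \<and> y < int (snd c) \<longrightarrow> (\<exists>k. a k = (x, y)))"
    (is "_ \<longleftrightarrow> ?R")
proof
  assume i: "inner_interval P b c"
  have "\<exists>k. a k = (x, y)"
    if xy: "int (fst b) \<le> x \<and> x < int (fst c) \<and> int (snd b) \<le> y \<and> y < int (snd c)" for x y
  proof -
    have "cell (nat x, nat y) \<subseteq> {b..c}" unfolding cell_subset_interval using xy by auto
    then have "cell (nat x, nat y) \<in> P" using i by (simp add: inner_interval_def)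
    moreover have "corner (nat x, nat y) = (x, y)" using xy by (simp add: corner_def)
    ultimately show ?thesis unfolding cell_in_P by simp
  qed
  then show ?R using i by (simp add: inner_interval_def proper_interval_def)
next
  assume R: ?R
  have sub: "cell u \<in> P" if "cell u \<subseteq> {b..c}" for u
    using R that unfolding cell_subset_interval cell_in_P corner_def by simp
  have in_V: "w \<in> vertices P" if "w \<in> cell u" "cell u \<subseteq> {b..c}" for u w
    using sub[OF that(2)] that(1) by (auto simp: vertices_def)
  have "b \<in> vertices P"
    using R by (intro in_V[of b b]) (simp_all add: mem_cell cell_subset_interval)
  moreover have "c \<in> vertices P"
    using R by (intro in_V[of c "(fst c - 1, snd c - 1)"]) (auto simp: mem_cell cell_subset_interval)
  ultimately show "inner_interval P b c"
    using R sub by (simp add: inner_interval_def proper_interval_def)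
qed

lemma inner_binomials_eq:
  "(inner_binomials P :: (point, 'k::field) mpoly set) = {rectangle_binomial v w | v w.
     0 \<le> fst v \<and> 0 \<le> snd v \<and> fst v < fst w \<and> snd v < snd w \<and>
     (\<forall>x y. fst v \<le> x \<and> x < fst w \<and> snd v \<le> y \<and> y < snd w \<longrightarrow> (\<exists>k. a k = (x, y)))}"
proof -
  have rb: "rectangle_binomial (corner b) (corner c)
      = (var b * var c - var (fst b, snd c) * var (fst c, snd b) :: (point, 'k) mpoly)" for b c
    by (simp add: rectangle_binomial_def pt_def corner_def)
  show ?thesis
  proof (rule Set.set_eqI, rule iffI)
    fix g :: "(point, 'k) mpoly" assume "g \<in> inner_binomials P"
    then obtain b c where "inner_interval P b c" "g = rectangle_binomial (corner b) (corner c)"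
      unfolding inner_binomials_def rb by blast
    then show "g \<in> {rectangle_binomial v w | v w.
        0 \<le> fst v \<and> 0 \<le> snd v \<and> fst v < fst w \<and> snd v < snd w \<and>
        (\<forall>x y. fst v \<le> x \<and> x < fst w \<and> snd v \<le> y \<and> y < snd w \<longrightarrow> (\<exists>k. a k = (x, y)))}"
      unfolding inner_interval_iff
      by (intro CollectI exI[of _ "corner b"] exI[of _ "corner c"]) (simp add: corner_def)
  next
    fix g :: "(point, 'k) mpoly" assume "g \<in> {rectangle_binomial v w | v w.
        0 \<le> fst v \<and> 0 \<le> snd v \<and> fst v < fst w \<and> snd v < snd w \<and>
        (\<forall>x y. fst v \<le> x \<and> x < fst w \<and> snd v \<le> y \<and> y < snd w \<longrightarrow> (\<exists>k. a k = (x, y)))}"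
    then obtain v w where vw: "g = rectangle_binomial v w" "0 \<le> fst v" "0 \<le> snd v"
        "fst v < fst w" "snd v < snd w"
        "\<forall>x y. fst v \<le> x \<and> x < fst w \<and> snd v \<le> y \<and> y < snd w \<longrightarrow> (\<exists>k. a k = (x, y))"
      by blast
    have c: "corner (pt v) = v" "corner (pt w) = w" using vw by (simp_all add: corner_pt)
    have "inner_interval P (pt v) (pt w)"
      unfolding inner_interval_iff using vw by (simp add: pt_def)
    moreover have "g = rectangle_binomial (corner (pt v)) (corner (pt w))" using vw c by simp
    ultimately show "g \<in> inner_binomials P" unfolding inner_binomials_def rb by blast
  qed
qed

lemma inner_binomials_carrier:
  "(inner_binomials P :: (point, 'k::field) mpoly set) \<subseteq> carrier (poly_ring V)"
proof
  fix g :: "(point, 'k) mpoly" assume "g \<in> inner_binomials P"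
  then obtain b c where i: "inner_interval P b c"
    and g: "g = var b * var c - var (fst b, snd c) * var (fst c, snd b)"
    unfolding inner_binomials_def by blast
  have bc: "fst b < fst c" "snd b < snd c" using i by (simp_all add: inner_interval_def proper_interval_def)
  have in_V: "w \<in> V" if "w \<in> cell u" "cell u \<subseteq> {b..c}" for u w
    using i that unfolding inner_interval_def vertices_P[symmetric] vertices_def by blast
  have "(fst b, snd c) \<in> V"
    using bc by (intro in_V[of _ "(fst b, snd c - 1)"]) (auto simp: mem_cell cell_subset_interval)
  moreover have "(fst c, snd b) \<in> V"
    using bc by (intro in_V[of _ "(fst c - 1, snd b)"]) (auto simp: mem_cell cell_subset_interval)
  moreover have "b \<in> V" "c \<in> V" using i by (simp_all add: inner_interval_def vertices_P)
  ultimately show "g \<in> carrier (poly_ring V)" unfolding g by (intro binomial_carrier)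
qed

lemma finite_inner_binomials: "finite (inner_binomials P :: (point, 'k::field) mpoly set)"
proof -
  have "(inner_binomials P :: (point, 'k) mpoly set) \<subseteq>
      (\<lambda>(b, c). var b * var c - var (fst b, snd c) * var (fst c, snd b)) ` (V \<times> V)"
    unfolding inner_binomials_def inner_interval_def vertices_P by (auto intro: rev_image_eqI)
  then show ?thesis using finite_V by (meson finite_SigmaI finite_imageI finite_subset)
qed

lemma cell_binomial_inner: "(cell_binomial (a k) :: (point, 'k::field) mpoly) \<in> inner_binomials P"
proof -
  have "(cell_binomial (a k) :: (point, 'k) mpoly) = rectangle_binomial (a k) (a k + (1, 1))"
    by (cases "a k") (simp add: cell_binomial_def rectangle_binomial_def mult.commute)
  moreover have "(rectangle_binomial (a k) (a k + (1, 1)) :: (point, 'k) mpoly) \<in> inner_binomials P"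
    unfolding inner_binomials_eq
  proof (rule CollectI, rule exI[of _ "a k"], rule exI[of _ "a k + (1, 1)"], intro conjI allI impI)
    fix x y assume "fst (a k) \<le> x \<and> x < fst (a k + (1, 1)) \<and> snd (a k) \<le> y \<and> y < snd (a k + (1, 1))"
    then have "a k = (x, y)" by (simp add: prod_eq_iff)
    then show "\<exists>k. a k = (x, y)" by blast
  qed (use positive[of k] in simp_all)
  ultimately show ?thesis by simp
qed

lemma row_binomial_inner:
  assumes g: "segment i m e" and s: "s = 1 \<or> s = -1" and uw: "u \<in> {-1..int m}" "w \<in> {-1..int m}"
  shows "(row_binomial (a i) e s u w :: (point, 'k::field) mpoly)
    \<in> idl V (inner_binomials P)"
proof -
  note I = genideal_poly_ring[OF inner_binomials_carrier[where 'k = 'k]]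
  note c = poly_ring_ideal_closed[OF I(1)]
  have e: "e \<in> units" using g by (simp add: segment_def)
  have less: "(row_binomial (a i) e s u w :: (point, 'k) mpoly) \<in> idl V (inner_binomials P)"
    if uw': "u < w" "- 1 \<le> u" "w \<le> int m" for u w
  proof -
    obtain v v' where v: "fst v < fst v'" "snd v < snd v'"
      "(row_binomial (a i) e s u w :: (point, 'k) mpoly) = rectangle_binomial v v' \<or>
       (row_binomial (a i) e s u w :: (point, 'k) mpoly) = - rectangle_binomial v v'"
      "\<And>x y. fst v \<le> x \<Longrightarrow> x < fst v' \<Longrightarrow> snd v \<le> y \<Longrightarrow> y < snd v' \<Longrightarrow>
        \<exists>j\<in>{u + 1..w}. (x, y) = a i + shift j e"
      using row_binomial_rectangle[OF e s uw'(1), of "a i", where 'k = 'k] by blast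
    have occ: "\<exists>k. a k = (x, y)" if xy: "fst v \<le> x" "x < fst v'" "snd v \<le> y" "y < snd v'" for x y
    proof -
      obtain j where j: "j \<in> {u + 1..w}" "(x, y) = a i + shift j e" using v(4)[OF xy] by blast
      have "a (i + j) = a i + shift j e"
        using j(1) \<open>- 1 \<le> u\<close> \<open>w \<le> int m\<close> by (intro segmentD[OF g]) auto
      then show ?thesis using j(2) by metis
    qed
    obtain k where "a k = v" using occ[of "fst v" "snd v"] v by auto
    then have "0 \<le> fst v" "0 \<le> snd v" using positive[of k] by simp_all
    then have "(rectangle_binomial v v' :: (point, 'k) mpoly) \<in> inner_binomials P"
      unfolding inner_binomials_eq using v(1,2) occ by blast
    then have "(rectangle_binomial v v' :: (point, 'k) mpoly) \<in> idl V (inner_binomials P)"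
      by (rule subsetD[OF I(2)])
    then show ?thesis using v(3) c(4) by auto
  qed
  consider "u < w" | "u = w" | "w < u" by linarith
  then show ?thesis
  proof cases
    case 1
    then show ?thesis using less uw by auto
  next
    case 2
    then show ?thesis using c(1) by (simp add: row_binomial_def)
  next
    case 3
    then have "(row_binomial (a i) e s w u :: (point, 'k) mpoly) \<in> idl V (inner_binomials P)"
      using less uw by auto
    from c(4)[OF this] show ?thesis by (simp add: row_binomial_def)
  qed
qed

text \<open>An inner interval has width one, since otherwise it would contain a 2 by 2 square of
  cells. As a row of cells it is then a run of the path, started from whichever end the path
  enters.\<close>

lemma inner_binomial_segment:
  assumes "(g :: (point, 'k::field) mpoly) \<in> inner_binomials P"
  shows "\<exists>i m e. segment i m e \<and> (m = 0 \<longrightarrow> e = d i) \<and>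
    (g = row_binomial (a i) e 1 (- 1) (int m) \<or> g = - row_binomial (a i) e 1 (- 1) (int m))"
proof -
  obtain v w where g: "g = rectangle_binomial v w" and vw: "fst v < fst w" "snd v < snd w"
    and occ: "\<And>x y. fst v \<le> x \<Longrightarrow> x < fst w \<Longrightarrow> snd v \<le> y \<Longrightarrow> y < snd w \<Longrightarrow> \<exists>k. a k = (x, y)"
    using assms unfolding inner_binomials_eq by blast
  have "fst w = fst v + 1 \<or> snd w = snd v + 1"
  proof (rule ccontr)
    assume "\<not> ?thesis"
    then have b: "fst v + 1 < fst w" "snd v + 1 < snd w" using vw by auto
    have "\<exists>k. a k = v" "\<exists>k. a k = v + (1, 0)" "\<exists>k. a k = v + (0, 1)" "\<exists>k. a k = v + (1, 1)"
      using occ[of "fst v" "snd v"] occ[of "fst v + 1" "snd v"] occ[of "fst v" "snd v + 1"]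
        occ[of "fst v + 1" "snd v + 1"] b by (cases v; simp)+
    then show False using no_square by blast
  qed
  then obtain m :: nat and u where u: "u = (1, 0) \<or> u = (0, 1)" and w: "w = v + (1, 1) + shift (int m) u"
  proof
    assume "fst w = fst v + 1"
    then have "w = v + (1, 1) + shift (int (nat (snd w - snd v - 1))) (0, 1)"
      using vw by (simp add: shift_def prod_eq_iff)
    then show ?thesis using that by blast
  next
    assume "snd w = snd v + 1"
    then have "w = v + (1, 1) + shift (int (nat (fst w - fst v - 1))) (1, 0)"
      using vw by (simp add: shift_def prod_eq_iff)
    then show ?thesis using that by blast
  qed
  have uu: "u \<in> units" "- u \<in> units" using u by (auto simp: units_def)
  have occ': "\<exists>k. a k = v + shift (int j) u" if "j \<le> m" for j
    using occ[of "fst (v + shift (int j) u)" "snd (v + shift (int j) u)"] u that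
    unfolding w by (cases v) (auto simp: shift_def)
  show ?thesis
  proof (cases "m = 0")
    case True
    \<comment> \<open>A single cell can be read in any direction; \<open>d k\<close> is the one
      required by \<open>segment_cover\<close>.\<close>
    obtain k where k: "a k = v" using occ'[of 0] by (auto simp: shift_simps)
    have "segment k 0 (d k)" using d_units by (simp add: segment_def shift_simps)
    moreover have "g = cell_binomial (a k)"
      using True by (cases v) (simp add: g w k shift_simps cell_binomial_def rectangle_binomial_def mult.commute)
    moreover have "row_binomial (a k) (d k) 1 (- 1) (int 0) = (cell_binomial (a k) :: (point, 'k) mpoly) \<or>
        row_binomial (a k) (d k) 1 (- 1) (int 0) = - (cell_binomial (a k) :: (point, 'k) mpoly)"
      using edge_step_binomial[OF d_units, of 1 "a k" k 0, where 'k = 'k]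
      by (simp add: row_binomial_def shift_simps)
    then have "cell_binomial (a k) = (row_binomial (a k) (d k) 1 (- 1) (int 0) :: (point, 'k) mpoly) \<or>
        cell_binomial (a k) = - (row_binomial (a k) (d k) 1 (- 1) (int 0) :: (point, 'k) mpoly)"
      by (elim disjE) simp_all
    ultimately show ?thesis by blast
  next
    case False
    from straight_path[OF uu(1) occ'] obtain i where
      i: "(\<forall>j\<le>m. a (i + int j) = v + shift (int j) u) \<or> (\<forall>j\<le>m. a (i - int j) = v + shift (int j) u)"
      by blast
    then have ai: "a i = v" by (auto simp: shift_simps)
    from i show ?thesis
    proof
      assume f: "\<forall>j\<le>m. a (i + int j) = v + shift (int j) u"
      then have "segment i m u" using uu by (simp add: segment_def ai)
      moreover have "g = row_binomial (a i) u 1 (- 1) (int m) \<or> g = - row_binomial (a i) u 1 (- 1) (int m)"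
        using rectangle_row_binomial(1)[OF u, of v "int m", where 'k = 'k] by (simp add: g w ai)
      ultimately show ?thesis using False by blast
    next
      assume f: "\<forall>j\<le>m. a (i - int j) = v + shift (int j) u"
      define i' where "i' = i - int m"
      have ai': "a i' = v + shift (int m) u" using f by (simp add: i'_def)
      have "a (i' + int j) = a i' + shift (int j) (- u)" if "j \<le> m" for j
      proof -
        have "a (i' + int j) = v + shift (int (m - j)) u"
          using f[rule_format, of "m - j"] that by (simp add: i'_def of_nat_diff algebra_simps)
        then show ?thesis using that by (simp add: ai' shift_def of_nat_diff prod_eq_iff algebra_simps)
      qed
      then have "segment i' m (- u)" using uu by (simp add: segment_def)
      moreover have "g = row_binomial (a i') (- u) 1 (- 1) (int m) \<or> g = - row_binomial (a i') (- u) 1 (- 1) (int m)"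
        using rectangle_row_binomial(2)[OF u, of v "int m", where 'k = 'k] by (simp add: g w ai')
      ultimately show ?thesis using False by blast
    qed
  qed
qed

lemma knutson: "knutson_ideal (vertices P) (polyomino_ideal P :: (point, 'k::field) mpoly set)"
proof -
  obtain r where r: "monomial_order V r"
    "\<And>i. is_initial_monomial r (factor i :: (point, 'k) mpoly) (factor_init i)"
    using factor_order[where 'k = 'k] by blast
  define f where "f = (\<Prod>i\<in>{0..<n}. factor i :: (point, 'k) mpoly)"
  have mem: "idl V {factor i} \<in> knutson_family (poly_ring V) f" for i
  proof -
    have "factor i = (factor (i mod n) :: (point, 'k) mpoly)"
      using factor_periodic[of "i mod n" "i div n"] by simp
    moreover have "i mod n \<in> {0..<n}" using n_ge by simp
    ultimately show ?thesis
      unfolding f_def using knutson_family_factors[OF r(1) _ _ factor_carrier r(2), of "{0..<n}" "i mod n"]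
      by simp
  qed
  interpret closed_path_family a n f by unfold_locales (rule mem)
  have f: "f \<in> carrier (poly_ring V)"
    unfolding f_def by (intro poly_ring_prod_closed factor_carrier)
  have init: "is_initial_monomial r f (\<Sum>i\<in>{0..<n}. factor_init i)"
    unfolding f_def by (intro initial_monomial_prod[OF r(1)] r(2)) simp
  let ?I = "idl V (inner_binomials P :: (point, 'k) mpoly set)"
  note I = genideal_poly_ring[OF inner_binomials_carrier[where 'k = 'k]]
  \<comment> \<open>This keeps all members of the family that are summed below inside the polyomino
    ideal.\<close>
  have sub: "segment_minors \<subseteq> ?I"
  proof
    fix g assume "g \<in> segment_minors"
    then obtain i m e s where g: "segment i m e" "s = 1 \<or> s = -1"
        "g \<in> minors (edge (a i) e s) (edge (a i) e (- s)) {-1..int m}"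
      unfolding segment_minors_def by blast
    from g(3) obtain u w where "u \<in> {-1..int m}" "w \<in> {-1..int m}" "g = row_binomial (a i) e s u w"
      unfolding minors_def row_binomial_def by blast
    then show "g \<in> ?I" using row_binomial_inner[OF g(1,2)] by blast
  qed
  have "?I \<in> knutson_family (poly_ring V) f"
  proof (rule knutson_family_Union[OF finite_inner_binomials _ inner_binomials_carrier])
    show "inner_binomials P \<noteq> ({} :: (point, 'k) mpoly set)" using cell_binomial_inner by blast
    fix g :: "(point, 'k) mpoly" assume "g \<in> inner_binomials P"
    then obtain i m e where g: "segment i m e" "m = 0 \<Longrightarrow> e = d i"
      "g = row_binomial (a i) e 1 (- 1) (int m) \<or> g = - row_binomial (a i) e 1 (- 1) (int m)"
      using inner_binomial_segment by blast
    obtain H where H: "H \<subseteq> segment_minors" "idl V H \<in> knutson_family (poly_ring V) f"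
      "row_binomial (a i) e 1 (- 1) (int m) \<in> idl V H"
      using segment_cover[OF g(1,2), of 1] unfolding row_binomial_def by blast
    have Hc: "H \<subseteq> carrier (poly_ring V)" using H(1) segment_minors_carrier by (rule subset_trans)
    show "\<exists>H. H \<subseteq> carrier (poly_ring V) \<and> g \<in> idl V H \<and>
        idl V H \<subseteq> ?I \<and> idl V H \<in> knutson_family (poly_ring V) f"
    proof (intro exI[of _ H] conjI)
      show "g \<in> idl V H" by (rule minors_sign[OF Hc H(3) g(3)])
      show "idl V H \<subseteq> ?I"
        using H(1) sub by (intro genideal_poly_ring(3)[OF Hc I(1)]) (rule subset_trans)
    qed (rule Hc H)+
  qed
  then show ?thesis
    unfolding knutson_ideal_def polyomino_ideal_def vertices_P
    using f r(1) init squarefree_init by blast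
qed

end

text \<open>The finite sequence with equal ends is unrolled to a sequence on all integers, so that
  reduction of indices becomes divisibility by the period.\<close>

lemma closed_path_polyomino_cells:
  assumes "closed_path_polyomino P"
  shows "\<exists>a n. closed_path_cells a n P"
proof -
  obtain N A where P: "P = A ` {0..N}" and A: "closed_path_sequence N A" and C: "cell_collection P"
    using assms unfolding closed_path_polyomino_def by blast
  have N: "6 \<le> N" and A0: "A 0 = A N"
    and distinct: "\<And>i j. i \<in> {1..N} \<Longrightarrow> j \<in> {1..N} \<Longrightarrow> A i = A j \<Longrightarrow> i = j"
    and edge: "\<And>i. i < N \<Longrightarrow> A i \<inter> A (i + 1) \<in> cell_edges (A i)"
    and far: "\<And>i j. i < N \<Longrightarrow> j < N \<Longrightarrow> A i \<inter> A j \<noteq> {} \<Longrightarrow>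
      \<exists>\<delta>\<in>{-2..2}. int j = (int i + \<delta>) mod int N"
    using A unfolding closed_path_sequence_def by blast+
  have "\<exists>c. A i = cell c \<and> 1 \<le> fst c \<and> 1 \<le> snd c" if "i \<le> N" for i
    using C that unfolding cell_collection_def P by simp
  then obtain c where c: "\<And>i. i \<le> N \<Longrightarrow> A i = cell (c i) \<and> 1 \<le> fst (c i) \<and> 1 \<le> snd (c i)"
    by metis
  have inj: "i = j" if "A i = A j" "i < N" "j < N" for i j
  proof -
    \<comment> \<open>Distinctness is given for the indices from 1 to \<open>N\<close>, whereas
      residues run from 0 to \<open>N - 1\<close>; the two ends carry the same cell.\<close>
    define i' where "i' = (if i = 0 then N else i)"
    define j' where "j' = (if j = 0 then N else j)"
    have "A i' = A i" "A j' = A j" using A0 by (simp_all add: i'_def j'_def)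
    then have "A i' = A j'" using that by simp
    then have "i' = j'" using that N by (intro distinct) (auto simp: i'_def j'_def)
    then show ?thesis using that by (auto simp: i'_def j'_def split: if_splits)
  qed
  define \<rho> where "\<rho> k = nat (k mod int N)" for k
  have \<rho>: "\<rho> k < N" "int (\<rho> k) = k mod int N" for k using N by (simp_all add: \<rho>_def nat_less_iff)
  define a where "a k = corner (c (\<rho> k))" for k
  have cell_a: "cell (pt (a k)) = A (\<rho> k)" for k using c[of "\<rho> k"] \<rho>(1)[of k] by (simp add: a_def)
  have succ: "A (\<rho> (k + 1)) = A (\<rho> k + 1)" for k
  proof (cases "\<rho> k + 1 = N")
    case True
    have "int (\<rho> (k + 1)) = (int (\<rho> k) + 1) mod int N"
      using \<rho>(2)[of "k + 1"] by (simp add: \<rho>(2) mod_add_left_eq)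
    also have "int (\<rho> k) + 1 = int N" using True by linarith
    finally have "\<rho> (k + 1) = 0" by simp
    then show ?thesis using True A0 by simp
  next
    case False
    then have "int (\<rho> k) + 1 < int N" using \<rho>(1)[of k] by simp
    then have "int (\<rho> (k + 1)) = int (\<rho> k) + 1"
      using \<rho>(2)[of "k + 1"] \<rho>(2)[of k] by (metis mod_add_left_eq mod_pos_pos_trivial of_nat_0_le_iff add_nonneg_nonneg zero_le_one)
    then have "\<rho> (k + 1) = \<rho> k + 1" by linarith
    then show ?thesis by simp
  qed
  have "closed_path_cells a (int N) P"
  proof
    show "6 \<le> int N" using N by simp
    show "a (k + int N) = a k" for k by (simp add: a_def \<rho>_def)
    show "a (k + 1) - a k \<in> units" for k
    proof -
      have e: "cell (c (\<rho> k)) \<inter> cell (c (\<rho> (k + 1))) \<in> cell_edges (cell (c (\<rho> k)))"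
        using edge[OF \<rho>(1)[of k]] succ[of k] c[of "\<rho> k"] c[of "\<rho> (k + 1)"] \<rho>(1)[of k] \<rho>(1)[of "k + 1"]
        by simp
      have "c (\<rho> k) \<noteq> c (\<rho> (k + 1))"
      proof
        assume "c (\<rho> k) = c (\<rho> (k + 1))"
        then have "A (\<rho> k) = A (\<rho> (k + 1))" using c[of "\<rho> k"] c[of "\<rho> (k + 1)"] \<rho>(1) by (simp add: less_imp_le)
        then have "\<rho> k = \<rho> (k + 1)" using inj \<rho>(1) by blast
        then have "k mod int N = (k + 1) mod int N" using \<rho>(2) by metis
        then have "int N dvd 1" by (metis add_diff_cancel_left' mod_eq_dvd_iff)
        then show False using N by simp
      qed
      then show ?thesis using common_edge_units[OF e] by (simp add: a_def)
    qed
    show "int N dvd i - j" if "a i = a j" for i j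
    proof -
      have "A (\<rho> i) = A (\<rho> j)" using cell_a[of i] cell_a[of j] that by simp
      then have "\<rho> i = \<rho> j" using inj \<rho>(1) by blast
      then show ?thesis using \<rho>(2) by (metis mod_eq_dvd_iff)
    qed
    show pos: "1 \<le> fst (a k)" "1 \<le> snd (a k)" for k
      using c[of "\<rho> k"] \<rho>(1)[of k] by (simp_all add: a_def corner_def)
    show "\<exists>\<delta>\<in>{-2..2}. int N dvd i - j - \<delta>" if "verts (a i) \<inter> verts (a j) \<noteq> {}" for i j
    proof -
      have "cell (pt (a k)) = pt ` verts (a k)" for k using pos[of k] by (intro cell_pt_verts) simp_all
      then have "A (\<rho> j) \<inter> A (\<rho> i) \<noteq> {}" using that cell_a by (metis Int_emptyI disjoint_iff image_eqI)
      then obtain \<delta> where \<delta>: "\<delta> \<in> {-2..2}" "int (\<rho> i) = (int (\<rho> j) + \<delta>) mod int N"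
        using far[OF \<rho>(1) \<rho>(1)] by blast
      then have "i mod int N = (j + \<delta>) mod int N" by (simp add: \<rho>(2) mod_add_left_eq)
      then have "int N dvd i - (j + \<delta>)" by (simp add: mod_eq_dvd_iff)
      then show ?thesis using \<delta>(1) by (intro bexI[of _ \<delta>]) (simp_all add: diff_diff_eq)
    qed
    show "P = range (\<lambda>k. cell (pt (a k)))"
    proof (rule Set.set_eqI, rule iffI)
      fix X assume "X \<in> P"
      then obtain i where i: "i \<le> N" "X = A i" by (auto simp: P)
      define i' where "i' = (if i = N then 0 else i)"
      have "i' < N" "X = A i'" using i A0 N by (auto simp: i'_def)
      then have "X = cell (pt (a (int i')))" by (simp add: cell_a \<rho>_def)
      then show "X \<in> range (\<lambda>k. cell (pt (a k)))" by blast
    next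
      fix X assume "X \<in> range (\<lambda>k. cell (pt (a k)))"
      then show "X \<in> P" using \<rho>(1) unfolding cell_a P by (auto simp: less_imp_le)
    qed
  qed
  then show ?thesis by blast
qed

theorem proposition3p11:
  fixes P :: "point set set"
  assumes "closed_path_polyomino P"
  shows "knutson_ideal (vertices P) (polyomino_ideal P :: (point, 'k::field) mpoly set)"
  using closed_path_polyomino_cells[OF assms] closed_path_cells.knutson by blast

end
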